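(* Let $f,g_1,\dots,g_m\in\mathbb{R}[x]$ be such that $f$ is non-negative on $S(g)$ with $g:=(g_1,\dots,g_m)$. Then there exists $q\in P(g)[x,\bar\lambda]$ such that $\lambda_0(f-q)$ vanishes on $V(h_{\mathrm{FJ}})$. Moreover, if $S(g)$ satisfies the Archimedean condition, one can take $q\in Q(g)[x,\bar\lambda]$.
   Context: Let $n,m\ge 1$, $x=(x_1,\dots,x_n)$ and $\bar\lambda:=(\lambda_0,\lambda_1,\dots,\lambda_m)$ be vectors of variables; polynomials in $x$ are also regarded as polynomials in $(x,\bar\lambda)$. $\nabla p$ is the (column) gradient with respect to $x$. $S(g):=\{x\in\mathbb{R}^n : g_j(x)\ge 0,\ j=1,\dots,m\}$. For a vector of variables $z$ ($z=x$ or $z=(x,\bar\lambda)$), $\Sigma^2[z]$ is the cone of sums of squares of polynomials in $\mathbb{R}[z]$, $Q(g)[z]:=\Sigma^2[z]+\sum_{j=1}^m g_j\Sigma^2[z]$ and $P(g)[z]:=\sum_{\alpha\in\{0,1\}^m}g^\alpha\Sigma^2[z]$, with $g^\alpha:=g_1^{\alpha_1}\cdots g_m^{\alpha_m}$. $S(g)$ satisfies the Archimedean condition if there is $R>0$ with $R-x_1^2-\dots-x_n^2\in Q(g)[x]$. For a tuple $h$ of polynomials, $V(h)$ is the set of its common real zeros. The tuple $h_{\mathrm{FJ}}$ of $n+m+1$ polynomials in $\mathbb{R}[x,\bar\lambda]$ is $$h_{\mathrm{FJ}}:=\Big(\lambda_0\nabla f-\sum_{j=1}^m\lambda_j\nabla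 g_j,\ \lambda_1g_1,\dots,\lambda_mg_m,\ 1-\sum_{j=0}^m\lambda_j^2\Big).$$ *)

theory Defs
  imports "HOL-Analysis.Analysis" "HOL-Library.Poly_Mapping"
begin

text \<open>A monomial is a finitely supported exponent map, a polynomial a finitely supported map from
  monomials to coefficients. With the convolution product this is the ring of formal polynomials
  whose variables are the elements of the index type.\<close>

type_synonym 'v mpoly = "('v \<Rightarrow>\<^sub>0 nat) \<Rightarrow>\<^sub>0 real"

definition Const :: "real \<Rightarrow> 'v mpoly" where
  "Const c = Poly_Mapping.single 0 c"

definition Var :: "'v \<Rightarrow> 'v mpoly" where
  "Var v = Poly_Mapping.single (Poly_Mapping.single v 1) 1"

text \<open>Substitution of \<open>a v\<close> for the variable \<open>v\<close>, where \<open>c\<close> embeds the coefficients.\<close>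

definition poly_subst :: "(real \<Rightarrow> 'r::comm_semiring_1) \<Rightarrow> ('v \<Rightarrow> 'r) \<Rightarrow> 'v mpoly \<Rightarrow> 'r" where
  "poly_subst c a p = (\<Sum>t\<in>Poly_Mapping.keys p.
     c (Poly_Mapping.lookup p t) *
     (\<Prod>v\<in>Poly_Mapping.keys t. a v ^ Poly_Mapping.lookup t v))"

definition peval :: "'v mpoly \<Rightarrow> real ^ 'v \<Rightarrow> real" where
  "peval p x = poly_subst (\<lambda>c. c) (\<lambda>v. x $ v) p"

text \<open>The formal partial derivative. The truncated subtraction of exponents is harmless: where it
  truncates, the coefficient is 0.\<close>

definition pdiff :: "'v \<Rightarrow> 'v mpoly \<Rightarrow> 'v mpoly" where
  "pdiff v p = (\<Sum>t\<in>Poly_Mapping.keys p.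
     Poly_Mapping.single (t - Poly_Mapping.single v 1)
       (real (Poly_Mapping.lookup t v) * Poly_Mapping.lookup p t))"

definition sos :: "'v mpoly set" where
  "sos = {p. \<exists>(k::nat) q. p = (\<Sum>i<k. (q i)\<^sup>2)}"

definition quad_module :: "('m::finite \<Rightarrow> 'v mpoly) \<Rightarrow> 'v mpoly set" where
  "quad_module g = {s0 + (\<Sum>j\<in>UNIV. g j * s j) | s0 s. s0 \<in> sos \<and> (\<forall>j. s j \<in> sos)}"

definition preorder_cone :: "('m::finite \<Rightarrow> 'v mpoly) \<Rightarrow> 'v mpoly set" where
  "preorder_cone g =
    {\<Sum>\<alpha>\<in>UNIV \<rightarrow> {0, 1 :: nat}. (\<Prod>j\<in>UNIV. g j ^ \<alpha> j) * s \<alpha> | s. \<forall>\<alpha>. s \<alpha> \<in> sos}"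

definition nonneg_set :: "('m \<Rightarrow> 'v mpoly) \<Rightarrow> (real ^ 'v) set" where
  "nonneg_set g = {x. \<forall>j. peval (g j) x \<ge> 0}"

definition archimedean :: "('m::finite \<Rightarrow> 'v::finite mpoly) \<Rightarrow> bool" where
  "archimedean g \<longleftrightarrow> (\<exists>R>0. Const R - (\<Sum>i\<in>UNIV. (Var i)\<^sup>2) \<in> quad_module g)"

definition zero_set :: "('i \<Rightarrow> 'v mpoly) \<Rightarrow> (real ^ 'v) set" where
  "zero_set h = {z. \<forall>i. peval (h i) z = 0}"

text \<open>The variables \<open>(x, \<lambda>\<^sub>0, \<lambda>\<^sub>1, \<dots>, \<lambda>\<^sub>m)\<close> are indexed by \<open>'n + 'm option\<close>: \<open>Inl i\<close> is \<open>x\<^sub>i\<close>,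
  \<open>Inr None\<close> is \<open>\<lambda>\<^sub>0\<close> and \<open>Inr (Some j)\<close> is \<open>\<lambda>\<^sub>j\<close>.\<close>

type_synonym ('n, 'm) var = "'n + 'm option"

definition lam :: "'m option \<Rightarrow> ('n, 'm) var mpoly" where
  "lam k = Var (Inr k)"

text \<open>A polynomial in \<open>x\<close> regarded as a polynomial in \<open>x\<close> and the multipliers.\<close>

definition lift_poly :: "'n mpoly \<Rightarrow> ('n, 'm) var mpoly" where
  "lift_poly p = poly_subst Const (\<lambda>i. Var (Inl i)) p"

text \<open>The \<open>n + m + 1\<close> entries of the tuple are indexed by \<open>'n + 'm + unit\<close>.\<close>

fun h_FJ :: "'n mpoly \<Rightarrow> ('m::finite \<Rightarrow> 'n mpoly) \<Rightarrow> 'n + 'm + unit \<Rightarrow> ('n, 'm) var mpoly" where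
  "h_FJ f g (Inl i) =
     lam None * lift_poly (pdiff i f) - (\<Sum>j\<in>UNIV. lam (Some j) * lift_poly (pdiff i (g j)))"
| "h_FJ f g (Inr (Inl j)) = lam (Some j) * lift_poly (g j)"
| "h_FJ f g (Inr (Inr u)) = 1 - (\<Sum>k\<in>UNIV. (lam k)\<^sup>2)"

end

theory Submission
  imports Defs "HOL-Algebra.Algebraic_Closure_Type"
begin

text \<open>On the points of \<open>V(h\<^sub>F\<^sub>J)\<close> with \<open>\<lambda>\<^sub>0 \<noteq> 0\<close> the polynomial \<open>f\<close> takes only finitely many values. Otherwise some
  prime ideal of \<open>\<real>[x, \<lambda>]\<close> contains \<open>h\<^sub>F\<^sub>J\<close>, avoids \<open>\<lambda>\<^sub>0\<close> and leaves \<open>f\<close> transcendental, so modulo this ideal there is a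
  derivation \<open>D\<close> with \<open>D f \<noteq> 0\<close>; but \<open>\<lambda>\<^sub>0 D f = \<Sum>\<^sub>j \<lambda>\<^sub>j D g\<^sub>j = 0\<close>, because \<open>\<lambda>\<^sub>j g\<^sub>j = 0\<close> forces \<open>\<lambda>\<^sub>j = 0\<close> or \<open>D g\<^sub>j = 0\<close>.
  By interpolation it suffices to represent each value \<open>v\<close> on its level set. For \<open>v \<ge> 0\<close> the constant \<open>v\<close> is a square.
  For \<open>v < 0\<close> the system \<open>g \<ge> 0\<close>, \<open>f = v\<close> has no solution, and the Positivstellensatz gives \<open>p\<close> in the cone with \<open>p = - 1\<close>
  wherever \<open>f = v\<close>, so that \<open>\<bar>v\<bar> p\<close> represents \<open>v\<close>. In the Archimedean case a maximal quadratic module is the set of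
  polynomials that are nonnegative at a real point, up to infinitesimals. In general a maximal proper preordering yields a
  real closed field with a solution, and a solution over the reals is found by eliminating one variable at a time
  with the algorithm of Cohen and Hoermander.\<close>

hide_const (open) Polynomials.degree Polynomials.lead_coeff up_ring.coeff up_ring.monom Module.smult Coset.order

section \<open>Polynomials and their evaluation\<close>

text \<open>Evaluation, lifting, residue maps and specializations of coefficients are all handled
  through this one interface.\<close>

locale rhom =
  fixes h :: "'a::comm_ring_1 \<Rightarrow> 'b::comm_ring_1"
  assumes one [simp]: "h 1 = 1"
    and add [simp]: "h (x + y) = h x + h y"
    and mult [simp]: "h (x * y) = h x * h y"
begin

lemma zero [simp]: "h 0 = 0"
  using add[of 0 0] by simp

lemma uminus [simp]: "h (- x) = - h x"
  using add[of x "- x"] by (simp add: eq_neg_iff_add_eq_0 add.commute)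

lemma diff [simp]: "h (x - y) = h x - h y"
  using add[of x "- y"] by simp

lemma power [simp]: "h (x ^ n) = h x ^ n"
  by (induction n) auto

lemma sum: "h (\<Sum>i\<in>S. f i) = (\<Sum>i\<in>S. h (f i))"
  by (induction S rule: infinite_finite_induct) auto

lemma prod: "h (\<Prod>i\<in>S. f i) = (\<Prod>i\<in>S. h (f i))"
  by (induction S rule: infinite_finite_induct) auto

end

lemma rhom_id: "rhom (\<lambda>x. x)"
  by (simp add: rhom_def)

lemma rhom_Const: "rhom Const"
  by unfold_locales (auto simp: Const_def single_add mult_single)

interpretation Const: rhom Const
  by (rule rhom_Const)

lemma mpoly_sum_single: "(p :: 'v mpoly) =
    (\<Sum>t\<in>Poly_Mapping.keys p. Poly_Mapping.single t (Poly_Mapping.lookup p t))"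
proof (rule poly_mapping_eqI)
  fix k
  show "Poly_Mapping.lookup p k = Poly_Mapping.lookup
      (\<Sum>t\<in>Poly_Mapping.keys p. Poly_Mapping.single t (Poly_Mapping.lookup p t)) k"
    by (auto simp: lookup_sum lookup_single when_def in_keys_iff)
qed

lemma Var_power: "Var v ^ n = Poly_Mapping.single (Poly_Mapping.single v n) 1"
  by (induction n) (auto simp: Var_def mult_single simp flip: single_add)

lemma prod_single: "finite S \<Longrightarrow>
  (\<Prod>v\<in>S. Poly_Mapping.single (e v) (1::real)) = Poly_Mapping.single (\<Sum>v\<in>S. e v) 1"
  by (induction S rule: finite_induct) (auto simp: mult_single)

lemma monomial_sum_single: "(t :: 'v \<Rightarrow>\<^sub>0 nat) =
    (\<Sum>v\<in>Poly_Mapping.keys t. Poly_Mapping.single v (Poly_Mapping.lookup t v))"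
  by (rule poly_mapping_eqI) (auto simp: lookup_sum lookup_single when_def in_keys_iff)

lemma single_eq: "Poly_Mapping.single t c =
    Const c * (\<Prod>v\<in>Poly_Mapping.keys t. Var v ^ Poly_Mapping.lookup t v)"
  by (simp add: Var_power prod_single flip: monomial_sum_single)
     (simp add: Const_def mult_single)

text \<open>With \<open>U = UNIV\<close> this gives the induction \<open>mpoly_induct\<close>. With
  \<open>U\<close> growing by one variable it supplies the coefficient rings for the induction in
  \<open>artin_lang\<close>, inside one polynomial type.\<close>

inductive_set gen_ring :: "'v set \<Rightarrow> 'v mpoly set" for U where
  Const: "Const c \<in> gen_ring U"
| Var: "v \<in> U \<Longrightarrow> Var v \<in> gen_ring U"
| add: "p \<in> gen_ring U \<Longrightarrow> q \<in> gen_ring U \<Longrightarrow> p + q \<in> gen_ring U"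
| mult: "p \<in> gen_ring U \<Longrightarrow> q \<in> gen_ring U \<Longrightarrow> p * q \<in> gen_ring U"

lemma gen_ring_power: "p \<in> gen_ring U \<Longrightarrow> p ^ n \<in> gen_ring U"
  by (induction n) (auto intro: gen_ring.intros simp flip: Const.one)

lemma gen_ring_UNIV: "p \<in> gen_ring UNIV"
proof -
  have "(\<Prod>v\<in>S. Var v ^ e v) \<in> gen_ring UNIV" if "finite S" for S :: "'a set" and e
    using that by (induction S rule: finite_induct)
      (auto intro: gen_ring.intros gen_ring_power simp flip: Const.one)
  then have "Poly_Mapping.single t c \<in> gen_ring UNIV" for t :: "'a \<Rightarrow>\<^sub>0 nat" and c
    by (simp add: single_eq gen_ring.intros)
  moreover have "(\<Sum>t\<in>S. h t) \<in> gen_ring UNIV"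
    if "finite S" "\<And>t. h t \<in> gen_ring UNIV" for S :: "('a \<Rightarrow>\<^sub>0 nat) set" and h :: "_ \<Rightarrow> 'a mpoly"
    using that by (induction S rule: finite_induct)
      (auto intro: gen_ring.intros simp flip: Const.zero)
  ultimately show ?thesis
    by (subst mpoly_sum_single) auto
qed

lemma mpoly_induct [case_names Const Var add mult]:
  assumes "\<And>c. P (Const c)" "\<And>v. P (Var v)"
    and "\<And>p q. P p \<Longrightarrow> P q \<Longrightarrow> P (p + q)" "\<And>p q. P p \<Longrightarrow> P q \<Longrightarrow> P (p * q)"
  shows "P p"
  using gen_ring_UNIV[of p] by induction (auto intro: assms)

section \<open>Substitution as a ring homomorphism\<close>

lemma poly_subst_superset:
  assumes "c 0 = 0" "finite S" "Poly_Mapping.keys p \<subseteq> S"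
  shows "poly_subst c a p = (\<Sum>t\<in>S. c (Poly_Mapping.lookup p t) *
     (\<Prod>v\<in>Poly_Mapping.keys t. a v ^ Poly_Mapping.lookup t v))"
  unfolding poly_subst_def using assms
  by (intro sum.mono_neutral_left) (auto simp: in_keys_iff)

lemma poly_subst_add:
  assumes "rhom c"
  shows "poly_subst c a (p + q) = poly_subst c a p + poly_subst c a q"
proof -
  interpret rhom c by fact
  let ?S = "Poly_Mapping.keys p \<union> Poly_Mapping.keys q"
  have "Poly_Mapping.keys (p + q) \<subseteq> ?S"
    by (rule Poly_Mapping.keys_add)
  then show ?thesis
    by (simp add: poly_subst_superset[of c ?S] lookup_add algebra_simps sum.distrib)
qed

lemma poly_subst_sum:
  assumes "rhom c"
  shows "poly_subst c a (\<Sum>i\<in>S. p i) = (\<Sum>i\<in>S. poly_subst c a (p i))"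
proof -
  have "poly_subst c a 0 = 0"
    by (simp add: poly_subst_def)
  then show ?thesis
    by (induction S rule: infinite_finite_induct) (auto simp: poly_subst_add[OF assms])
qed

lemma poly_subst_single:
  assumes "rhom c"
  shows "poly_subst c a (Poly_Mapping.single t x) =
    c x * (\<Prod>v\<in>Poly_Mapping.keys t. a v ^ Poly_Mapping.lookup t v)"
  by (subst poly_subst_superset[of c "{t}"]) (auto simp: rhom.zero[OF assms])

lemma monomial_value_add:
  fixes a :: "'v \<Rightarrow> 'r::comm_ring_1"
  shows "(\<Prod>v\<in>Poly_Mapping.keys (s + t). a v ^ Poly_Mapping.lookup (s + t) v) =
    (\<Prod>v\<in>Poly_Mapping.keys s. a v ^ Poly_Mapping.lookup s v) *
    (\<Prod>v\<in>Poly_Mapping.keys t. a v ^ Poly_Mapping.lookup t v)"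
proof -
  let ?S = "Poly_Mapping.keys s \<union> Poly_Mapping.keys t"
  have eq: "(\<Prod>v\<in>Poly_Mapping.keys u. a v ^ Poly_Mapping.lookup u v) =
      (\<Prod>v\<in>?S. a v ^ Poly_Mapping.lookup u v)" if "Poly_Mapping.keys u \<subseteq> ?S" for u
    using that by (intro prod.mono_neutral_left) (auto simp: in_keys_iff)
  show ?thesis
    by (subst (1 2 3) eq) (auto simp: lookup_add power_add prod.distrib Poly_Mapping.keys_add
        dest: subsetD[OF Poly_Mapping.keys_add])
qed

lemma rhom_poly_subst:
  assumes "rhom c"
  shows "rhom (poly_subst c a)"
proof -
  interpret rhom c by fact
  have s: "poly_subst c a (Poly_Mapping.single s x * Poly_Mapping.single t y) =
      poly_subst c a (Poly_Mapping.single s x) * poly_subst c a (Poly_Mapping.single t y)"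
    for s t x y
    by (simp add: mult_single poly_subst_single[OF assms] monomial_value_add)
  have m: "poly_subst c a (p * q) = poly_subst c a p * poly_subst c a q" for p q
  proof -
    obtain x K where p: "p = (\<Sum>t\<in>K. Poly_Mapping.single t (x t))"
      using mpoly_sum_single by blast
    obtain y L where q: "q = (\<Sum>t\<in>L. Poly_Mapping.single t (y t))"
      using mpoly_sum_single by blast
    show ?thesis
      unfolding p q sum_product poly_subst_sum[OF assms] s ..
  qed
  show ?thesis
    by unfold_locales
      (use m poly_subst_add[OF assms] poly_subst_single[OF assms, of a 0 1] in simp_all)
qed

lemma poly_subst_Const [simp]: "rhom c \<Longrightarrow> poly_subst c a (Const x) = c x"
  by (simp add: Const_def poly_subst_single)

lemma poly_subst_Var [simp]: "rhom c \<Longrightarrow> poly_subst c a (Var v) = a v"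
  using rhom.one[of c] by (simp add: Var_def poly_subst_single)

lemma rhom_peval: "rhom (\<lambda>p. peval p x)"
  unfolding peval_def by (rule rhom_poly_subst[OF rhom_id])

interpretation peval: rhom "\<lambda>p. peval p x" for x
  by (rule rhom_peval)

lemma peval_Const [simp]: "peval (Const c) x = c"
  by (simp add: peval_def rhom_id)

lemma peval_Var [simp]: "peval (Var v) x = x $ v"
  by (simp add: peval_def rhom_id)

interpretation lift_poly: rhom lift_poly
  unfolding lift_poly_def by (rule rhom_poly_subst[OF rhom_Const])

lemma lift_poly_Const [simp]: "lift_poly (Const c) = Const c"
  by (simp add: lift_poly_def rhom_Const)

lemma lift_poly_Var [simp]: "lift_poly (Var i) = Var (Inl i)"
  by (simp add: lift_poly_def rhom_Const)

lemma peval_lift_poly: "peval (lift_poly p) z = peval p (\<chi> i. z $ Inl i)"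
  by (induction p rule: mpoly_induct) auto

section \<open>The formal partial derivative\<close>

lemma pdiff_superset:
  assumes "finite S" "Poly_Mapping.keys p \<subseteq> S"
  shows "pdiff v p = (\<Sum>t\<in>S. Poly_Mapping.single (t - Poly_Mapping.single v 1)
       (real (Poly_Mapping.lookup t v) * Poly_Mapping.lookup p t))"
  unfolding pdiff_def using assms
  by (intro sum.mono_neutral_left) (auto simp: in_keys_iff)

lemma pdiff_add: "pdiff v (p + q) = pdiff v p + pdiff v q"
proof -
  let ?S = "Poly_Mapping.keys p \<union> Poly_Mapping.keys q"
  have "Poly_Mapping.keys (p + q) \<subseteq> ?S"
    by (rule Poly_Mapping.keys_add)
  then show ?thesis
    by (simp add: pdiff_superset[of ?S] lookup_add algebra_simps single_add sum.distrib)
qed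

lemma pdiff_sum: "pdiff v (\<Sum>i\<in>S. p i) = (\<Sum>i\<in>S. pdiff v (p i))"
proof -
  have "pdiff v 0 = 0"
    by (simp add: pdiff_def)
  then show ?thesis
    by (induction S rule: infinite_finite_induct) (auto simp: pdiff_add)
qed

lemma pdiff_single: "pdiff v (Poly_Mapping.single t c) =
    Poly_Mapping.single (t - Poly_Mapping.single v 1) (real (Poly_Mapping.lookup t v) * c)"
  by (subst pdiff_superset[of "{t}"]) auto

lemma pdiff_mult: "pdiff v (p * q) = pdiff v p * q + p * pdiff v q"
proof -
  have minus: "(s - Poly_Mapping.single v 1) + t = s + t - Poly_Mapping.single v 1"
    if "Poly_Mapping.lookup s v > 0" for s t :: "'a \<Rightarrow>\<^sub>0 nat"
    using that by (intro poly_mapping_eqI) (auto simp: lookup_add lookup_minus lookup_single when_def)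
  \<comment> \<open>Where \<open>v\<close> does not occur in \<open>s\<close> the exponents may
    differ, but then the coefficient is 0 on both sides.\<close>
  have l: "Poly_Mapping.single ((s - Poly_Mapping.single v 1) + t)
        (real (Poly_Mapping.lookup s v) * z) =
      Poly_Mapping.single (s + t - Poly_Mapping.single v 1) (real (Poly_Mapping.lookup s v) * z)"
    for s t z
    by (cases "Poly_Mapping.lookup s v > 0") (auto simp only: minus, simp)
  have r: "Poly_Mapping.single (s + (t - Poly_Mapping.single v 1))
        (real (Poly_Mapping.lookup t v) * z) =
      Poly_Mapping.single (s + t - Poly_Mapping.single v 1) (real (Poly_Mapping.lookup t v) * z)"
    for s t z
    using l[of t s z] by (simp add: add.commute)
  have s: "pdiff v (Poly_Mapping.single s x * Poly_Mapping.single t y) =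
      pdiff v (Poly_Mapping.single s x) * Poly_Mapping.single t y +
      Poly_Mapping.single s x * pdiff v (Poly_Mapping.single t y)" for s t x y
    using l[of s t "x * y"] r[of s t "x * y"]
    by (simp add: pdiff_single mult_single lookup_add algebra_simps flip: single_add)
  obtain a K where p: "p = (\<Sum>t\<in>K. Poly_Mapping.single t (a t))"
    using mpoly_sum_single by blast
  obtain b L where q: "q = (\<Sum>t\<in>L. Poly_Mapping.single t (b t))"
    using mpoly_sum_single by blast
  show ?thesis
    unfolding p q sum_product pdiff_sum s sum.distrib ..
qed

lemma pdiff_Const [simp]: "pdiff v (Const c) = 0"
  by (simp add: Const_def pdiff_single)

lemma pdiff_Var: "pdiff v (Var w) = (if v = w then 1 else 0)"
  by (simp add: Var_def pdiff_single lookup_single when_def)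

section \<open>Sums of squares, orderings and quadratic modules\<close>

lemma Const_mult_eq: "a * b = c \<Longrightarrow> Const a * Const b = Const c"
  by (simp flip: Const.mult)

lemma Const_numeral [simp]: "Const (numeral n) = numeral n"
proof -
  have "Const (of_nat k) = of_nat k" for k
    by (induction k) auto
  from this[of "numeral n"] show ?thesis
    by simp
qed

lemma sos_zero: "0 \<in> sos"
  unfolding sos_def by (intro CollectI exI[of _ 0]) simp

lemma sos_add_square:
  assumes "s \<in> sos"
  shows "s + q\<^sup>2 \<in> sos"
proof -
  obtain k r where "s = (\<Sum>i<(k::nat). (r i)\<^sup>2)"
    using assms by (auto simp: sos_def)
  then have "s + q\<^sup>2 = (\<Sum>i<Suc k. ((r(k := q)) i)\<^sup>2)"
    by simp
  then show ?thesis
    unfolding sos_def by blast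
qed

lemma sos_induct [consumes 1, case_names zero add]:
  assumes "s \<in> sos" "P 0" "\<And>s q. s \<in> sos \<Longrightarrow> P s \<Longrightarrow> P (s + q\<^sup>2)"
  shows "P s"
proof -
  have "(\<Sum>i<k. (q i)\<^sup>2) \<in> sos \<and> P (\<Sum>i<k. (q i)\<^sup>2)" for k :: nat and q
    by (induction k) (auto simp: sos_zero sos_add_square assms)
  then show ?thesis
    using assms(1) by (auto simp: sos_def)
qed

lemma sos_square: "q\<^sup>2 \<in> sos"
  using sos_add_square[OF sos_zero] by simp

lemma sos_one: "1 \<in> sos"
  using sos_square[of 1] by simp

lemma sos_add:
  assumes "s \<in> sos" "t \<in> sos"
  shows "s + t \<in> sos"
  using assms(2) by (induction rule: sos_induct) (auto simp: assms(1) sos_add_square simp flip: add.assoc)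

lemma sos_mult_square:
  assumes "s \<in> sos"
  shows "a * a * s \<in> sos"
  using assms
proof (induction rule: sos_induct)
  case (add s q)
  have "a * a * (s + q\<^sup>2) = a * a * s + (a * q)\<^sup>2"
    by (simp add: algebra_simps power2_eq_square)
  then show ?case
    using add.IH sos_add_square by metis
qed (simp add: sos_zero)

lemma sos_mult:
  assumes "s \<in> sos" "t \<in> sos"
  shows "s * t \<in> sos"
  using assms(1)
proof (induction rule: sos_induct)
  case (add s q)
  have "(s + q\<^sup>2) * t = s * t + q * q * t"
    by (simp add: algebra_simps power2_eq_square)
  then show ?case
    using add.IH sos_mult_square[OF assms(2)] sos_add by metis
qed (simp add: sos_zero)

lemma sos_Const: "r \<ge> 0 \<Longrightarrow> Const r \<in> sos"
  using sos_square[of "Const (sqrt r)"] by (simp flip: Const.power)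

text \<open>Zorn's lemma in the form shared by preorderings, quadratic modules, real cones and
  ideals. Their closure conditions involve at most two members at a time, so it is enough that any
  two elements of the union lie in a common member of the chain.\<close>

lemma ex_maximal_superset:
  assumes "R T"
    and union: "\<And>C. C \<noteq> {} \<Longrightarrow> (\<And>Z. Z \<in> C \<Longrightarrow> R Z) \<Longrightarrow>
      (\<And>x y. x \<in> \<Union>C \<Longrightarrow> y \<in> \<Union>C \<Longrightarrow> \<exists>Z\<in>C. x \<in> Z \<and> y \<in> Z) \<Longrightarrow> R (\<Union>C)"
  obtains M where "R M" "T \<subseteq> M" "\<And>Q. R Q \<Longrightarrow> M \<subseteq> Q \<Longrightarrow> Q = M"
proof -
  let ?A = "{Q. R Q \<and> T \<subseteq> Q}"
  have "\<exists>M\<in>?A. \<forall>Z\<in>?A. M \<subseteq> Z \<longrightarrow> Z = M"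
  proof (rule subset_Zorn_nonempty)
    show "?A \<noteq> {}"
      using assms(1) by blast
  next
    fix C
    assume C: "C \<noteq> {}" "subset.chain ?A C"
    then have A: "\<And>Z. Z \<in> C \<Longrightarrow> Z \<in> ?A"
      by (auto simp: subset_chain_def)
    have "R (\<Union>C)"
    proof (rule union[OF C(1)])
      show "R Z" if "Z \<in> C" for Z
        using A[OF that] by simp
    next
      fix x y
      assume "x \<in> \<Union>C" "y \<in> \<Union>C"
      then obtain Y Z where "Y \<in> C" "x \<in> Y" "Z \<in> C" "y \<in> Z"
        by blast
      moreover have "Y \<subseteq> Z \<or> Z \<subseteq> Y"
        using C(2) \<open>Y \<in> C\<close> \<open>Z \<in> C\<close> by (auto simp: subset_chain_def)
      ultimately show "\<exists>Z\<in>C. x \<in> Z \<and> y \<in> Z"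
        by blast
    qed
    then show "\<Union>C \<in> ?A"
      using A C(1) by blast
  qed
  then obtain M where M: "M \<in> ?A" "\<forall>Z\<in>?A. M \<subseteq> Z \<longrightarrow> Z = M"
    by (rule bexE)
  have "Q = M" if "R Q" "M \<subseteq> Q" for Q
    using that M(1) by (intro M(2)[rule_format]) blast+
  then show ?thesis
    using that M(1) by blast
qed

section \<open>Maximal preorderings: totality and prime support\<close>

definition ring_preordering :: "'a::comm_ring_1 set \<Rightarrow> bool" where
  "ring_preordering P \<longleftrightarrow> (\<forall>x\<in>P. \<forall>y\<in>P. x + y \<in> P \<and> x * y \<in> P) \<and> (\<forall>x. x * x \<in> P)"

definition max_cone :: "'a::comm_ring_1 set \<Rightarrow> bool" where
  "max_cone P \<longleftrightarrow> ring_preordering P \<and> - 1 \<notin> P \<and>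
    (\<forall>Q. ring_preordering Q \<longrightarrow> - 1 \<notin> Q \<longrightarrow> P \<subseteq> Q \<longrightarrow> Q = P)"

lemma ex_max_cone:
  assumes "ring_preordering T" "- 1 \<notin> T"
  obtains P where "max_cone P" "T \<subseteq> P"
proof (rule ex_maximal_superset[of "\<lambda>P. ring_preordering P \<and> - 1 \<notin> P" T])
  show "ring_preordering T \<and> - 1 \<notin> T"
    using assms by blast
next
  fix C :: "'a set set"
  assume C: "C \<noteq> {}" and A: "\<And>Z. Z \<in> C \<Longrightarrow> ring_preordering Z \<and> - 1 \<notin> Z"
    and directed: "\<And>x y. x \<in> \<Union>C \<Longrightarrow> y \<in> \<Union>C \<Longrightarrow> \<exists>Z\<in>C. x \<in> Z \<and> y \<in> Z"
  have "x + y \<in> \<Union>C \<and> x * y \<in> \<Union>C" if xy: "x \<in> \<Union>C" "y \<in> \<Union>C" for x y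
  proof -
    obtain Z where "Z \<in> C" "x \<in> Z" "y \<in> Z"
      using directed[OF xy] by blast
    then show ?thesis
      using A unfolding ring_preordering_def by blast
  qed
  moreover have "x * x \<in> \<Union>C" for x
    using A C unfolding ring_preordering_def by blast
  ultimately show "ring_preordering (\<Union>C) \<and> - 1 \<notin> \<Union>C"
    using A by (simp add: ring_preordering_def)
next
  fix P
  assume "ring_preordering P \<and> - 1 \<notin> P" "T \<subseteq> P"
    "\<And>Q. ring_preordering Q \<and> - 1 \<notin> Q \<Longrightarrow> P \<subseteq> Q \<Longrightarrow> Q = P"
  then show thesis
    by (intro that) (simp_all add: max_cone_def)
qed

locale maximal_preordering =
  fixes P :: "'a::comm_ring_1 set"
  assumes max_cone: "max_cone P"
begin

lemma add: "x \<in> P \<Longrightarrow> y \<in> P \<Longrightarrow> x + y \<in> P"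
  and mult: "x \<in> P \<Longrightarrow> y \<in> P \<Longrightarrow> x * y \<in> P"
  and square: "x * x \<in> P"
  and proper: "- 1 \<notin> P"
  using max_cone by (auto simp: max_cone_def ring_preordering_def)

lemma zero: "0 \<in> P" and one: "1 \<in> P"
  using square[of 0] square[of 1] by simp_all

text \<open>\<open>P + x * P\<close> is a preordering that contains \<open>P\<close> and
  \<open>x\<close>, so maximality makes it improper.\<close>

lemma not_mem_witness:
  assumes "x \<notin> P"
  obtains p q where "p \<in> P" "q \<in> P" "- 1 = p + x * q"
proof -
  let ?Q = "{p + x * q | p q. p \<in> P \<and> q \<in> P}"
  have "ring_preordering ?Q"
    unfolding ring_preordering_def
  proof (intro conjI ballI allI)
    fix a b
    assume "a \<in> ?Q" "b \<in> ?Q"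
    then obtain p q p' q' where *: "p \<in> P" "q \<in> P" "p' \<in> P" "q' \<in> P"
        "a = p + x * q" "b = p' + x * q'"
      by blast
    then have "a + b = (p + p') + x * (q + q')"
      by (simp add: algebra_simps)
    moreover have "p + p' \<in> P" "q + q' \<in> P"
      using * by (auto intro: add)
    ultimately show "a + b \<in> ?Q"
      by blast
    have "a * b = (p * p' + x * x * (q * q')) + x * (p * q' + q * p')"
      using * by (simp add: algebra_simps)
    moreover have "p * p' + x * x * (q * q') \<in> P" "p * q' + q * p' \<in> P"
      using * by (auto intro: add mult square)
    ultimately show "a * b \<in> ?Q"
      by blast
  next
    fix a
    have "a * a = a * a + x * 0"
      by simp
    then show "a * a \<in> ?Q"
      using square zero by blast
  qed
  moreover have "p \<in> ?Q" if "p \<in> P" for p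
  proof -
    have "p = p + x * 0"
      by simp
    then show ?thesis
      using that zero by blast
  qed
  then have "P \<subseteq> ?Q"
    by blast
  moreover have "x \<in> ?Q"
  proof -
    have "x = 0 + x * 1"
      by simp
    then show ?thesis
      using zero one by blast
  qed
  moreover have "ring_preordering Q \<Longrightarrow> - 1 \<notin> Q \<Longrightarrow> P \<subseteq> Q \<Longrightarrow> Q = P" for Q
    using max_cone unfolding max_cone_def by blast
  ultimately have "- 1 \<in> ?Q"
    using assms by blast
  then show ?thesis
    using that by blast
qed

lemma total: "x \<in> P \<or> - x \<in> P"
proof (rule ccontr)
  assume "\<not> ?thesis"
  then obtain a b c d where *: "a \<in> P" "b \<in> P" "c \<in> P" "d \<in> P"
      "- 1 = a + x * b" "- 1 = c + (- x) * d"
    using not_mem_witness[of x] not_mem_witness[of "- x"] by metis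
  have "x * b = - (1 + a)" "x * d = 1 + c"
    using * by (simp_all add: algebra_simps eq_neg_iff_add_eq_0) (metis add.commute add.assoc add_eq_0_iff)+
  \<comment> \<open>Multiplying the two relations leaves \<open>x\<close> only through its square,
    which is in \<open>P\<close> whatever the sign of \<open>x\<close>.\<close>
  then have "- (x * x * (b * d)) = (1 + a) * (1 + c)"
    by (metis (no_types, lifting) minus_mult_left minus_minus mult.assoc mult.left_commute)
  then have "- 1 = a + c + a * c + x * x * (b * d)"
    by (simp add: algebra_simps) (metis add.commute add.assoc add_eq_0_iff minus_add_cancel)
  moreover have "a + c + a * c + x * x * (b * d) \<in> P"
    using * by (auto intro: add mult square)
  ultimately show False
    using proper by simp
qed

definition supp :: "'a set" where
  "supp = {x. x \<in> P \<and> - x \<in> P}"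

lemma supp_add: "x \<in> supp \<Longrightarrow> y \<in> supp \<Longrightarrow> x + y \<in> supp"
  using add[of x y] add[of "- x" "- y"] by (simp add: supp_def)

lemma supp_mult: "x \<in> supp \<Longrightarrow> a * x \<in> supp"
  using total[of a] mult[of a x] mult[of a "- x"] mult[of "- a" x] mult[of "- a" "- x"]
  by (auto simp: supp_def)

text \<open>An element outside the support divides some \<open>1 + p\<close> with \<open>p\<close>
  in \<open>P\<close>. Multiplying two such relations puts \<open>(1 + p) * (1 + p')\<close> into
  the support, whence - 1 is in \<open>P\<close>.\<close>

lemma supp_prime:
  assumes "a * b \<in> supp"
  shows "a \<in> supp \<or> b \<in> supp"
proof (rule ccontr)
  have *: "\<exists>e p q. (e = 1 \<or> e = - 1) \<and> p \<in> P \<and> e * x * q = 1 + p" if x: "x \<notin> supp" for x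
  proof -
    obtain e where e: "e = 1 \<or> e = - 1" "- (e * x) \<notin> P"
    proof (cases "x \<in> P")
      case True
      then show ?thesis
        using that[of 1] x by (simp add: supp_def)
    next
      case False
      then show ?thesis
        using that[of "- 1"] by simp
    qed
    then obtain p q where "p \<in> P" "- 1 = p + (- (e * x)) * q"
      using not_mem_witness by metis
    then have "e * x * q = 1 + p"
      by (simp add: algebra_simps eq_neg_iff_add_eq_0)
    with e \<open>p \<in> P\<close> show ?thesis
      by blast
  qed
  assume "\<not> ?thesis"
  then obtain e p q e' p' q' where "e = 1 \<or> e = - 1" "p \<in> P" "e * a * q = 1 + p"
      "e' = 1 \<or> e' = - 1" "p' \<in> P" "e' * b * q' = 1 + p'"
    using *[of a] *[of b] by metis
  moreover from this have "(1 + p) * (1 + p') = e * e' * q * q' * (a * b)"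
    by (metis mult.assoc mult.left_commute mult.commute)
  then have "(1 + p) * (1 + p') \<in> supp"
    using assms supp_mult by simp
  then have "- ((1 + p) * (1 + p')) \<in> P"
    by (simp add: supp_def)
  then have "- ((1 + p) * (1 + p')) + (p + p' + p * p') \<in> P"
    using calculation by (intro add mult) auto
  then show False
    using proper by (simp add: algebra_simps)
qed

end

section \<open>Quadratic modules and the Archimedean case\<close>

definition quadratic_module :: "'a::comm_ring_1 set \<Rightarrow> bool" where
  "quadratic_module M \<longleftrightarrow> 1 \<in> M \<and> (\<forall>x\<in>M. \<forall>y\<in>M. x + y \<in> M) \<and> (\<forall>x\<in>M. \<forall>a. a * a * x \<in> M)"

lemma ex_max_quadratic_module:
  assumes "quadratic_module T" "- 1 \<notin> T"
  obtains M where "quadratic_module M" "- 1 \<notin> M" "T \<subseteq> M"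
    "\<And>Q. quadratic_module Q \<Longrightarrow> - 1 \<notin> Q \<Longrightarrow> M \<subseteq> Q \<Longrightarrow> Q = M"
proof (rule ex_maximal_superset[of "\<lambda>M. quadratic_module M \<and> - 1 \<notin> M" T])
  show "quadratic_module T \<and> - 1 \<notin> T"
    using assms by blast
next
  fix C :: "'a set set"
  assume C: "C \<noteq> {}" and A: "\<And>Z. Z \<in> C \<Longrightarrow> quadratic_module Z \<and> - 1 \<notin> Z"
    and directed: "\<And>x y. x \<in> \<Union>C \<Longrightarrow> y \<in> \<Union>C \<Longrightarrow> \<exists>Z\<in>C. x \<in> Z \<and> y \<in> Z"
  have "x + y \<in> \<Union>C" if xy: "x \<in> \<Union>C" "y \<in> \<Union>C" for x y
  proof -
    obtain Z where "Z \<in> C" "x \<in> Z" "y \<in> Z"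
      using directed[OF xy] by blast
    then show ?thesis
      using A unfolding quadratic_module_def by blast
  qed
  moreover have "a * a * x \<in> \<Union>C" if "x \<in> \<Union>C" for a x
    using that A unfolding quadratic_module_def by blast
  moreover have "1 \<in> \<Union>C"
    using A C unfolding quadratic_module_def by blast
  ultimately show "quadratic_module (\<Union>C) \<and> - 1 \<notin> \<Union>C"
    using A by (simp add: quadratic_module_def)
next
  fix M
  assume "quadratic_module M \<and> - 1 \<notin> M" "T \<subseteq> M"
    "\<And>Q. quadratic_module Q \<and> - 1 \<notin> Q \<Longrightarrow> M \<subseteq> Q \<Longrightarrow> Q = M"
  then show thesis
    by (intro that) blast+
qed

text \<open>The bound on the sum of squares makes every variable finite relative to a maximal module
  \<open>M\<close>. Passing to an infinitely near real number respects sums and products and fixes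
  constants, so it is evaluation at the point whose coordinates are the numbers near the
  variables.\<close>

lemma archimedean_real_point:
  fixes T :: "'v::finite mpoly set"
  assumes T: "quadratic_module T" "- 1 \<notin> T"
    and arch: "Const R - (\<Sum>i\<in>UNIV. (Var i)\<^sup>2) \<in> T"
  obtains x where "\<And>p. p \<in> T \<Longrightarrow> peval p x \<ge> 0"
proof -
  obtain M where M: "quadratic_module M" "- 1 \<notin> M" "T \<subseteq> M"
    and max: "\<And>Q. quadratic_module Q \<Longrightarrow> - 1 \<notin> Q \<Longrightarrow> M \<subseteq> Q \<Longrightarrow> Q = M"
    using ex_max_quadratic_module[OF T] by metis
  have one: "1 \<in> M" and add: "\<And>x y. x \<in> M \<Longrightarrow> y \<in> M \<Longrightarrow> x + y \<in> M"
    and sq: "\<And>a x. x \<in> M \<Longrightarrow> a * a * x \<in> M"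
    using M(1) by (auto simp: quadratic_module_def)
  have square: "a * a \<in> M" for a
    using sq[OF one, of a] by simp
  have zero: "0 \<in> M"
    using square[of 0] by simp
  have scale: "Const r * x \<in> M" if "r \<ge> 0" "x \<in> M" for r x
  proof -
    have "Const (sqrt r) * Const (sqrt r) = (Const r :: 'v mpoly)"
      using that by (intro Const_mult_eq) simp
    then show ?thesis
      using sq[OF that(2)] by metis
  qed
  have const: "Const r \<in> M \<longleftrightarrow> r \<ge> 0" for r
  proof
    assume "r \<ge> 0"
    then show "Const r \<in> M"
      using scale[OF _ one] by simp
  next
    assume r: "Const r \<in> M"
    show "r \<ge> 0"
    proof (rule ccontr)
      assume "\<not> r \<ge> 0"
      then have "0 \<le> - (1 / r)" "- (1 / r) * r = - 1"
        by simp_all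
      then have "Const (- 1) \<in> M"
        using scale[OF _ r, of "- (1 / r)"] Const_mult_eq[of "- (1 / r)" r "- 1"] by metis
      then show False
        using M(2) by simp
    qed
  qed
  \<comment> \<open>Polarization: \<open>4 * a * m\<close> is the difference of
    \<open>(a + 1) * (a + 1) * m\<close> and \<open>(a - 1) * (a - 1) * m\<close>.\<close>
  have ideal: "a * m \<in> M" if "m \<in> M" "- m \<in> M" for a m
  proof -
    have "Const (1/4) * ((a + 1) * (a + 1) * m + (a - 1) * (a - 1) * (- m)) = (Const (1/4) * 4) * (a * m)"
      by (simp add: algebra_simps)
    moreover have "Const (1/4) * 4 = (1 :: 'v mpoly)"
      using Const_mult_eq[of "1/4" 4 1] by simp
    ultimately have "a * m = Const (1/4) * ((a + 1) * (a + 1) * m + (a - 1) * (a - 1) * (- m))"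
      by simp
    then show ?thesis
      using scale[OF _ add[OF sq[OF that(1), of "a + 1"] sq[OF that(2), of "a - 1"]], of "1/4"] by simp
  qed
  have total: "x \<in> M \<or> - x \<in> M" for x
  proof (rule ccontr)
    have sos_mult: "s * m \<in> M" if "s \<in> sos" "m \<in> M" for s m
      using that(1)
    proof (induction s rule: sos_induct)
      case zero
      then show ?case
        by (simp add: \<open>0 \<in> M\<close>)
    next
      case (add s q)
      have "s * m + q * q * m \<in> M"
        using add.IH sq[OF that(2)] by (rule \<open>\<And>y x. x \<in> M \<Longrightarrow> y \<in> M \<Longrightarrow> x + y \<in> M\<close>)
      then show ?case
        by (simp add: algebra_simps power2_eq_square)
    qed
    have w: "\<exists>p\<in>M. \<exists>s\<in>sos. - 1 = p + x * s" if "x \<notin> M" for x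
    proof -
      let ?Q = "{p + x * s | p s. p \<in> M \<and> s \<in> sos}"
      have "quadratic_module ?Q"
        unfolding quadratic_module_def
      proof (intro conjI ballI allI)
        have "1 = 1 + x * 0"
          by simp
        then show "1 \<in> ?Q"
          using one sos_zero by blast
      next
        fix a b
        assume "a \<in> ?Q" "b \<in> ?Q"
        then obtain p q p' q' where *: "p \<in> M" "q \<in> sos" "p' \<in> M" "q' \<in> sos"
            "a = p + x * q" "b = p' + x * q'"
          by blast
        then have "a + b = (p + p') + x * (q + q')"
          by (simp add: algebra_simps)
        then show "a + b \<in> ?Q"
          using * add sos_add by blast
      next
        fix a b
        assume "a \<in> ?Q"
        then obtain p q where *: "p \<in> M" "q \<in> sos" "a = p + x * q"
          by blast
        then have "b * b * a = b * b * p + x * (b * b * q)"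
          by (simp add: algebra_simps)
        then show "b * b * a \<in> ?Q"
          using * sq sos_mult_square by blast
      qed
      moreover have "p \<in> ?Q" if "p \<in> M" for p
      proof -
        have "p = p + x * 0"
          by simp
        then show ?thesis
          using that sos_zero by blast
      qed
      then have "M \<subseteq> ?Q"
        by blast
      moreover have "x \<in> ?Q"
      proof -
        have "x = 0 + x * 1"
          by simp
        then show ?thesis
          using zero sos_one by blast
      qed
      ultimately have "- 1 \<in> ?Q"
        using max[of ?Q] that by blast
      then show ?thesis
        by blast
    qed
    assume "\<not> ?thesis"
    then obtain p s p' s' where *: "p \<in> M" "s \<in> sos" "p' \<in> M" "s' \<in> sos"
        "- 1 = p + x * s" "- 1 = p' + (- x) * s'"
      using w[of x] w[of "- x"] by metis
    have SM: "t \<in> M" if "t \<in> sos" for t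
      using sos_mult[OF that one] by simp
    \<comment> \<open>\<open>M\<close> need not be closed under products, so \<open>x\<close> is
      cancelled by multiplying the relations with the sums of squares \<open>s'\<close> and
      \<open>s\<close>. As a result both \<open>s\<close> and \<open>- s\<close> are in
      \<open>M\<close>, and \<open>ideal\<close> applies to \<open>x * s\<close>.\<close>
    have "- (s + s') = s' * p + s * p'"
    proof -
      have "- s' = s' * (p + x * s)" "- s = s * (p' + (- x) * s')"
        using *(5,6) by (metis mult.commute mult_minus1)+
      then show ?thesis
        by (simp add: algebra_simps)
    qed
    then have "- (s + s') \<in> M"
      using add[OF sos_mult[OF *(4,1)] sos_mult[OF *(2,3)]] by simp
    then have "- s \<in> M"
      using add[of "- (s + s')" s'] SM * by simp
    then have "x * s \<in> M"
      using ideal SM * by blast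
    then show False
      using add[OF *(1)] *(5) M(2) by simp
  qed
  \<comment> \<open>The infinitesimals relative to \<open>M\<close>.\<close>
  define small where "small a \<longleftrightarrow> (\<forall>e>0. Const e - a \<in> M \<and> Const e + a \<in> M)" for a
  have small_add: "small (a + b)" if "small a" "small b" for a b
    unfolding small_def
  proof (intro allI impI)
    fix e :: real
    assume "e > 0"
    then have "Const (e / 2) - a \<in> M" "Const (e / 2) - b \<in> M" "Const (e / 2) + a \<in> M" "Const (e / 2) + b \<in> M"
      using that unfolding small_def by simp_all
    then have "(Const (e / 2) - a) + (Const (e / 2) - b) \<in> M" "(Const (e / 2) + a) + (Const (e / 2) + b) \<in> M"
      by (simp_all only: add)
    moreover have "Const e = Const (e / 2) + (Const (e / 2) :: 'v mpoly)"
      by (simp flip: Const.add)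
    ultimately show "Const e - (a + b) \<in> M \<and> Const e + (a + b) \<in> M"
      by (simp add: algebra_simps)
  qed
  have small_uminus: "small (- a)" if "small a" for a
    using that by (simp add: small_def)
  have small_scale_pos: "small (Const c * a)" if "small a" "c > 0" for a c
    unfolding small_def
  proof (intro allI impI)
    fix e :: real
    assume "e > 0"
    then have "Const (e / c) - a \<in> M" "Const (e / c) + a \<in> M"
      using that unfolding small_def by simp_all
    then have "Const c * (Const (e / c) - a) \<in> M" "Const c * (Const (e / c) + a) \<in> M"
      using scale that by simp_all
    moreover have "Const c * Const (e / c) = (Const e :: 'v mpoly)"
      using that by (intro Const_mult_eq) simp
    ultimately show "Const e - Const c * a \<in> M \<and> Const e + Const c * a \<in> M"
      by (simp add: algebra_simps)
  qed
  have small_0: "small 0"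
    by (simp add: small_def const)
  have small_scale: "small (Const c * a)" if "small a" for a c
    using small_scale_pos[OF that, of c] small_uminus[OF small_scale_pos[OF that, of "- c"]] small_0
    by (cases c "0 :: real" rule: linorder_cases) simp_all
  have small_square: "small (a * a)" if "small a" for a
    unfolding small_def
  proof (intro allI impI)
    fix e :: real
    assume e: "e > 0"
    define d where "d = sqrt e"
    have d: "d > 0" "d * d = e"
      using e by (simp_all add: d_def)
    have "Const d - a \<in> M" "Const d + a \<in> M"
      using that d(1) unfolding small_def by simp_all
    \<comment> \<open>The bracket equals \<open>2 * d * (d * d - a * a)\<close>, and each summand is
      a square times a member of \<open>M\<close>.\<close>
    then have "Const (1 / (2 * d)) * ((Const d + a) * (Const d + a) * (Const d - a) +
        (Const d - a) * (Const d - a) * (Const d + a)) \<in> M"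
      using scale add sq d by simp
    also have "Const (1 / (2 * d)) * ((Const d + a) * (Const d + a) * (Const d - a) +
        (Const d - a) * (Const d - a) * (Const d + a)) =
        (Const (1 / (2 * d)) * (Const d + Const d)) * ((Const d * Const d) - a * a)"
      by (simp add: algebra_simps)
    also have "Const (1 / (2 * d)) * (Const d + Const d) = (1 :: 'v mpoly)"
      using d Const_mult_eq[of "1 / (2 * d)" "d + d" 1] by simp
    also have "Const d * Const d = (Const e :: 'v mpoly)"
      using d by (intro Const_mult_eq)
    finally show "Const e - a * a \<in> M \<and> Const e + a * a \<in> M"
      using add[OF square[of a], of "Const e"] e by (simp add: const add.commute)
  qed
  have small_mult: "small (a * b)" if "small a" "small b" for a b
  proof -
    have "small (Const (1/4) * ((a + b) * (a + b) + - ((a + - b) * (a + - b))))"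
      by (intro small_scale small_add small_square small_uminus that)
    moreover have "Const (1/4) * ((a + b) * (a + b) + - ((a + - b) * (a + - b))) =
        (Const (1/4) * 4) * (a * b)"
      by (simp add: algebra_simps)
    moreover have "Const (1/4) * 4 = (1 :: 'v mpoly)"
      using Const_mult_eq[of "1/4" 4 1] by simp
    ultimately show ?thesis
      by simp
  qed
  define near where "near a r \<longleftrightarrow> small (a - Const r)" for a r
  have near_const: "near (Const c) c" for c
    by (simp add: near_def small_0)
  have near_add: "near (a + b) (r + s)" if "near a r" "near b s" for a b r s
    using small_add[OF that[unfolded near_def]] by (simp add: near_def algebra_simps)
  have near_mult: "near (a * b) (r * s)" if "near a r" "near b s" for a b r s
  proof -
    have "small ((a - Const r) * (b - Const s) + (Const r * (b - Const s) + Const s * (a - Const r)))"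
      using that unfolding near_def by (intro small_add small_mult small_scale)
    then show ?thesis
      by (simp add: near_def algebra_simps)
  qed
  have near_nonneg: "r \<ge> 0" if "near a r" "a \<in> M" for a r
  proof (rule ccontr)
    assume "\<not> r \<ge> 0"
    then have "Const (- r / 2) - (a - Const r) \<in> M"
      using that(1) unfolding near_def small_def by (meson divide_pos_pos neg_0_less_iff_less not_le zero_less_numeral)
    from add[OF this that(2)] have "Const (- r / 2 + r) \<in> M"
      unfolding Const.add by simp
    then show False
      using \<open>\<not> r \<ge> 0\<close> by (simp only: const)
  qed
  have near_Var: "\<exists>r. near (Var i) r" for i
  proof -
    have sum_sq: "(\<Sum>j\<in>S. (Var j)\<^sup>2) \<in> M" if "finite S" for S :: "'v set"
      using that by (induction S rule: finite_induct) (auto simp: zero add square power2_eq_square)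
    have "(Const R - (\<Sum>i\<in>UNIV. (Var i)\<^sup>2)) + (\<Sum>j\<in>UNIV - {i}. (Var j)\<^sup>2) \<in> M"
      by (rule add[OF subsetD[OF M(3) arch] sum_sq]) simp
    then have R: "Const R - Var i * Var i \<in> M"
      by (simp add: sum.remove[of UNIV i] power2_eq_square)
    \<comment> \<open>Adding the square of \<open>Var i + 1/2\<close> or of
      \<open>Var i - 1/2\<close> to \<open>R - Var i * Var i\<close> leaves \<open>N + Var i\<close>
      or \<open>N - Var i\<close>.\<close>
    define N where "N = R + 1/4"
    have half: "Const (1/2) * Const (1/2) = (Const (1/4) :: 'v mpoly)"
      "Const (1/2) + Const (1/2) = (1 :: 'v mpoly)"
      using Const_mult_eq[of "1/2" "1/2" "1/4"] Const.add[of "1/2" "1/2"] by simp_all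
    have "(Const R - Var i * Var i) + (Var i + Const (1/2)) * (Var i + Const (1/2)) \<in> M"
      "(Const R - Var i * Var i) + (Var i - Const (1/2)) * (Var i - Const (1/2)) \<in> M"
      by (rule add[OF R square])+
    moreover have "(Const R - Var i * Var i) + (Var i + Const (1/2)) * (Var i + Const (1/2)) =
        Const R + Const (1/2) * Const (1/2) + (Const (1/2) + Const (1/2)) * Var i"
      "(Const R - Var i * Var i) + (Var i - Const (1/2)) * (Var i - Const (1/2)) =
        Const R + Const (1/2) * Const (1/2) - (Const (1/2) + Const (1/2)) * Var i"
      by (simp_all add: algebra_simps)
    ultimately have N: "Const N + Var i \<in> M" "Const N - Var i \<in> M"
      unfolding half N_def by simp_all
    \<comment> \<open>The upper cut of \<open>Var i\<close> in the reals: it contains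
      \<open>N\<close> and is bounded below by \<open>- N\<close>.\<close>
    define A where "A = {s. Const s - Var i \<in> M}"
    have lower: "s \<ge> - N" if "s \<in> A" for s
    proof -
      have "(Const s - Var i) + (Const N + Var i) \<in> M"
        using that by (intro add N) (simp add: A_def)
      then have "Const (s + N) \<in> M"
        by simp
      then show ?thesis
        by (simp add: const del: Const.add)
    qed
    then have bdd: "bdd_below A"
      by (rule bdd_belowI)
    have "near (Var i) (Inf A)"
      unfolding near_def small_def
    proof (intro allI impI conjI)
      fix e :: real
      assume "e > 0"
      have "A \<noteq> {}"
        using N by (auto simp: A_def)
      then obtain s where s: "s \<in> A" "s < Inf A + e"
        using \<open>e > 0\<close> cInf_lessD[of A "Inf A + e"] by (meson less_add_same_cancel1)
      have "Const s - Var i \<in> M" "Const (Inf A + e - s) \<in> M"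
        using s by (simp add: A_def, simp only: const)
      from add[OF this] show "Const e - (Var i - Const (Inf A)) \<in> M"
        by (simp add: algebra_simps)
      have "Inf A - e \<notin> A"
        using cInf_lower[OF _ bdd, of "Inf A - e"] \<open>e > 0\<close> by linarith
      then have "Const (Inf A - e) - Var i \<notin> M"
        by (simp only: A_def mem_Collect_eq not_False_eq_True)
      then have "- (Const (Inf A - e) - Var i) \<in> M"
        using total by blast
      then show "Const e + (Var i - Const (Inf A)) \<in> M"
        by (simp add: algebra_simps)
    qed
    then show ?thesis ..
  qed
  then obtain x where x: "\<And>i. near (Var i) (x i)"
    by metis
  have "near p (peval p (\<chi> i. x i))" for p
    by (induction p rule: mpoly_induct) (auto simp: near_const x near_add near_mult)
  then show ?thesis
    using near_nonneg subsetD[OF M(3)] that by metis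
qed

section \<open>Polynomials over real closed fields\<close>

text \<open>The constant \<^const>\<open>poly\<close> is not available in class specifications, so that polynomials have to be
  written as sums here.\<close>

class rcf = linordered_field +
  assumes sum_ivt: "a < b \<Longrightarrow> (\<Sum>k\<le>n. f k * a ^ k) < 0 \<Longrightarrow> 0 < (\<Sum>k\<le>n. f k * b ^ k) \<Longrightarrow>
    \<exists>x. a < x \<and> x < b \<and> (\<Sum>k\<le>n. f k * x ^ k) = 0"

lemma sum_eq_poly: "(\<Sum>k\<le>n. f k * (x :: 'a::comm_semiring_1) ^ k) = poly (\<Sum>k\<le>n. monom (f k) k) x"
  by (simp add: poly_sum poly_monom)

instance real :: rcf
proof
  fix a b :: real and f :: "nat \<Rightarrow> real" and n
  assume "a < b" "(\<Sum>k\<le>n. f k * a ^ k) < 0" "0 < (\<Sum>k\<le>n. f k * b ^ k)"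
  then show "\<exists>x. a < x \<and> x < b \<and> (\<Sum>k\<le>n. f k * x ^ k) = 0"
    unfolding sum_eq_poly by (rule poly_IVT_pos)
qed

section \<open>Rolle's theorem, mean values and monotonicity\<close>

lemma poly_ivt:
  fixes p :: "'a::rcf poly"
  assumes "a < b" "poly p a < 0" "0 < poly p b"
  shows "\<exists>x. a < x \<and> x < b \<and> poly p x = 0"
  using assms sum_ivt[of a b "coeff p" "degree p"] by (simp add: poly_altdef)

lemma poly_ivt_mult:
  fixes p :: "'a::rcf poly"
  assumes "a < b" "poly p a * poly p b < 0"
  shows "\<exists>x. a < x \<and> x < b \<and> poly p x = 0"
proof (cases "poly p a < 0")
  case True
  then show ?thesis
    using assms poly_ivt[of a b p] by (simp add: mult_less_0_iff)
next
  case False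
  then have "poly (- p) a < 0" "poly (- p) b > 0"
    using assms(2) by (auto simp: mult_less_0_iff)
  from poly_ivt[OF assms(1) this] show ?thesis
    by simp
qed

text \<open>An argument by a maximum is not at hand in a real closed field. Instead split off the
  full powers of \<open>X - a\<close> and \<open>X - b\<close>: the cofactor \<open>q\<close> has
  the same sign at both ends. After removing the lower powers of the two factors from the
  derivative, the remaining factor \<open>r\<close> has opposite signs at the ends.\<close>

lemma rolle_consecutive:
  fixes p :: "'a::rcf poly"
  assumes "a < b" "poly p a = 0" "poly p b = 0" "p \<noteq> 0"
    and no_root: "\<And>x. a < x \<Longrightarrow> x < b \<Longrightarrow> poly p x \<noteq> 0"
  shows "\<exists>c. a < c \<and> c < b \<and> poly (pderiv p) c = 0"
proof -
  define A B where "A = [:- a, 1:]" and "B = [:- b, 1:]"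
  obtain q1 where q1: "p = A ^ order a p * q1" "\<not> A dvd q1"
    using order_decomp[OF \<open>p \<noteq> 0\<close>] unfolding A_def by metis
  then have "q1 \<noteq> 0"
    using \<open>p \<noteq> 0\<close> by auto
  obtain q where q: "q1 = B ^ order b q1 * q" "\<not> B dvd q"
    using order_decomp[OF \<open>q1 \<noteq> 0\<close>] unfolding B_def by metis
  define m n where "m = order a p" and "n = order b q1"
  have p: "p = A ^ m * (B ^ n * q)"
    using q1 q by (simp add: m_def n_def)
  have "poly q b \<noteq> 0"
    using q(2) by (simp add: B_def poly_eq_0_iff_dvd)
  have "poly q1 a \<noteq> 0"
    using q1(2) by (simp add: A_def poly_eq_0_iff_dvd)
  then have "poly q a \<noteq> 0"
    using q(1) by (metis mult_zero_right poly_mult)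
  have "m \<noteq> 0"
    using assms(2,4) order_root[of p a] by (simp add: m_def)
  then obtain m' where m': "m = Suc m'"
    by (cases m) auto
  have "n \<noteq> 0"
  proof
    assume "n = 0"
    then have "poly p b = poly A b ^ m * poly q b"
      using p by simp
    then show False
      using assms(1,3) \<open>poly q b \<noteq> 0\<close> by (simp add: A_def)
  qed
  then obtain n' where n': "n = Suc n'"
    by (cases n) auto
  have "poly q a * poly q b > 0"
  proof (rule ccontr)
    assume "\<not> ?thesis"
    then have "poly q a * poly q b < 0"
      using \<open>poly q a \<noteq> 0\<close> \<open>poly q b \<noteq> 0\<close> by (metis mult_eq_0_iff not_less_iff_gr_or_eq)
    from poly_ivt_mult[OF assms(1) this] obtain x where "a < x" "x < b" "poly q x = 0"
      by (elim exE conjE)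
    then show False
      using no_root[of x] p by simp
  qed
  define r where "r = smult (of_nat m) (B * q) + smult (of_nat n) (A * q) + A * B * pderiv q"
  have "pderiv A = 1" "pderiv B = 1"
    by (simp_all add: A_def B_def pderiv_pCons)
  then have p': "pderiv p = A ^ m' * B ^ n' * r"
    unfolding p m' n' r_def
    by (simp add: pderiv_mult pderiv_power_Suc algebra_simps del: power_Suc of_nat_Suc)
       (simp add: algebra_simps)
  have ends: "poly r a = of_nat m * ((a - b) * poly q a)" "poly r b = of_nat n * ((b - a) * poly q b)"
    by (simp_all add: r_def A_def B_def algebra_simps)
  have "poly r a * poly r b = - (of_nat m * of_nat n * ((b - a) * (b - a)) * (poly q a * poly q b))"
    unfolding ends by (simp add: algebra_simps)
  also have "\<dots> < 0"
    using \<open>poly q a * poly q b > 0\<close> \<open>m \<noteq> 0\<close> \<open>n \<noteq> 0\<close> assms(1) by (simp add: mult_pos_pos)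
  finally have "poly r a * poly r b < 0" .
  from poly_ivt_mult[OF assms(1) this] obtain c where c: "a < c" "c < b" "poly r c = 0"
    by (elim exE conjE)
  then have "poly (pderiv p) c = 0"
    unfolding p' by simp
  with c(1,2) show ?thesis
    by (intro exI[of _ c] conjI)
qed

lemma rolle:
  fixes p :: "'a::rcf poly"
  assumes "a < b" "poly p a = 0" "poly p b = 0"
  shows "\<exists>c. a < c \<and> c < b \<and> poly (pderiv p) c = 0"
proof (cases "p = 0")
  case True
  then have "pderiv p = 0"
    by simp
  moreover obtain c where "a < c" "c < b"
    using dense[OF assms(1)] by blast
  ultimately show ?thesis
    by (intro exI[of _ c]) simp
next
  case False
  define R where "R = {x. a < x \<and> x \<le> b \<and> poly p x = 0}"
  have "finite R"
    by (rule finite_subset[OF _ poly_roots_finite[OF False]]) (auto simp: R_def)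
  moreover have "b \<in> R"
    using assms by (simp add: R_def)
  ultimately have M: "Min R \<in> R" "\<And>x. x \<in> R \<Longrightarrow> Min R \<le> x"
    by (auto intro: Min_in)
  have "\<exists>c. a < c \<and> c < Min R \<and> poly (pderiv p) c = 0"
  proof (rule rolle_consecutive[OF _ assms(2) _ False])
    show "a < Min R" "poly p (Min R) = 0"
      using M(1) by (auto simp: R_def)
    show "poly p x \<noteq> 0" if "a < x" "x < Min R" for x
      using M(2)[of x] M(1) that by (auto simp: R_def)
  qed
  then obtain c where c: "a < c" "c < Min R" "poly (pderiv p) c = 0"
    by (elim exE conjE)
  moreover have "Min R \<le> b"
    using M(1) by (simp add: R_def)
  ultimately have "c < b"
    by simp
  with c show ?thesis
    by (intro exI[of _ c] conjI)
qed

lemma rcf_mvt: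
  fixes p :: "'a::rcf poly"
  assumes "a < b"
  shows "\<exists>c. a < c \<and> c < b \<and> poly p b - poly p a = (b - a) * poly (pderiv p) c"
proof -
  define q where "q = smult (b - a) p -
    [:(b - a) * poly p a - a * (poly p b - poly p a), poly p b - poly p a:]"
  have "poly q a = 0" "poly q b = 0"
    by (simp_all add: q_def algebra_simps)
  from rolle[OF assms this] obtain c where c: "a < c" "c < b" "poly (pderiv q) c = 0"
    by (elim exE conjE)
  have "pderiv q = smult (b - a) (pderiv p) - [:poly p b - poly p a:]"
    by (simp add: q_def pderiv_diff pderiv_smult pderiv_pCons)
  then have "(b - a) * poly (pderiv p) c - (poly p b - poly p a) = 0"
    using c(3) by simp
  then have "poly p b - poly p a = (b - a) * poly (pderiv p) c"
    by (simp only: right_minus_eq)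
  with c(1,2) show ?thesis
    by (intro exI[of _ c] conjI)
qed

lemma poly_strict_mono:
  fixes p :: "'a::rcf poly"
  assumes "a < b" "\<And>x. a < x \<Longrightarrow> x < b \<Longrightarrow> poly (pderiv p) x > 0"
  shows "poly p a < poly p b"
proof -
  obtain c where c: "a < c" "c < b" "poly p b - poly p a = (b - a) * poly (pderiv p) c"
    using rcf_mvt[OF assms(1), of p] by (elim exE conjE)
  have "poly p b - poly p a > 0"
    unfolding c(3) using assms(1) assms(2)[OF c(1,2)] by simp
  then show ?thesis
    by simp
qed

text \<open>A positive lower bound, not mere positivity, carries the Horner step: it makes
  \<open>x * poly q x\<close> outgrow the constant term.\<close>

lemma poly_eventually_ge:
  fixes p :: "'a::linordered_field poly"
  assumes "lead_coeff p > 0"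
  shows "\<exists>M e. e > 0 \<and> (\<forall>x\<ge>M. poly p x \<ge> e)"
  using assms
proof (induction p rule: pCons_induct)
  case 0
  then show ?case
    by simp
next
  case (pCons c q)
  show ?case
  proof (cases "q = 0")
    case True
    then show ?thesis
      using pCons.prems by auto
  next
    case False
    then obtain M e where e: "e > 0" "\<And>x. x \<ge> M \<Longrightarrow> poly q x \<ge> e"
      using pCons by auto
    have "poly (pCons c q) x \<ge> e" if "x \<ge> max M (max 0 ((e - c) / e))" for x
    proof -
      have "x \<ge> 0" "x \<ge> M" "e - c \<le> x * e"
        using that e(1) by (auto simp: pos_divide_le_eq)
      then have "x * e \<le> x * poly q x"
        using e(2) by (intro mult_left_mono)
      then show ?thesis
        using \<open>e - c \<le> x * e\<close> by simp
    qed
    then show ?thesis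
      using e(1) by blast
  qed
qed

text \<open>The leading coefficient decides: were it negative, the derivative would eventually be
  negative, too.\<close>

lemma pos_deriv_imp_pos:
  fixes p :: "'a::linordered_field poly"
  assumes "\<And>x. x > a \<Longrightarrow> poly (pderiv p) x > 0"
  shows "\<exists>x>a. poly p x > 0"
proof -
  have "poly (pderiv p) (a + 1) > 0"
    using assms by simp
  then have "pderiv p \<noteq> 0"
    by auto
  then have d: "degree p \<noteq> 0"
    by (simp add: pderiv_eq_0_iff)
  then have lc: "lead_coeff (pderiv p) = of_nat (degree p) * lead_coeff p"
    by (simp add: degree_pderiv coeff_pderiv)
  have "lead_coeff p > 0"
  proof (rule ccontr)
    assume "\<not> ?thesis"
    moreover have "lead_coeff p \<noteq> 0"
      using d by auto
    ultimately have "lead_coeff p < 0"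
      by (simp add: not_less order.strict_iff_order)
    then have "lead_coeff (- pderiv p) > 0"
      using d lc by (simp add: mult_less_0_iff)
    then obtain M e where *: "e > 0" "\<forall>x\<ge>M. poly (- pderiv p) x \<ge> e"
      using poly_eventually_ge by blast
    then have "poly (- pderiv p) (max M (a + 1)) \<ge> e"
      by simp
    moreover have "poly (pderiv p) (max M (a + 1)) > 0"
      by (rule assms) (simp add: less_max_iff_disj)
    ultimately show False
      using *(1) by simp
  qed
  then obtain M e where *: "e > 0" "\<forall>x\<ge>M. poly p x \<ge> e"
    using poly_eventually_ge by blast
  then have "poly p (max M (a + 1)) > 0"
    using less_le_trans by (metis max.cobounded1)
  moreover have "max M (a + 1) > a"
    by (simp add: less_max_iff_disj)
  ultimately show ?thesis
    by blast
qed

lemma pos_deriv_imp_neg: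
  fixes p :: "'a::linordered_field poly"
  assumes "\<And>x. x < a \<Longrightarrow> poly (pderiv p) x > 0"
  shows "\<exists>x<a. poly p x < 0"
proof -
  have "\<exists>x>- a. poly (- (p \<circ>\<^sub>p [:0, - 1:])) x > 0"
    by (rule pos_deriv_imp_pos)
       (use assms in \<open>auto simp: pderiv_pcompose poly_pcompose pderiv_minus pderiv_pCons\<close>)
  then obtain x where "x > - a" "poly p (- x) < 0"
    by (auto simp: poly_pcompose)
  then show ?thesis
    by (intro exI[of _ "- x"]) auto
qed

text \<open>\<^const>\<open>None\<close> stands for an infinite end.\<close>

definition gap :: "'a::linorder option \<Rightarrow> 'a option \<Rightarrow> 'a set" where
  "gap l u = {x. (\<forall>a. l = Some a \<longrightarrow> a < x) \<and> (\<forall>b. u = Some b \<longrightarrow> x < b)}"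

lemma gap_left: "x \<in> gap l (Some z) \<Longrightarrow> z \<in> gap l u \<Longrightarrow> x \<in> gap l u \<and> x < z"
  by (cases u) (auto simp: gap_def)

lemma gap_right: "x \<in> gap (Some z) u \<Longrightarrow> z \<in> gap l u \<Longrightarrow> x \<in> gap l u \<and> z < x"
  by (cases l) (auto simp: gap_def)

lemma gap_Some_right: "b \<in> gap l None \<Longrightarrow> \<exists>x::'a::linordered_field. x \<in> gap l (Some b)"
  by (cases l) (auto simp: gap_def dense lt_ex)

lemma gap_None_right: "\<exists>x::'a::linordered_field. x \<in> gap l None"
  by (cases l) (auto simp: gap_def gt_ex)

lemma infinite_gap:
  assumes "x \<in> gap l u"
  shows "infinite (gap l (u :: 'a::linordered_field option))"
proof -
  obtain b where b: "x < b" "\<And>c. u = Some c \<Longrightarrow> b \<le> c"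
    using assms gt_ex[of x] by (cases u) (auto simp: gap_def)
  have "{x<..<b} \<subseteq> gap l u"
    using assms b by (fastforce simp: gap_def)
  then show ?thesis
    using infinite_Ioo[OF b(1)] finite_subset by blast
qed

text \<open>Which of the three sign patterns occurs is read off from the signs at the ends.
  \<open>N\<close> and \<open>Q\<close> hold vacuously at infinite ends, which fits, because an
  increasing polynomial becomes negative far to the left and positive far to the right.\<close>

lemma gap_sign_increasing:
  fixes p :: "'a::rcf poly"
  assumes pos: "\<And>x. x \<in> gap l u \<Longrightarrow> poly (pderiv p) x > 0"
    and nonempty: "x0 \<in> gap l u"
  defines "N \<equiv> (\<forall>a. l = Some a \<longrightarrow> poly p a < 0)" and "Q \<equiv> (\<forall>b. u = Some b \<longrightarrow> poly p b > 0)"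
  shows "\<not> N \<Longrightarrow> x \<in> gap l u \<Longrightarrow> poly p x > 0"
    and "\<not> Q \<Longrightarrow> x \<in> gap l u \<Longrightarrow> poly p x < 0"
    and "N \<Longrightarrow> Q \<Longrightarrow> \<exists>z\<in>gap l u. poly p z = 0 \<and>
      (\<forall>x\<in>gap l (Some z). poly p x < 0) \<and> (\<forall>x\<in>gap (Some z) u. poly p x > 0)"
proof -
  show 1: "poly p x > 0" if "\<not> N" "x \<in> gap l u"
  proof -
    obtain a where a: "l = Some a" "poly p a \<ge> 0"
      using \<open>\<not> N\<close> by (auto simp: N_def not_less)
    have "poly p a < poly p x"
      by (rule poly_strict_mono) (use that a in \<open>auto simp: gap_def intro!: pos\<close>)
    then show ?thesis
      using a by simp
  qed
  show 2: "poly p x < 0" if "\<not> Q" "x \<in> gap l u"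
  proof -
    obtain a where a: "u = Some a" "poly p a \<le> 0"
      using \<open>\<not> Q\<close> by (auto simp: Q_def not_less)
    have "poly p x < poly p a"
      by (rule poly_strict_mono) (use that a in \<open>auto simp: gap_def intro!: pos\<close>)
    then show ?thesis
      using a by simp
  qed
  show "\<exists>z\<in>gap l u. poly p z = 0 \<and>
      (\<forall>x\<in>gap l (Some z). poly p x < 0) \<and> (\<forall>x\<in>gap (Some z) u. poly p x > 0)" if "N" "Q"
  proof -
    have mono: "poly p x < poly p y" if "x \<in> gap l u" "y \<in> gap l u" "x < y" for x y
      by (rule poly_strict_mono) (use that in \<open>auto simp: gap_def intro!: pos\<close>)
    have "\<exists>a. a \<le> x0 \<and> poly p a < 0 \<and> (\<forall>x>a. \<forall>c. l = Some c \<longrightarrow> c < x)"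
    proof (cases l)
      case None
      have "\<exists>x<x0. poly p x < 0"
        by (rule pos_deriv_imp_neg) (use None nonempty in \<open>auto simp: gap_def intro!: pos\<close>)
      then show ?thesis
        using None by (auto intro: less_imp_le)
    next
      case (Some a)
      then have "poly p a < 0" "a \<le> x0"
        using \<open>N\<close> nonempty by (simp_all add: N_def gap_def)
      then show ?thesis
        using Some by auto
    qed
    then obtain a where a: "a \<le> x0" "poly p a < 0" "\<And>x c. x > a \<Longrightarrow> l = Some c \<Longrightarrow> c < x"
      by blast
    have "\<exists>a. x0 \<le> a \<and> poly p a > 0 \<and> (\<forall>x<a. \<forall>c. u = Some c \<longrightarrow> x < c)"
    proof (cases u)
      case None
      have "\<exists>x>x0. poly p x > 0"
        by (rule pos_deriv_imp_pos) (use None nonempty in \<open>auto simp: gap_def intro!: pos\<close>)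
      then show ?thesis
        using None by (auto intro: less_imp_le)
    next
      case (Some a)
      then have "poly p a > 0" "x0 \<le> a"
        using \<open>Q\<close> nonempty by (simp_all add: Q_def gap_def)
      then show ?thesis
        using Some by auto
    qed
    then obtain b where b: "x0 \<le> b" "poly p b > 0" "\<And>x c. x < b \<Longrightarrow> u = Some c \<Longrightarrow> x < c"
      by blast
    have "a < b"
      using a b by (metis less_asym order.strict_iff_order order.trans)
    then obtain z where z: "a < z" "z < b" "poly p z = 0"
      using poly_ivt a b by blast
    then have zg: "z \<in> gap l u"
      using a(3)[of z] b(3)[of z] by (simp add: gap_def)
    moreover have "\<forall>x\<in>gap l (Some z). poly p x < 0"
    proof
      fix x assume that: "x \<in> gap l (Some z)"
      show "poly p x < 0"
        using mono[of x z] gap_left[OF that zg] zg z(3) by simp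
    qed
    moreover have "\<forall>x\<in>gap (Some z) u. poly p x > 0"
    proof
      fix x assume that: "x \<in> gap (Some z) u"
      show "poly p x > 0"
        using mono[of z x] gap_right[OF that zg] zg z(3) by simp
    qed
    ultimately show ?thesis
      using z(3) by (intro bexI[of _ z] conjI)
  qed
qed

section \<open>Transfer of sign conditions in one variable\<close>

text \<open>The library constant \<^const>\<open>pderiv\<close> requires the absence of zero divisors, which is not known
  for \<^typ>\<open>'v mpoly\<close>.\<close>

definition fderiv :: "'a::comm_ring_1 poly \<Rightarrow> 'a poly" where
  "fderiv p = (\<Sum>i<degree p. monom (of_nat (Suc i) * coeff p (Suc i)) i)"

lemma coeff_fderiv: "coeff (fderiv p) i = of_nat (Suc i) * coeff p (Suc i)"
proof -
  have "coeff (fderiv p) i = (if i < degree p then of_nat (Suc i) * coeff p (Suc i) else 0)"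
    by (simp add: fderiv_def coeff_sum del: of_nat_Suc)
  then show ?thesis
    by (simp add: coeff_eq_0 not_less del: of_nat_Suc)
qed

lemma degree_fderiv: "degree p > 0 \<Longrightarrow> degree (fderiv p) < degree p"
proof -
  assume "degree p > 0"
  moreover have "degree (fderiv p) \<le> degree p - 1"
    by (intro degree_le) (auto simp: coeff_fderiv coeff_eq_0 simp del: of_nat_Suc)
  ultimately show ?thesis
    by simp
qed

context rhom
begin

lemma coeff_map [simp]: "coeff (map_poly h p) i = h (coeff p i)"
  by (simp add: coeff_map_poly)

lemma map_poly_add [simp]: "map_poly h (p + q) = map_poly h p + map_poly h q"
  by (rule poly_eqI) simp

lemma map_poly_diff [simp]: "map_poly h (p - q) = map_poly h p - map_poly h q"
  by (rule poly_eqI) simp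

lemma map_poly_mult [simp]: "map_poly h (p * q) = map_poly h p * map_poly h q"
  by (rule poly_eqI) (simp add: coeff_mult sum)

lemma map_poly_smult [simp]: "map_poly h (smult c p) = smult (h c) (map_poly h p)"
  by (rule poly_eqI) simp

lemma map_poly_monom [simp]: "map_poly h (monom c n) = monom (h c) n"
  by (rule poly_eqI) simp

lemma of_nat [simp]: "h (of_nat n) = of_nat n"
  by (induction n) auto

lemma poly_map_poly: "poly (map_poly h p) (h x) = h (poly p x)"
  by (induction p) (auto simp: map_poly_pCons)

end

lemma map_poly_fderiv:
  assumes "rhom (k :: 'a::comm_ring_1 \<Rightarrow> 'b::idom)"
  shows "map_poly k (fderiv p) = pderiv (map_poly k p)"
proof -
  interpret k: rhom k by fact
  show ?thesis
    by (rule poly_eqI) (simp add: coeff_pderiv coeff_fderiv k.coeff_map del: of_nat_Suc)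
qed

text \<open>This is the relevant polynomial when the leading coefficient of \<open>p\<close> vanishes under a specialization.\<close>

definition trunc_poly :: "'a::comm_ring_1 poly \<Rightarrow> 'a poly" where
  "trunc_poly p = p - monom (lead_coeff p) (degree p)"

lemma degree_trunc_poly:
  assumes "degree p > 0"
  shows "degree (trunc_poly p) < degree p"
proof -
  have "coeff (trunc_poly p) i = 0" if "i \<ge> degree p" for i
    using that by (cases "i = degree p") (auto simp: trunc_poly_def coeff_eq_0)
  then have "degree (trunc_poly p) \<le> degree p - 1"
    using assms by (intro degree_le) auto
  then show ?thesis
    using assms by simp
qed

text \<open>A pseudo-remainder, as leading coefficients need not be invertible. The exponent is left
  open: at a root of \<open>f\<close> only the sign of the factor matters, and it is determined by
  the sign of \<open>lead_coeff f\<close>.\<close>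

definition is_rem :: "'a::comm_ring_1 poly \<Rightarrow> 'a::comm_ring_1 poly \<Rightarrow> 'a::comm_ring_1 poly \<Rightarrow> bool" where
  "is_rem p f r \<longleftrightarrow> (\<exists>k q. smult (lead_coeff f ^ k) p = q * f + r) \<and> degree r < degree f"

text \<open>These are the operations of the elimination algorithm. Two sets occur because the
  closure is built in stages, with results of operations on \<open>F\<close> allowed to lie in the
  larger \<open>G\<close>.\<close>

definition deriv_closed :: "'a::comm_ring_1 poly set \<Rightarrow> 'a::comm_ring_1 poly set \<Rightarrow> bool" where
  "deriv_closed F G \<longleftrightarrow>
    (\<forall>p\<in>F. degree p > 0 \<longrightarrow> fderiv p \<in> G \<and> trunc_poly p \<in> G) \<and>
    (\<forall>p\<in>F. \<forall>f\<in>F. 0 < degree f \<longrightarrow> degree f \<le> degree p \<longrightarrow> (\<exists>r\<in>G. is_rem p f r))"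

lemma deriv_closedD:
  assumes "deriv_closed F G" "p \<in> F" "degree p > 0"
  shows "fderiv p \<in> G" "trunc_poly p \<in> G"
  using assms unfolding deriv_closed_def by blast+

lemma deriv_closed_rem:
  assumes "deriv_closed F G" "p \<in> F" "f \<in> F" "0 < degree f" "degree f \<le> degree p"
  shows "\<exists>r\<in>G. is_rem p f r"
  using assms unfolding deriv_closed_def by blast

section \<open>Subrings, pseudo-division and closed families of polynomials\<close>

locale subring_set =
  fixes W :: "'b::comm_ring_1 set"
  assumes one: "1 \<in> W" and add: "x \<in> W \<Longrightarrow> y \<in> W \<Longrightarrow> x + y \<in> W"
    and uminus: "x \<in> W \<Longrightarrow> - x \<in> W" and mult: "x \<in> W \<Longrightarrow> y \<in> W \<Longrightarrow> x * y \<in> W"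
begin

lemma zero: "0 \<in> W"
  using add[OF one uminus[OF one]] by simp

lemma diff: "x \<in> W \<Longrightarrow> y \<in> W \<Longrightarrow> x - y \<in> W"
  using add[of x "- y"] uminus[of y] by simp

lemma power: "x \<in> W \<Longrightarrow> x ^ n \<in> W"
  by (induction n) (auto simp: one mult)

lemma of_nat: "of_nat n \<in> W"
  by (induction n) (auto simp: zero one add)

lemma sum: "(\<And>i. i \<in> S \<Longrightarrow> f i \<in> W) \<Longrightarrow> (\<Sum>i\<in>S. f i) \<in> W"
  by (induction S rule: infinite_finite_induct) (auto simp: zero add)

definition polys :: "'b poly set" where
  "polys = {p. \<forall>i. coeff p i \<in> W}"

lemma coeff_mem: "p \<in> polys \<Longrightarrow> coeff p i \<in> W"
  by (simp add: polys_def)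

lemma polys_0: "0 \<in> polys"
  by (simp add: polys_def zero)

lemma polys_add: "p \<in> polys \<Longrightarrow> q \<in> polys \<Longrightarrow> p + q \<in> polys"
  by (simp add: polys_def add)

lemma polys_diff: "p \<in> polys \<Longrightarrow> q \<in> polys \<Longrightarrow> p - q \<in> polys"
  by (simp add: polys_def diff)

lemma polys_mult: "p \<in> polys \<Longrightarrow> q \<in> polys \<Longrightarrow> p * q \<in> polys"
  by (auto simp: polys_def coeff_mult intro!: sum mult)

lemma polys_smult: "c \<in> W \<Longrightarrow> p \<in> polys \<Longrightarrow> smult c p \<in> polys"
  by (simp add: polys_def mult)

lemma polys_monom: "c \<in> W \<Longrightarrow> monom c n \<in> polys"
  by (simp add: polys_def zero)

lemma polys_pCons: "c \<in> W \<Longrightarrow> p \<in> polys \<Longrightarrow> pCons c p \<in> polys"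
  by (auto simp: polys_def coeff_pCons split: nat.split)

lemma polys_fderiv: "p \<in> polys \<Longrightarrow> fderiv p \<in> polys"
  using of_nat[of "Suc _"] by (auto simp: polys_def coeff_fderiv intro!: mult simp del: of_nat_Suc)

lemma polys_trunc: "p \<in> polys \<Longrightarrow> trunc_poly p \<in> polys"
  by (simp add: trunc_poly_def polys_diff polys_monom coeff_mem)

lemma pseudo_division:
  assumes "degree f > 0" "f \<in> polys" "p \<in> polys"
  shows "\<exists>k q r. q \<in> polys \<and> r \<in> polys \<and> smult (lead_coeff f ^ k) p = q * f + r \<and> degree r < degree f"
  using assms(3)
proof (induction "degree p" arbitrary: p rule: less_induct)
  case less
  show ?case
  proof (cases "degree p < degree f")
    case True
    then show ?thesis
      using less.prems polys_0 by (intro exI[of _ 0] exI[of _ 0] exI[of _ p]) simp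
  next
    case False
    define g where "g = monom (lead_coeff p) (degree p - degree f) * f"
    define p' where "p' = smult (lead_coeff f) p - g"
    have "g \<in> polys"
      using less.prems assms(2) by (auto simp: g_def intro!: polys_mult polys_monom coeff_mem)
    then have "p' \<in> polys"
      using less.prems assms(2) by (auto simp: p'_def intro!: polys_diff polys_smult coeff_mem)
    have "coeff p' i = 0" if "i \<ge> degree p" for i
    proof (cases "i = degree p")
      case True
      then show ?thesis
        using False by (simp add: p'_def g_def coeff_monom_mult)
    next
      case False
      then have "i - (degree p - degree f) > degree f"
        using that \<open>\<not> degree p < degree f\<close> by linarith
      then show ?thesis
        using that False by (simp add: p'_def g_def coeff_monom_mult coeff_eq_0)
    qed
    moreover have "degree p > 0"
      using False assms(1) by simp
    ultimately have "degree p' \<le> degree p - 1"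
      by (intro degree_le) auto
    then have "degree p' < degree p"
      using \<open>degree p > 0\<close> by simp
    from less.hyps[OF this \<open>p' \<in> polys\<close>] obtain k q r where
      *: "q \<in> polys" "r \<in> polys" "smult (lead_coeff f ^ k) p' = q * f + r" "degree r < degree f"
      by blast
    have "smult (lead_coeff f ^ Suc k) p = smult (lead_coeff f ^ k) (p' + g)"
      by (simp add: p'_def mult.commute)
    also have "\<dots> = (q + smult (lead_coeff f ^ k) (monom (lead_coeff p) (degree p - degree f))) * f + r"
      by (simp add: smult_add_right *(3) g_def algebra_simps)
    finally have "smult (lead_coeff f ^ Suc k) p =
      (q + smult (lead_coeff f ^ k) (monom (lead_coeff p) (degree p - degree f))) * f + r" .
    moreover have "q + smult (lead_coeff f ^ k) (monom (lead_coeff p) (degree p - degree f)) \<in> polys"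
      using *(1) less.prems assms(2)
      by (auto intro!: polys_add polys_smult polys_monom power coeff_mem)
    ultimately show ?thesis
      using *(2,4) by blast
  qed
qed

text \<open>The closure is built degree by degree from above: \<open>T\<close> is already dealt with, and the elements of
  degree \<open>n - 1\<close> of \<open>S\<close> are dealt with next.\<close>

lemma ex_deriv_closed_aux:
  assumes "finite S" "finite T" "S \<subseteq> polys" "T \<subseteq> polys"
    and "\<And>p. p \<in> S \<Longrightarrow> degree p < n" "\<And>p. p \<in> T \<Longrightarrow> n \<le> degree p"
    and "deriv_closed T (S \<union> T)"
  shows "\<exists>G. finite G \<and> G \<subseteq> polys \<and> S \<union> T \<subseteq> G \<and> deriv_closed G G"
  using assms
proof (induction n arbitrary: S T)
  case 0
  then have "S = {}"
    by auto
  then show ?case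
    using 0 by (intro exI[of _ T]) auto
next
  case (Suc n)
  define S1 where "S1 = {p \<in> S. degree p = n}"
  define T' where "T' = T \<union> S1"
  have "\<forall>p f. \<exists>r. p \<in> polys \<longrightarrow> f \<in> polys \<longrightarrow> degree f > 0 \<longrightarrow> r \<in> polys \<and> is_rem p f r"
    unfolding is_rem_def using pseudo_division by blast
  then obtain R where R: "\<And>p f. p \<in> polys \<Longrightarrow> f \<in> polys \<Longrightarrow> degree f > 0 \<Longrightarrow> R p f \<in> polys \<and> is_rem p f (R p f)"
    by metis
  define A where "A = {p \<in> S1. degree p > 0}"
  \<comment> \<open>Only remainders by divisors of degree \<open>n\<close> are new. If the divisor
    is in \<open>T\<close>, its degree exceeds \<open>n\<close>, so the dividend is in
    \<open>T\<close> as well and the remainder is already present.\<close>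
  define S' where "S' = (S - S1) \<union> fderiv ` A \<union> trunc_poly ` A \<union> (\<lambda>(p, f). R p f) ` (T' \<times> A)"
  have T'_polys: "T' \<subseteq> polys" and A_polys: "A \<subseteq> polys"
    using Suc.prems(3,4) by (auto simp: T'_def S1_def A_def)
  have "\<exists>G. finite G \<and> G \<subseteq> polys \<and> S' \<union> T' \<subseteq> G \<and> deriv_closed G G"
  proof (rule Suc.IH)
    have "finite S1" "finite A"
      using Suc.prems(1) by (auto simp: S1_def A_def)
    then show "finite S'" "finite T'"
      using Suc.prems(1,2) by (auto simp: S'_def T'_def)
    have "R p f \<in> polys" if "p \<in> T'" "f \<in> A" for p f
      using R[of p f] that T'_polys A_polys by (auto simp: A_def)
    then show "S' \<subseteq> polys"
      using Suc.prems(3) A_polys by (auto simp: S'_def polys_fderiv polys_trunc)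
    show "T' \<subseteq> polys"
      by fact
    show "n \<le> degree p" if "p \<in> T'" for p
      using that Suc.prems(6)[of p] by (auto simp: T'_def S1_def)
    have "degree (R p f) < n" if "p \<in> T'" "f \<in> A" for p f
      using R[of p f] that T'_polys A_polys by (auto simp: A_def S1_def is_rem_def)
    moreover have "degree (fderiv p) < n" if "p \<in> A" for p
      using that degree_fderiv[of p] by (auto simp: A_def S1_def)
    moreover have "degree (trunc_poly p) < n" if "p \<in> A" for p
      using that degree_trunc_poly[of p] by (auto simp: A_def S1_def)
    moreover have "degree p < n" if "p \<in> S - S1" for p
      using that Suc.prems(5)[of p] by (auto simp: S1_def)
    ultimately show "degree p < n" if "p \<in> S'" for p
      using that unfolding S'_def by auto
    have sub: "S \<union> T \<subseteq> S' \<union> T'"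
      by (auto simp: S'_def T'_def)
    have 1: "fderiv p \<in> S' \<union> T' \<and> trunc_poly p \<in> S' \<union> T'" if "p \<in> T'" "degree p > 0" for p
    proof (cases "p \<in> S1")
      case True
      then show ?thesis
        using that by (auto simp: S'_def A_def)
    next
      case False
      then have "p \<in> T"
        using that by (simp add: T'_def)
      then show ?thesis
        using that Suc.prems(7) sub unfolding deriv_closed_def by blast
    qed
    have 2: "\<exists>r\<in>S' \<union> T'. is_rem p f r" if "p \<in> T'" "f \<in> T'" "0 < degree f" "degree f \<le> degree p" for p f
    proof (cases "f \<in> S1")
      case True
      then have "f \<in> A"
        using that by (simp add: A_def)
      then have "R p f \<in> S'" "is_rem p f (R p f)"
        using that R[of p f] T'_polys by (auto simp: S'_def)
      then show ?thesis
        by blast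
    next
      case False
      then have "f \<in> T"
        using that by (simp add: T'_def)
      then have "p \<in> T"
        using that Suc.prems(6)[of f] by (auto simp: T'_def S1_def)
      then show ?thesis
        using that \<open>f \<in> T\<close> Suc.prems(7) sub unfolding deriv_closed_def by blast
    qed
    show "deriv_closed T' (S' \<union> T')"
      using 1 2 by (simp add: deriv_closed_def)
  qed
  moreover have "S \<union> T \<subseteq> S' \<union> T'"
    by (auto simp: S'_def T'_def)
  ultimately show ?case
    by (meson order.trans)
qed

lemma ex_deriv_closed:
  assumes "finite S" "S \<subseteq> polys"
  obtains G where "finite G" "G \<subseteq> polys" "S \<subseteq> G" "deriv_closed G G"
proof -
  have "\<exists>G. finite G \<and> G \<subseteq> polys \<and> S \<union> {} \<subseteq> G \<and> deriv_closed G G"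
  proof (rule ex_deriv_closed_aux)
    show "degree p < Suc (Max (insert 0 (degree ` S)))" if "p \<in> S" for p
      using that assms(1) by (simp add: le_imp_less_Suc)
  qed (use assms in \<open>auto simp: deriv_closed_def\<close>)
  then show ?thesis
    using that by auto
qed

end

section \<open>Comparison of signs in two ordered fields\<close>

definition same_sign :: "'a::linordered_field \<Rightarrow> 'b::linordered_field \<Rightarrow> bool" where
  "same_sign x y \<longleftrightarrow> (0 < x \<longleftrightarrow> 0 < y) \<and> (x < 0 \<longleftrightarrow> y < 0)"

lemma same_sign_pos: "x > 0 \<Longrightarrow> y > 0 \<Longrightarrow> same_sign x y"
  and same_sign_neg: "x < 0 \<Longrightarrow> y < 0 \<Longrightarrow> same_sign x y"
  and same_sign_zero: "same_sign 0 0"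
  by (auto simp: same_sign_def)

lemma same_sign_0_iff: "same_sign x y \<Longrightarrow> x = 0 \<longleftrightarrow> y = 0"
  by (auto simp: same_sign_def not_less_iff_gr_or_eq)

lemma same_sign_uminus: "same_sign (- x) (- y) \<longleftrightarrow> same_sign x y"
  by (auto simp: same_sign_def)

lemma same_sign_mult: "same_sign x y \<Longrightarrow> same_sign u v \<Longrightarrow> same_sign (x * u) (y * v)"
  by (auto simp: same_sign_def zero_less_mult_iff mult_less_0_iff)

lemma same_sign_power: "same_sign x y \<Longrightarrow> same_sign (x ^ n) (y ^ n)"
  by (induction n) (simp add: same_sign_def, simp add: same_sign_mult)

lemma same_sign_mult_cancel:
  assumes "same_sign x y" "same_sign (x * u) (y * v)" "x \<noteq> 0"
  shows "same_sign u v"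
proof -
  have "y \<noteq> 0"
    using assms(1,3) same_sign_0_iff by blast
  then show ?thesis
    using assms by (auto simp: same_sign_def zero_less_mult_iff mult_less_0_iff not_less_iff_gr_or_eq)
qed

text \<open>Inserting a polynomial either leaves a pair of corresponding cells whole or splits both
  at one point. \<open>Z\<close> records what is known of the splitting point, namely that it is a
  root.\<close>

definition cells_refine :: "('a::rcf \<Rightarrow> 'b::rcf \<Rightarrow> bool) \<Rightarrow> ('a \<Rightarrow> bool) \<Rightarrow>
    'a option \<Rightarrow> 'a option \<Rightarrow> 'b option \<Rightarrow> 'b option \<Rightarrow> bool" where
  "cells_refine S Z l u l' u' \<longleftrightarrow> (\<forall>x\<in>gap l u. \<forall>y\<in>gap l' u'. S x y) \<or>
    (\<exists>z\<in>gap l u. \<exists>w\<in>gap l' u'. Z z \<and> S z w \<and>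
      (\<forall>x\<in>gap l (Some z). \<forall>y\<in>gap l' (Some w). S x y) \<and>
      (\<forall>x\<in>gap (Some z) u. \<forall>y\<in>gap (Some w) u'. S x y))"

text \<open>The trichotomy of \<open>gap_sign_increasing\<close> depends only on the signs at the
  ends. These agree in the two fields, so both fields fall into the same case.\<close>

lemma gap_refine_pos:
  fixes P :: "'a::rcf poly" and R :: "'b::rcf poly"
  defines "S \<equiv> \<lambda>x y. same_sign (poly P x) (poly R y)"
  assumes "\<And>x. x \<in> gap l u \<Longrightarrow> poly (pderiv P) x > 0" "\<And>y. y \<in> gap l' u' \<Longrightarrow> poly (pderiv R) y > 0"
    and ne: "x0 \<in> gap l u" "y0 \<in> gap l' u'" and l: "rel_option S l l'" and u: "rel_option S u u'"
  shows "cells_refine S (\<lambda>z. poly P z = 0) l u l' u'"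
proof -
  note gP = gap_sign_increasing[of l u P, OF assms(2) ne(1)]
    and gR = gap_sign_increasing[of l' u' R, OF assms(3) ne(2)]
  have N: "(\<forall>a. l = Some a \<longrightarrow> poly P a < 0) \<longleftrightarrow> (\<forall>a. l' = Some a \<longrightarrow> poly R a < 0)"
    using l by (cases l; cases l') (auto simp: S_def same_sign_def)
  have Q: "(\<forall>a. u = Some a \<longrightarrow> poly P a > 0) \<longleftrightarrow> (\<forall>a. u' = Some a \<longrightarrow> poly R a > 0)"
    using u by (cases u; cases u') (auto simp: S_def same_sign_def)
  consider "\<not> (\<forall>a. l = Some a \<longrightarrow> poly P a < 0)" | "\<not> (\<forall>a. u = Some a \<longrightarrow> poly P a > 0)"
    | "\<forall>a. l = Some a \<longrightarrow> poly P a < 0" "\<forall>a. u = Some a \<longrightarrow> poly P a > 0"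
    by argo
  then show ?thesis
  proof cases
    case 1
    then have "poly P x > 0" if "x \<in> gap l u" for x
      using gP(1) that by metis
    moreover have "poly R x > 0" if "x \<in> gap l' u'" for x
      using gR(1) that 1 N by metis
    ultimately show ?thesis
      by (simp add: cells_refine_def S_def same_sign_pos)
  next
    case 2
    then have "poly P x < 0" if "x \<in> gap l u" for x
      using gP(2) that by metis
    moreover have "poly R x < 0" if "x \<in> gap l' u'" for x
      using gR(2) that 2 Q by metis
    ultimately show ?thesis
      by (simp add: cells_refine_def S_def same_sign_neg)
  next
    case 3
    then obtain z where z: "z \<in> gap l u" "poly P z = 0" "\<And>x. x \<in> gap l (Some z) \<Longrightarrow> poly P x < 0"
        "\<And>x. x \<in> gap (Some z) u \<Longrightarrow> poly P x > 0"
      using gP(3) by metis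
    obtain w where w: "w \<in> gap l' u'" "poly R w = 0" "\<And>x. x \<in> gap l' (Some w) \<Longrightarrow> poly R x < 0"
        "\<And>x. x \<in> gap (Some w) u' \<Longrightarrow> poly R x > 0"
      using gR(3) 3 N Q by metis
    show ?thesis
      unfolding cells_refine_def S_def
      by (intro disjI2 bexI[of _ z] bexI[of _ w] conjI ballI)
        (use z w in \<open>auto intro: same_sign_pos same_sign_neg same_sign_zero\<close>)
  qed
qed

section \<open>Sign diagrams for two specializations of the same coefficients\<close>

locale rhom_pair = phi: rhom phi + psi: rhom psi
  for phi :: "'c::comm_ring_1 \<Rightarrow> 'a::rcf" and psi :: "'c \<Rightarrow> 'b::rcf"
begin

definition same_signs :: "'c poly set \<Rightarrow> 'a \<Rightarrow> 'b \<Rightarrow> bool" where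
  "same_signs F x y \<longleftrightarrow>
    (\<forall>p\<in>F. same_sign (poly (map_poly phi p) x) (poly (map_poly psi p) y))"

text \<open>The points of the list cut the two lines into cells on which all signs are constant and agree;
  \<open>l\<close> and \<open>l'\<close> are the left ends of the part of the lines under consideration.\<close>

fun sign_diagram :: "'c poly set \<Rightarrow> 'a option \<Rightarrow> 'b option \<Rightarrow> ('a \<times> 'b) list \<Rightarrow> bool" where
  "sign_diagram F l l' [] \<longleftrightarrow> (\<forall>x\<in>gap l None. \<forall>y\<in>gap l' None. same_signs F x y)"
| "sign_diagram F l l' ((a, b) # r) \<longleftrightarrow> a \<in> gap l None \<and> b \<in> gap l' None \<and>
    (\<forall>x\<in>gap l (Some a). \<forall>y\<in>gap l' (Some b). same_signs F x y) \<and>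
    same_signs F a b \<and> sign_diagram F (Some a) (Some b) r"

lemma sign_diagram_transfer:
  "sign_diagram F l l' r \<Longrightarrow> x \<in> gap l None \<Longrightarrow> \<exists>y\<in>gap l' None. same_signs F x y"
proof (induction r arbitrary: l l')
  case Nil
  then show ?case
    using gap_None_right[of l'] by auto
next
  case (Cons ab r)
  obtain a b where [simp]: "ab = (a, b)"
    by fastforce
  consider "x < a" | "x = a" | "a < x"
    by fastforce
  then show ?case
  proof cases
    case 1
    then have "x \<in> gap l (Some a)"
      using Cons.prems by (auto simp: gap_def)
    moreover obtain y where "y \<in> gap l' (Some b)"
      using gap_Some_right[of b l'] Cons.prems by auto
    moreover from this have "y \<in> gap l' None"
      by (auto simp: gap_def)
    ultimately show ?thesis
      using Cons.prems by auto
  next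
    case 2
    then show ?thesis
      using Cons.prems by auto
  next
    case 3
    then have "x \<in> gap (Some a) None"
      by (simp add: gap_def)
    then obtain y where "y \<in> gap (Some b) None" "same_signs F x y"
      using Cons.IH[of "Some a" "Some b"] Cons.prems by auto
    moreover have "b \<in> gap l' None"
      using Cons.prems by simp
    ultimately show ?thesis
      using gap_right[of y b None l'] by blast
  qed
qed

lemma same_signs_insert: "same_signs (insert p F) x y \<longleftrightarrow> same_signs {p} x y \<and> same_signs F x y"
  by (auto simp: same_signs_def)

lemma sign_diagram_insert:
  assumes "\<And>x y. same_signs F x y \<Longrightarrow> same_signs {p} x y"
  shows "sign_diagram F l l' r \<Longrightarrow> sign_diagram (insert p F) l l' r"
proof -
  have eq: "same_signs (insert p F) = same_signs F"
    by (intro ext) (use assms in \<open>metis same_signs_insert\<close>)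
  have "sign_diagram (insert p F) l l' r \<longleftrightarrow> sign_diagram F l l' r"
  proof (induction r arbitrary: l l')
    case (Cons ab r)
    then show ?case
      by (cases ab) (simp add: eq)
  qed (simp add: eq)
  then show "sign_diagram F l l' r \<Longrightarrow> sign_diagram (insert p F) l l' r"
    by simp
qed

lemma same_signs_single:
  "same_signs {p} x y \<longleftrightarrow> same_sign (poly (map_poly phi p) x) (poly (map_poly psi p) y)"
  by (simp add: same_signs_def)

lemma gap_refine:
  assumes deriv: "\<And>x y. x \<in> gap l u \<Longrightarrow> y \<in> gap l' u' \<Longrightarrow> same_signs {fderiv p} x y"
    and ne: "x0 \<in> gap l u" "y0 \<in> gap l' u'"
    and nz: "phi (lead_coeff p) \<noteq> 0" "degree p > 0"
    and l: "rel_option (same_signs {p}) l l'" and u: "rel_option (same_signs {p}) u u'"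
  shows "cells_refine (same_signs {p}) (\<lambda>z. poly (map_poly phi p) z = 0) l u l' u'"
proof -
  define P R where "P = map_poly phi p" and "R = map_poly psi p"
  have P': "map_poly phi (fderiv p) = pderiv P" and R': "map_poly psi (fderiv p) = pderiv R"
    by (simp_all add: P_def R_def map_poly_fderiv phi.rhom_axioms psi.rhom_axioms)
  have sign: "same_sign (poly (pderiv P) x) (poly (pderiv R) y)" if "x \<in> gap l u" "y \<in> gap l' u'" for x y
    using deriv[OF that] by (simp add: same_signs_single P' R')
  have ss: "same_signs {p} = (\<lambda>x y. same_sign (poly P x) (poly R y))"
    by (intro ext) (simp add: same_signs_single P_def R_def)
  consider "poly (pderiv R) y0 > 0" | "poly (pderiv R) y0 < 0" | "poly (pderiv R) y0 = 0"
    by fastforce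
  then show ?thesis
  proof cases
    case 1
    then have "poly (pderiv P) x > 0" if "x \<in> gap l u" for x
      using sign[OF that ne(2)] by (simp add: same_sign_def)
    moreover from this have "poly (pderiv R) y > 0" if "y \<in> gap l' u'" for y
      using sign[OF ne(1) that] ne(1) by (simp add: same_sign_def)
    ultimately show ?thesis
      using gap_refine_pos[of l u P l' u' R, OF _ _ ne] l u unfolding ss P_def[symmetric] by blast
  next
    case 2
    then have "poly (pderiv P) x < 0" if "x \<in> gap l u" for x
      using sign[OF that ne(2)] by (simp add: same_sign_def)
    then have *: "poly (pderiv (- P)) x > 0" if "x \<in> gap l u" for x
      using that by (simp add: pderiv_minus)
    have "poly (pderiv R) y < 0" if "y \<in> gap l' u'" for y
      using sign[OF ne(1) that] *[OF ne(1)] by (simp add: same_sign_def pderiv_minus)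
    then have **: "poly (pderiv (- R)) y > 0" if "y \<in> gap l' u'" for y
      using that by (simp add: pderiv_minus)
    show ?thesis
      using gap_refine_pos[of l u "- P" l' u' "- R", OF * ** ne] l u
      unfolding ss P_def[symmetric] by (simp add: same_sign_uminus)
  next
    case 3
    \<comment> \<open>A derivative vanishing on an infinite gap is the zero polynomial, against the
      nonzero leading coefficient of \<open>P\<close> in characteristic 0.\<close>
    then have "poly (pderiv P) x = 0" if "x \<in> gap l u" for x
      using sign[OF that ne(2)] same_sign_0_iff by metis
    then have "gap l u \<subseteq> {x. poly (pderiv P) x = 0}"
      by blast
    then have "pderiv P = 0"
      using infinite_gap[OF ne(1)] poly_roots_finite finite_subset by metis
    moreover have "coeff (pderiv P) (degree p - 1) = of_nat (degree p) * phi (lead_coeff p)"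
      using nz(2) by (simp add: coeff_pderiv P_def phi.coeff_map del: of_nat_Suc)
    ultimately show ?thesis
      using nz by simp
  qed
qed

text \<open>The signs of \<open>p\<close> at the old points are given; the cells are treated by
  \<open>gap_refine\<close>. That new points are roots of \<open>p\<close> is recorded to keep the
  invariant of \<open>ex_sign_diagram\<close>, on which the next insertion relies.\<close>

lemma sign_diagram_refine:
  assumes p: "fderiv p \<in> F" "phi (lead_coeff p) \<noteq> 0" "degree p > 0"
  shows "sign_diagram F l l' r \<Longrightarrow> rel_option (same_signs {p}) l l' \<Longrightarrow>
    (\<forall>(a, b)\<in>set r. same_signs {p} a b) \<Longrightarrow>
    \<exists>r'. sign_diagram (insert p F) l l' r' \<and>
      (\<forall>(a, b)\<in>set r'. (a, b) \<in> set r \<or> poly (map_poly phi p) a = 0)"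
proof (induction r arbitrary: l l')
  case Nil
  have F: "same_signs F x y" if "x \<in> gap l None" "y \<in> gap l' None" for x y
    using Nil that by simp
  obtain x0 y0 where ne: "x0 \<in> gap l None" "y0 \<in> gap l' None"
    using gap_None_right by metis
  have "same_signs {fderiv p} x y" if "x \<in> gap l None" "y \<in> gap l' None" for x y
    using F[OF that] p(1) by (simp add: same_signs_def)
  from gap_refine[OF this ne p(2,3) Nil.prems(2)] consider
      "\<forall>x\<in>gap l None. \<forall>y\<in>gap l' None. same_signs {p} x y"
    | z w where "z \<in> gap l None" "w \<in> gap l' None" "poly (map_poly phi p) z = 0" "same_signs {p} z w"
      "\<forall>x\<in>gap l (Some z). \<forall>y\<in>gap l' (Some w). same_signs {p} x y"
      "\<forall>x\<in>gap (Some z) None. \<forall>y\<in>gap (Some w) None. same_signs {p} x y"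
    unfolding cells_refine_def by auto
  then show ?case
  proof cases
    case 1
    then show ?thesis
      using F by (intro exI[of _ "[]"]) (simp add: same_signs_insert[of p F])
  next
    case 2
    then show ?thesis
      using F gap_left[OF _ 2(1)] gap_left[OF _ 2(2)] gap_right[OF _ 2(1)] gap_right[OF _ 2(2)]
      by (intro exI[of _ "[(z, w)]"]) (simp add: same_signs_insert[of p F])
  qed
next
  case (Cons ab r)
  obtain a b where [simp]: "ab = (a, b)"
    by fastforce
  have ab: "a \<in> gap l None" "b \<in> gap l' None" "same_signs F a b" "same_signs {p} a b"
    and F: "\<And>x y. x \<in> gap l (Some a) \<Longrightarrow> y \<in> gap l' (Some b) \<Longrightarrow> same_signs F x y"
    using Cons.prems by simp_all
  obtain r' where r': "sign_diagram (insert p F) (Some a) (Some b) r'"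
      "\<forall>(a, b)\<in>set r'. (a, b) \<in> set r \<or> poly (map_poly phi p) a = 0"
    using Cons.IH[of "Some a" "Some b"] Cons.prems by auto
  obtain x0 y0 where ne: "x0 \<in> gap l (Some a)" "y0 \<in> gap l' (Some b)"
    using gap_Some_right ab by metis
  have "same_signs {fderiv p} x y" if "x \<in> gap l (Some a)" "y \<in> gap l' (Some b)" for x y
    using F[OF that] p(1) by (simp add: same_signs_def)
  from gap_refine[OF this ne p(2,3) Cons.prems(2)] ab consider
      "\<forall>x\<in>gap l (Some a). \<forall>y\<in>gap l' (Some b). same_signs {p} x y"
    | z w where "z \<in> gap l (Some a)" "w \<in> gap l' (Some b)" "poly (map_poly phi p) z = 0" "same_signs {p} z w"
      "\<forall>x\<in>gap l (Some z). \<forall>y\<in>gap l' (Some w). same_signs {p} x y"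
      "\<forall>x\<in>gap (Some z) (Some a). \<forall>y\<in>gap (Some w) (Some b). same_signs {p} x y"
    unfolding cells_refine_def by auto
  then show ?case
  proof cases
    case 1
    then show ?thesis
      using F r' ab by (intro exI[of _ "(a, b) # r'"]) (auto simp: same_signs_insert[of p F])
  next
    case 2
    have za: "z \<in> gap l None" "w \<in> gap l' None" "a \<in> gap (Some z) None" "b \<in> gap (Some w) None"
      using 2(1,2) by (auto simp: gap_def)
    show ?thesis
      using 2 F r' ab za gap_left[OF _ 2(1)] gap_left[OF _ 2(2)] gap_right[OF _ 2(1)] gap_right[OF _ 2(2)]
      by (intro exI[of _ "(z, w) # (a, b) # r'"]) (auto simp: same_signs_insert[of p F])
  qed
qed

text \<open>Polynomials are added in order of increasing degree. The sign of a new one at the points already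
  present, which are roots of earlier ones, is that of a remainder, hence already known.\<close>

lemma ex_sign_diagram:
  assumes "finite G" "deriv_closed G G" "\<forall>p\<in>G. same_sign (phi (lead_coeff p)) (psi (lead_coeff p))"
  shows "\<exists>r. sign_diagram G None None r \<and>
    (\<forall>(a, b)\<in>set r. \<exists>f\<in>G. phi (lead_coeff f) \<noteq> 0 \<and> poly (map_poly phi f) a = 0)"
  using assms
proof (induction G rule: finite_ranking_induct[where f = degree])
  case empty
  show ?case
    by (intro exI[of _ "[]"]) (simp add: same_signs_def)
next
  case (insert p G)
  have cl: "deriv_closed (insert p G) (insert p G)"
    by fact
  \<comment> \<open>\<open>p\<close> has maximal degree, and all derived polynomials have smaller
    degree than \<open>p\<close>, so none of them is \<open>p\<close>.\<close>
  have "deriv_closed G G"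
    unfolding deriv_closed_def
  proof (intro conjI ballI impI)
    fix q assume q: "q \<in> G" "degree q > 0"
    then have "fderiv q \<in> insert p G" "trunc_poly q \<in> insert p G"
      using deriv_closedD[OF cl] by blast+
    moreover have "degree (fderiv q) < degree p" "degree (trunc_poly q) < degree p"
      using degree_fderiv[OF q(2)] degree_trunc_poly[OF q(2)] insert.hyps(2)[OF q(1)] by auto
    ultimately show "fderiv q \<in> G" "trunc_poly q \<in> G"
      by auto
  next
    fix q f assume q: "q \<in> G" "f \<in> G" "0 < degree f" "degree f \<le> degree q"
    then obtain r where "r \<in> insert p G" "is_rem q f r"
      using deriv_closed_rem[OF cl, of q f] by blast
    moreover from this have "degree r < degree p"
      using insert.hyps(2)[OF q(2)] by (simp add: is_rem_def)
    ultimately show "\<exists>r\<in>G. is_rem q f r"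
      by auto
  qed
  then obtain r where r: "sign_diagram G None None r"
      "\<forall>(a, b)\<in>set r. \<exists>f\<in>G. phi (lead_coeff f) \<noteq> 0 \<and> poly (map_poly phi f) a = 0"
    using insert.IH insert.prems by (elim meta_impE exE conjE) auto
  have lc: "same_sign (phi (lead_coeff p)) (psi (lead_coeff p))"
    using insert.prems by simp
  consider "degree p = 0" | "degree p > 0" "phi (lead_coeff p) = 0" | "degree p > 0" "phi (lead_coeff p) \<noteq> 0"
    by blast
  then show ?case
  proof cases
    case 1
    then obtain c where c: "p = [:c:]"
      using degree_eq_zeroE by blast
    have "same_signs {p} x y" for x y
      using lc by (simp add: same_signs_single c map_poly_pCons)
    then show ?thesis
      using r by (intro exI[of _ r]) (auto intro: sign_diagram_insert)
  next
    case 2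
    have psi0: "psi (lead_coeff p) = 0"
      using 2(2) lc same_sign_0_iff by blast
    have "trunc_poly p \<in> insert p G"
      using deriv_closedD[OF cl _ 2(1)] by simp
    then have "trunc_poly p \<in> G"
      using degree_trunc_poly[OF 2(1)] by auto
    moreover have "map_poly phi (trunc_poly p) = map_poly phi p" "map_poly psi (trunc_poly p) = map_poly psi p"
      using 2(2) psi0 by (simp_all add: trunc_poly_def)
    ultimately have "same_signs {p} x y" if "same_signs G x y" for x y
      using that unfolding same_signs_single by (metis same_signs_def)
    then show ?thesis
      using r by (intro exI[of _ r]) (auto intro: sign_diagram_insert)
  next
    case 3
    have "fderiv p \<in> insert p G"
      using deriv_closedD[OF cl _ 3(1)] by simp
    then have deriv: "fderiv p \<in> G"
      using degree_fderiv[OF 3(1)] by auto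
    have points: "same_signs {p} a b" if ab: "(a, b) \<in> set r" for a b
    proof -
      have "sign_diagram G l l' r \<Longrightarrow> (a, b) \<in> set r \<Longrightarrow> same_signs G a b" for l l' r
        by (induction r arbitrary: l l') auto
      then have G: "same_signs G a b"
        using r(1) ab by blast
      obtain f where f: "f \<in> G" "phi (lead_coeff f) \<noteq> 0" "poly (map_poly phi f) a = 0"
        using r(2) ab by blast
      then have f0: "poly (map_poly psi f) b = 0"
        using G same_sign_0_iff by (metis same_signs_def)
      have "degree f > 0"
      proof (rule ccontr)
        assume "\<not> ?thesis"
        then obtain c where "f = [:c:]"
          using degree_eq_zeroE by blast
        then show False
          using f by (simp add: map_poly_pCons)
      qed
      then obtain s where s: "s \<in> insert p G" "is_rem p f s"
        using deriv_closed_rem[OF cl, of p f] f(1) insert.hyps(2)[OF f(1)] by blast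
      then have "degree s < degree p"
        using insert.hyps(2)[OF f(1)] by (simp add: is_rem_def)
      then have sG: "s \<in> G"
        using s(1) by auto
      \<comment> \<open>At the root \<open>a\<close> of \<open>f\<close>, and at the matching root
        \<open>b\<close>, the term \<open>q * f\<close> drops out. Thus the sign of \<open>p\<close>
        is that of \<open>s\<close>, corrected by the known nonzero sign of
        \<open>lead_coeff f ^ k\<close>.\<close>
      obtain k q where kq: "smult (lead_coeff f ^ k) p = q * f + s"
        using s(2) by (auto simp: is_rem_def)
      have "phi (lead_coeff f) ^ k * poly (map_poly phi p) a = poly (map_poly phi s) a"
        using arg_cong[OF kq, of "\<lambda>p. poly (map_poly phi p) a"] f(3) by simp
      moreover have "psi (lead_coeff f) ^ k * poly (map_poly psi p) b = poly (map_poly psi s) b"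
        using arg_cong[OF kq, of "\<lambda>p. poly (map_poly psi p) b"] f0 by simp
      moreover have "same_sign (poly (map_poly phi s) a) (poly (map_poly psi s) b)"
        using G sG by (simp add: same_signs_def)
      moreover have "same_sign (phi (lead_coeff f) ^ k) (psi (lead_coeff f) ^ k)"
        using insert.prems(2) f(1) by (simp add: same_sign_power)
      ultimately show ?thesis
        unfolding same_signs_single using f(2) same_sign_mult_cancel
        by (metis power_not_zero)
    qed
    obtain r' where r': "sign_diagram (insert p G) None None r'"
        "\<forall>(a, b)\<in>set r'. (a, b) \<in> set r \<or> poly (map_poly phi p) a = 0"
      using sign_diagram_refine[OF deriv 3(2,1) r(1)] points by auto
    then show ?thesis
      using r(2) 3(2) by (intro exI[of _ r']) fastforce
  qed
qed

end

text \<open>Elimination of one variable: agreement of the signs of finitely many coefficients allows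
  any \<open>x\<close> to be matched by some \<open>y\<close>. That \<open>Q\<close> lies in
  \<open>W\<close> and is chosen before \<open>phi\<close>, \<open>psi\<close> and \<open>x\<close>
  is what permits iteration over the variables.\<close>

lemma (in subring_set) sign_transfer:
  assumes "finite S" "S \<subseteq> polys"
  shows "\<exists>Q. finite Q \<and> Q \<subseteq> W \<and>
    (\<forall>(phi :: 'b \<Rightarrow> 'x::rcf) (psi :: 'b \<Rightarrow> 'y::rcf) x. rhom phi \<longrightarrow> rhom psi \<longrightarrow>
      (\<forall>c\<in>Q. same_sign (phi c) (psi c)) \<longrightarrow>
      (\<exists>y. \<forall>p\<in>S. same_sign (poly (map_poly phi p) x) (poly (map_poly psi p) y)))"
proof -
  obtain G where G: "finite G" "G \<subseteq> polys" "S \<subseteq> G" "deriv_closed G G"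
    using ex_deriv_closed[OF assms] by blast
  show ?thesis
  proof (intro exI[of _ "lead_coeff ` G"] conjI allI impI)
    show "finite (lead_coeff ` G)" "lead_coeff ` G \<subseteq> W"
      using G(1,2) by (auto simp: coeff_mem)
    fix phi :: "'b \<Rightarrow> 'x" and psi :: "'b \<Rightarrow> 'y" and x
    assume h: "rhom phi" "rhom psi" "\<forall>c\<in>lead_coeff ` G. same_sign (phi c) (psi c)"
    interpret rhom_pair phi psi
      using h by (simp add: rhom_pair_def)
    obtain r where "sign_diagram G None None r"
      using ex_sign_diagram[OF G(1,4)] h(3) by blast
    from sign_diagram_transfer[OF this, of x] obtain y where "same_signs G x y"
      by (auto simp: gap_def)
    then show "\<exists>y. \<forall>p\<in>S. same_sign (poly (map_poly phi p) x) (poly (map_poly psi p) y)"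
      using G(3) by (auto simp: same_signs_def)
  qed
qed

section \<open>Real closure inside an algebraically closed field\<close>

text \<open>The substitution \<open>a + 1 / (1 / (b - a) + Y * Y)\<close> takes values in the
  interval from \<open>a\<close> (excluded) to \<open>b\<close>. After clearing denominators it
  turns \<open>p\<close> into \<open>t\<close>, whose leading coefficient is \<open>poly p a\<close>
  and whose constant coefficient has the sign of \<open>poly p b\<close>. Thus intermediate values
  reduce to a criterion on the two extreme coefficients.\<close>

lemma ivt_of_sign_change_root:
  fixes p :: "'a::linordered_field poly"
  assumes H: "\<And>q :: 'a poly. coeff q 0 * lead_coeff q < 0 \<Longrightarrow> \<exists>x. poly q x = 0"
    and ab: "a < b" "poly p a < 0" "0 < poly p b"
  shows "\<exists>x. a < x \<and> x < b \<and> poly p x = 0"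
proof -
  define q where "q = p \<circ>\<^sub>p [:a, 1:]"
  define r where "r = reflect_poly q"
  define t where "t = (r \<circ>\<^sub>p [:1 / (b - a), 1:]) \<circ>\<^sub>p [:0, 0, 1:]"
  have q: "poly q y = poly p (a + y)" for y
    by (simp add: q_def poly_pcompose)
  have r: "poly r y = y ^ degree q * poly q (inverse y)" if "y \<noteq> 0" for y
    using that by (simp add: r_def poly_reflect_poly_nz)
  have t: "poly t y = poly r (1 / (b - a) + y * y)" for y
    by (simp add: t_def poly_pcompose)
  have "coeff q 0 = poly p a"
    using q[of 0] by (simp add: poly_0_coeff_0)
  then have "lead_coeff r = poly p a"
    using ab(2) coeff_0_reflect_poly[of r] by (simp add: r_def)
  moreover have "lead_coeff t = lead_coeff r"
    unfolding t_def by (subst lead_coeff_comp, simp, subst lead_coeff_comp) simp_all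
  moreover have "coeff t 0 = poly r (1 / (b - a))"
    using t[of 0] by (simp add: poly_0_coeff_0)
  moreover have "poly r (1 / (b - a)) > 0"
    using r[of "1 / (b - a)"] ab q[of "b - a"] by simp
  ultimately have "coeff t 0 * lead_coeff t < 0"
    using ab(2) by (simp add: mult_pos_neg)
  then obtain y where y: "poly t y = 0"
    using H by blast
  define z where "z = 1 / (b - a) + y * y"
  have z: "z > 0" "1 / (b - a) \<le> z"
    using ab(1) by (auto simp: z_def intro: add_pos_nonneg)
  then have root: "poly p (a + inverse z) = 0"
    using y t[of y] r[of z] q by (simp add: z_def)
  have "inverse z \<le> b - a"
    using z ab(1) by (simp add: field_simps)
  moreover have "inverse z \<noteq> b - a"
    using root ab(3) by auto
  ultimately have "a + inverse z < b"
    by simp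
  moreover have "a < a + inverse z"
    using z(1) by simp
  ultimately show ?thesis
    using root by blast
qed

text \<open>The nonnegative part of an order whose domain is not fixed in advance. Squares are
  demanded only for differences of members: in an algebraically closed field, admitting all squares
  would admit - 1.\<close>

definition real_cone :: "'a::field set \<Rightarrow> bool" where
  "real_cone C \<longleftrightarrow> 1 \<in> C \<and> (\<forall>x\<in>C. \<forall>y\<in>C. x + y \<in> C \<and> x * y \<in> C \<and> (x - y) * (x - y) \<in> C) \<and>
    (\<forall>x\<in>C. - x \<in> C \<longrightarrow> x = 0)"

definition max_real_cone :: "'a::field set \<Rightarrow> bool" where
  "max_real_cone C \<longleftrightarrow> real_cone C \<and> (\<forall>D. real_cone D \<longrightarrow> C \<subseteq> D \<longrightarrow> D = C)"

lemma real_coneI: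
  assumes "1 \<in> C" "\<And>x y. x \<in> C \<Longrightarrow> y \<in> C \<Longrightarrow> x + y \<in> C" "\<And>x y. x \<in> C \<Longrightarrow> y \<in> C \<Longrightarrow> x * y \<in> C"
    "\<And>x y. x \<in> C \<Longrightarrow> y \<in> C \<Longrightarrow> (x - y) * (x - y) \<in> C" "\<And>x. x \<in> C \<Longrightarrow> - x \<in> C \<Longrightarrow> x = 0"
  shows "real_cone C"
  unfolding real_cone_def by (intro conjI ballI impI assms)

lemma real_coneD:
  assumes "real_cone C"
  shows "1 \<in> C" "x \<in> C \<Longrightarrow> y \<in> C \<Longrightarrow> x + y \<in> C" "x \<in> C \<Longrightarrow> y \<in> C \<Longrightarrow> x * y \<in> C"
    "x \<in> C \<Longrightarrow> y \<in> C \<Longrightarrow> (x - y) * (x - y) \<in> C" "x \<in> C \<Longrightarrow> - x \<in> C \<Longrightarrow> x = 0"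
  using assms by (auto simp: real_cone_def)

lemma ex_max_real_cone:
  assumes "real_cone T"
  obtains C where "max_real_cone C" "T \<subseteq> C"
proof (rule ex_maximal_superset[of real_cone T])
  show "real_cone T"
    by fact
next
  fix Z :: "'a set set"
  assume Z: "Z \<noteq> {}" and A: "\<And>C. C \<in> Z \<Longrightarrow> real_cone C"
    and directed: "\<And>x y. x \<in> \<Union>Z \<Longrightarrow> y \<in> \<Union>Z \<Longrightarrow> \<exists>C\<in>Z. x \<in> C \<and> y \<in> C"
  show "real_cone (\<Union>Z)"
  proof (rule real_coneI)
    show "1 \<in> \<Union>Z"
      using A Z real_coneD(1) by blast
  next
    fix x y
    assume "x \<in> \<Union>Z" "y \<in> \<Union>Z"
    from directed[OF this] obtain C where "C \<in> Z" "x \<in> C" "y \<in> C"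
      by blast
    then show "x + y \<in> \<Union>Z" "x * y \<in> \<Union>Z" "(x - y) * (x - y) \<in> \<Union>Z"
      using real_coneD(2-4)[OF A, of C x y] by blast+
  next
    fix x
    assume "x \<in> \<Union>Z" "- x \<in> \<Union>Z"
    from directed[OF this] obtain C where "C \<in> Z" "x \<in> C" "- x \<in> C"
      by blast
    then show "x = 0"
      using real_coneD(5)[OF A, of C x] by blast
  qed
next
  fix C
  assume "real_cone C" "T \<subseteq> C" "\<And>Q. real_cone Q \<Longrightarrow> C \<subseteq> Q \<Longrightarrow> Q = C"
  then show thesis
    by (intro that) (simp_all add: max_real_cone_def)
qed

inductive_set weighted_squares :: "'a::comm_ring_1 set \<Rightarrow> 'a set \<Rightarrow> 'a set" for C F where
  zero: "0 \<in> weighted_squares C F"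
| step: "t \<in> weighted_squares C F \<Longrightarrow> c \<in> C \<Longrightarrow> w \<in> F \<Longrightarrow> t + c * (w * w) \<in> weighted_squares C F"

lemma weighted_squares_add:
  assumes "s \<in> weighted_squares C F" "t \<in> weighted_squares C F"
  shows "s + t \<in> weighted_squares C F"
  using assms(2)
proof induction
  case (step t c w)
  then have "s + t + c * (w * w) \<in> weighted_squares C F"
    by (intro weighted_squares.step)
  then show ?case
    by (simp add: add.assoc)
qed (simp add: assms(1))

lemma weighted_squares_scale:
  assumes "t \<in> weighted_squares C F" "c \<in> C" "w \<in> F"
    and "\<And>x y. x \<in> C \<Longrightarrow> y \<in> C \<Longrightarrow> x * y \<in> C" "\<And>x y. x \<in> F \<Longrightarrow> y \<in> F \<Longrightarrow> x * y \<in> F"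
  shows "c * (w * w) * t \<in> weighted_squares C F"
  using assms(1)
proof induction
  case (step t d v)
  then have "c * (w * w) * t + (c * d) * ((w * v) * (w * v)) \<in> weighted_squares C F"
    using assms by (intro weighted_squares.step) auto
  then show ?case
    by (simp add: algebra_simps)
qed (simp add: weighted_squares.zero)

lemma weighted_squares_mult:
  assumes "s \<in> weighted_squares C F" "t \<in> weighted_squares C F"
    and "\<And>x y. x \<in> C \<Longrightarrow> y \<in> C \<Longrightarrow> x * y \<in> C" "\<And>x y. x \<in> F \<Longrightarrow> y \<in> F \<Longrightarrow> x * y \<in> F"
  shows "s * t \<in> weighted_squares C F"
  using assms(1)
proof induction
  case (step s c w)
  then have "s * t + c * (w * w) * t \<in> weighted_squares C F"
    using weighted_squares_scale[OF assms(2) _ _ assms(3,4)] weighted_squares_add by blast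
  then show ?case
    by (simp add: algebra_simps)
qed (simp add: weighted_squares.zero)

locale maximal_real_cone =
  fixes C :: "'a::field set"
  assumes max_real_cone: "max_real_cone C"
begin

lemma real_cone: "real_cone C"
  and max: "real_cone D \<Longrightarrow> C \<subseteq> D \<Longrightarrow> D = C"
  using max_real_cone by (auto simp: max_real_cone_def)

lemmas one = real_coneD(1)[OF real_cone]
  and add = real_coneD(2)[OF real_cone]
  and mult = real_coneD(3)[OF real_cone]
  and square_diff = real_coneD(4)[OF real_cone]
  and proper = real_coneD(5)[OF real_cone]

lemma zero: "0 \<in> C"
  using square_diff[OF one one] by simp

lemma power: "x \<in> C \<Longrightarrow> x ^ n \<in> C"
  by (induction n) (auto simp: one mult)

text \<open>Localization: admitting powers of \<open>c\<close> as denominators gives a real cone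
  again, so by maximality nothing new arises.\<close>

lemma inverse:
  assumes "c \<in> C"
  shows "inverse c \<in> C"
proof (cases "c = 0")
  case True
  then show ?thesis
    by (simp add: zero)
next
  case False
  define D where "D = {x. \<exists>k. x * c ^ k \<in> C}"
  have D: "x \<in> D" if "x * c ^ k \<in> C" for x k
    using that by (auto simp: D_def)
  have raise: "x * c ^ (k + l) \<in> C" if "x * c ^ k \<in> C" for x k l
    using mult[OF that power[OF assms, of l]] by (simp add: power_add mult.assoc)
  have common: "\<exists>k. x * c ^ k \<in> C \<and> y * c ^ k \<in> C" if "x \<in> D" "y \<in> D" for x y
    using that raise unfolding D_def by (auto simp: add.commute) (metis add.commute)
  have "real_cone D"
  proof (rule real_coneI)
    show "1 \<in> D"
      by (rule D[of _ 0]) (simp add: one)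
  next
    fix x y
    assume "x \<in> D" "y \<in> D"
    then obtain k where k: "x * c ^ k \<in> C" "y * c ^ k \<in> C"
      using common by blast
    show "x + y \<in> D"
      by (rule D[of _ k]) (use add[OF k] in \<open>simp add: algebra_simps\<close>)
    show "x * y \<in> D"
      by (rule D[of _ "k + k"]) (use mult[OF k] in \<open>simp add: algebra_simps power_add\<close>)
    show "(x - y) * (x - y) \<in> D"
      by (rule D[of _ "k + k"]) (use square_diff[OF k] in \<open>simp add: algebra_simps power_add\<close>)
  next
    fix x
    assume "x \<in> D" "- x \<in> D"
    then obtain k where k: "x * c ^ k \<in> C" "- x * c ^ k \<in> C"
      using common by blast
    then have "x * c ^ k = 0"
      by (intro proper) simp_all
    then show "x = 0"
      using False by simp
  qed
  moreover have "C \<subseteq> D"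
    using D[of _ 0] by auto
  ultimately have "D = C"
    by (rule max)
  moreover have "inverse c \<in> D"
    by (rule D[of _ 1]) (use False one in simp)
  ultimately show ?thesis
    by simp
qed

text \<open>The subfield ordered by \<open>C\<close>. By \<open>diff_cases\<close> it consists of
  all differences of members of \<open>C\<close>.\<close>

definition E :: "'a set" where
  "E = {x. x \<in> C \<or> - x \<in> C}"

text \<open>If \<open>- z\<close> is not in \<open>C\<close>, then \<open>C + z * C\<close> is a
  real cone and maximality puts \<open>z\<close> into \<open>C\<close>: a failure of properness
  would exhibit \<open>- z\<close> as a quotient of members of \<open>C\<close>.\<close>

lemma diff_cases:
  assumes "x \<in> C" "y \<in> C"
  shows "x - y \<in> C \<or> y - x \<in> C"
proof -
  define z where "z = x - y"
  define D where "D = {a + z * b | a b. a \<in> C \<and> b \<in> C}"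
  have D: "a + z * b \<in> D" if "a \<in> C" "b \<in> C" for a b
    using that by (auto simp: D_def)
  have zz: "z * z \<in> C"
    using square_diff[OF assms] by (simp add: z_def)
  show ?thesis
  proof (rule ccontr)
    assume "\<not> ?thesis"
    then have nz: "z \<notin> C" "- z \<notin> C"
      by (auto simp: z_def)
    have "real_cone D"
    proof (rule real_coneI)
      show "1 \<in> D"
        using D[OF one zero] by simp
    next
      fix u v
      assume "u \<in> D" "v \<in> D"
      then obtain a b a' b' where *: "a \<in> C" "b \<in> C" "a' \<in> C" "b' \<in> C" "u = a + z * b" "v = a' + z * b'"
        by (auto simp: D_def)
      show "u + v \<in> D"
        using D[of "a + a'" "b + b'"] * by (simp add: add algebra_simps)
      show "u * v \<in> D"
        using D[of "a * a' + z * z * (b * b')" "a * b' + b * a'"] * zz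
        by (simp add: add mult algebra_simps)
      \<comment> \<open>Since \<open>z = x - y\<close>, a difference in \<open>D\<close> is also a
        difference of members of \<open>C\<close>, so its square is already in
        \<open>C\<close>.\<close>
      have "u - v = (a + x * b + y * b') - (a' + x * b' + y * b)"
        unfolding *(5,6) by (simp add: z_def algebra_simps)
      moreover have "a + x * b + y * b' \<in> C" "a' + x * b' + y * b \<in> C"
        using * assms by (auto intro!: add mult)
      ultimately have "(u - v) * (u - v) \<in> C"
        using square_diff by metis
      then show "(u - v) * (u - v) \<in> D"
        using D[OF _ zero] by fastforce
    next
      fix u
      assume "u \<in> D" "- u \<in> D"
      then obtain a b a' b' where *: "a \<in> C" "b \<in> C" "a' \<in> C" "b' \<in> C" "u = a + z * b" "- u = a' + z * b'"
        by (auto simp: D_def)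
      have "(a + z * b) + (a' + z * b') = 0"
        unfolding *(5,6)[symmetric] by simp
      then have "(a + a') + z * (b + b') = 0"
        by (simp add: algebra_simps)
      then have "z * (b + b') = - (a + a')"
        by (simp only: add_eq_0_iff)
      then have eq: "- z * (b + b') = a + a'"
        by simp
      show "u = 0"
      proof (cases "b + b' = 0")
        case True
        then have "b = 0"
          using proper[OF *(2)] *(4) by (simp add: add_eq_0_iff)
        moreover have "a = 0"
          using proper[OF *(1)] *(3) eq True by (simp add: add_eq_0_iff)
        ultimately show ?thesis
          using * by simp
      next
        case False
        then have "- z = (a + a') * inverse (b + b')"
          using eq by (metis (no_types) divide_inverse nonzero_eq_divide_eq)
        then show ?thesis
          using nz * by (simp add: add mult inverse)
      qed
    qed
    moreover have "C \<subseteq> D"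
      using D[OF _ zero] by fastforce
    ultimately have "D = C"
      by (rule max)
    then show False
      using D[OF zero one] nz by simp
  qed
qed

lemma diff_mem_E: "x \<in> C \<Longrightarrow> y \<in> C \<Longrightarrow> x - y \<in> E"
  using diff_cases[of x y] by (auto simp: E_def)

lemma C_subset_E: "C \<subseteq> E"
  by (auto simp: E_def)

sublocale E: subring_set E
proof
  show "1 \<in> E"
    by (simp add: E_def one)
  show "- x \<in> E" if "x \<in> E" for x
    using that by (auto simp: E_def)
  show "x + y \<in> E" if xy: "x \<in> E" "y \<in> E" for x y
  proof -
    consider "x \<in> C" "y \<in> C" | "x \<in> C" "- y \<in> C" | "- x \<in> C" "y \<in> C" | "- x \<in> C" "- y \<in> C"
      using xy by (auto simp: E_def)
    then show ?thesis
    proof cases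
      case 1
      then show ?thesis
        using add by (auto simp: E_def)
    next
      case 2
      then show ?thesis
        using diff_mem_E[of x "- y"] by simp
    next
      case 3
      then show ?thesis
        using diff_mem_E[of y "- x"] by (simp add: add.commute)
    next
      case 4
      then show ?thesis
        using add[of "- x" "- y"] by (simp add: E_def)
    qed
  qed
  show "x * y \<in> E" if "x \<in> E" "y \<in> E" for x y
    using that mult[of x y] mult[of "- x" y] mult[of x "- y"] mult[of "- x" "- y"]
    by (auto simp: E_def)
qed

lemma E_inverse: "x \<in> E \<Longrightarrow> inverse x \<in> E"
  using inverse[of x] inverse[of "- x"] by (auto simp: E_def)

lemma E_square: "x \<in> E \<Longrightarrow> x * x \<in> C"
  using mult[of x x] mult[of "- x" "- x"] by (auto simp: E_def)

lemma of_nat_nz: "of_nat (Suc n) \<noteq> (0 :: 'a)"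
proof
  assume "of_nat (Suc n) = (0 :: 'a)"
  then have "- 1 = (of_nat n :: 'a)"
    by (simp add: add_eq_0_iff)
  moreover have "of_nat n \<in> C"
    by (induction n) (auto simp: zero one add)
  ultimately show False
    using proper[OF one] by simp
qed

text \<open>Members of \<open>C\<close> add up to 0 only if both are 0, so leading terms do not
  cancel.\<close>

lemma lead_coeff_add_mem:
  assumes "lead_coeff s \<in> C" "lead_coeff t \<in> C"
  shows "lead_coeff (s + t) \<in> C"
proof (cases "degree s" "degree t" rule: linorder_cases)
  case less
  then show ?thesis
    using assms by (simp add: degree_add_eq_right coeff_eq_0)
next
  case greater
  then show ?thesis
    using assms by (simp add: degree_add_eq_left coeff_eq_0)
next
  case equal
  show ?thesis
  proof (cases "lead_coeff s + lead_coeff t = 0")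
    case True
    then have "lead_coeff s = 0"
      using proper[OF assms(1)] assms(2) by (simp add: add_eq_0_iff)
    then show ?thesis
      using assms(2) by simp
  next
    case False
    then have "degree (s + t) = degree s"
      using equal degree_add_le[of s "degree s" t] le_degree[of "s + t" "degree s"] by simp
    then show ?thesis
      using assms equal add by simp
  qed
qed

text \<open>A necessary condition on sums of weighted squares of polynomials of degree less than \<open>d\<close>.\<close>

definition pos_poly :: "nat \<Rightarrow> 'a poly \<Rightarrow> bool" where
  "pos_poly d s \<longleftrightarrow> s \<in> E.polys \<and> degree s \<le> 2 * (d - 1) \<and> coeff s 0 \<in> C \<and> lead_coeff s \<in> C \<and>
    (\<forall>x\<in>E. poly s x \<in> C)"

lemma poly_mem_E: "p \<in> E.polys \<Longrightarrow> x \<in> E \<Longrightarrow> poly p x \<in> E"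
  unfolding poly_altdef by (intro E.sum E.mult E.coeff_mem E.power)

lemma pos_poly_add: "pos_poly d s \<Longrightarrow> pos_poly d t \<Longrightarrow> pos_poly d (s + t)"
  using lead_coeff_add_mem[of s t] by (auto simp: pos_poly_def add E.polys_add intro: degree_add_le)

lemma pos_poly_square:
  assumes "c \<in> C" "u \<in> E.polys" "degree u < d"
  shows "pos_poly d (smult c (u * u))"
  unfolding pos_poly_def
proof (intro conjI ballI)
  show "smult c (u * u) \<in> E.polys"
    using assms C_subset_E by (auto intro: E.polys_smult E.polys_mult)
  have "degree (smult c (u * u)) \<le> degree u + degree u"
    using degree_smult_le degree_mult_le le_trans by blast
  then show "degree (smult c (u * u)) \<le> 2 * (d - 1)"
    using assms(3) by linarith
  show "coeff (smult c (u * u)) 0 \<in> C"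
    using assms by (simp add: coeff_mult mult E_square E.coeff_mem)
  show "lead_coeff (smult c (u * u)) \<in> C"
    using assms by (simp add: lead_coeff_mult lead_coeff_smult mult E_square E.coeff_mem zero)
  show "poly (smult c (u * u)) x \<in> C" if "x \<in> E" for x
    using assms poly_mem_E[OF assms(2) that] by (simp add: mult E_square)
qed

lemma neg_product_cases:
  assumes "- (s * t) \<in> C" "s * t \<noteq> 0" "s \<in> E" "t \<in> E"
  shows "(- s \<in> C \<and> s \<noteq> 0) \<or> (- t \<in> C \<and> t \<noteq> 0)"
proof (rule ccontr)
  assume "\<not> ?thesis"
  then have "s \<in> C" "t \<in> C"
    using assms by (auto simp: E_def)
  then show False
    using mult proper assms by blast
qed

lemma E_division:
  assumes "f \<in> E.polys" "degree f > 0" "p \<in> E.polys"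
  obtains q r where "q \<in> E.polys" "r \<in> E.polys" "p = q * f + r" "degree r < degree f"
proof -
  obtain k q r where *: "q \<in> E.polys" "r \<in> E.polys" "smult (lead_coeff f ^ k) p = q * f + r" "degree r < degree f"
    using E.pseudo_division[OF assms(2,1,3)] by blast
  define c where "c = inverse (lead_coeff f ^ k)"
  have c: "c \<in> E"
    using assms by (simp add: c_def E_inverse E.power E.coeff_mem)
  have "lead_coeff f ^ k \<noteq> 0"
    using assms by auto
  then have "p = smult c (smult (lead_coeff f ^ k) p)"
    by (simp add: c_def)
  also have "\<dots> = smult c q * f + smult c r"
    by (simp add: *(3) smult_add_right)
  finally show ?thesis
    using that[of "smult c q" "smult c r"] * c
    by (metis E.polys_smult degree_smult_le le_less_trans)
qed

end

section \<open>Roots from a change of sign\<close>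

lemma coeff_mult_at_0: "coeff (p * q) 0 = coeff p 0 * coeff q 0"
  by (simp add: coeff_mult)

locale maximal_real_cone_closed = maximal_real_cone C for C :: "'a::alg_closed_field set"
begin

text \<open>In a counterexample \<open>p\<close> of minimal degree, let \<open>\<alpha>\<close> be a root in the algebraically closed field. If the cone cannot
  be enlarged to \<open>E[\<alpha>]\<close>, then \<open>1 + s = q p\<close> for a sum \<open>s\<close> of weighted squares of polynomials of smaller degree than \<open>p\<close>.
  Then \<open>q\<close> has smaller degree than \<open>p\<close>, too, and inherits the sign change, so that it has a root in \<open>E\<close>, where
  \<open>1 + s\<close> is positive.\<close>

lemma sign_change_root:
  assumes "p \<in> E.polys" "- (coeff p 0 * lead_coeff p) \<in> C" "coeff p 0 * lead_coeff p \<noteq> 0"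
  shows "\<exists>x\<in>E. poly p x = 0"
  using assms
proof (induction "degree p" arbitrary: p rule: less_induct)
  case less
  define d where "d = degree p"
  have d: "d > 0"
  proof (rule ccontr)
    assume "\<not> ?thesis"
    then have "coeff p 0 * lead_coeff p \<in> C"
      using less.prems(1) by (simp add: d_def E_square E.coeff_mem)
    then show False
      using proper less.prems by blast
  qed
  show ?case
  proof (rule ccontr)
    assume no_root: "\<not> ?case"
    obtain \<alpha> where \<alpha>: "poly p \<alpha> = 0"
      using alg_closed_imp_poly_has_root d by (auto simp: d_def)
    \<comment> \<open>In a proper factorization one factor inherits the sign change. By minimality
      it has a root in \<open>E\<close>, which would be a root of \<open>p\<close>.\<close>
    have no_factor: False if "p = u * v" "u \<in> E.polys" "v \<in> E.polys" "degree u < d" "degree v < d" for u v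
    proof -
      have "coeff p 0 * lead_coeff p = (coeff u 0 * lead_coeff u) * (coeff v 0 * lead_coeff v)"
        by (simp only: that(1) coeff_mult_at_0 lead_coeff_mult mult_ac)
      then have "(- (coeff u 0 * lead_coeff u) \<in> C \<and> coeff u 0 * lead_coeff u \<noteq> 0) \<or>
          (- (coeff v 0 * lead_coeff v) \<in> C \<and> coeff v 0 * lead_coeff v \<noteq> 0)"
        using less.prems that by (intro neg_product_cases) (auto intro: E.mult E.coeff_mem)
      then have "(\<exists>x\<in>E. poly u x = 0) \<or> (\<exists>x\<in>E. poly v x = 0)"
        using less.hyps that by (metis d_def)
      then show False
        using no_root that(1) by auto
    qed
    \<comment> \<open>By descent through remainders, a polynomial of degree below \<open>d\<close>
      annihilating \<alpha> would lead to a proper divisor of \<open>p\<close>.\<close>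
    have irred: "poly u \<alpha> \<noteq> 0" if "u \<in> E.polys" "u \<noteq> 0" "degree u < d" for u
      using that
    proof (induction "degree u" arbitrary: u rule: less_induct)
      case (less u)
      show ?case
      proof
        assume u0: "poly u \<alpha> = 0"
        have du: "degree u > 0"
        proof (rule ccontr)
          assume "\<not> ?thesis"
          then obtain c where "u = [:c:]"
            using degree_eq_zeroE by blast
          then show False
            using u0 less.prems by simp
        qed
        obtain q r where qr: "q \<in> E.polys" "r \<in> E.polys" "p = q * u + r" "degree r < degree u"
          using E_division[OF less.prems(1) du \<open>p \<in> E.polys\<close>] by blast
        have "poly r \<alpha> = 0"
          using arg_cong[OF qr(3), of "\<lambda>p. poly p \<alpha>"] \<alpha> u0 by simp
        then have "r = 0"
          using less.hyps[OF qr(4) qr(2)] qr(4) less.prems(3) by fastforce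
        then have p: "p = q * u"
          using qr by simp
        have "q \<noteq> 0" "u \<noteq> 0"
          using p d by (auto simp: d_def)
        then have "degree q < d"
          using p du by (simp add: d_def degree_mult_eq)
        then show False
          using no_factor[OF p qr(1)] less.prems by blast
      qed
    qed
    \<comment> \<open>Euclid's algorithm for \<open>p\<close> and \<open>u\<close>, evaluated at
      \<alpha>; the remainder is nonzero by \<open>no_factor\<close>.\<close>
    have inv: "\<exists>v\<in>E.polys. poly u \<alpha> * poly v \<alpha> = 1" if "u \<in> E.polys" "u \<noteq> 0" "degree u < d" for u
      using that
    proof (induction "degree u" arbitrary: u rule: less_induct)
      case (less u)
      show ?case
      proof (cases "degree u = 0")
        case True
        then obtain c where c: "u = [:c:]"
          using degree_eq_zeroE by blast
        then have "c \<in> E" "c \<noteq> 0"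
          using less.prems E.coeff_mem[of u 0] by auto
        then show ?thesis
          using c by (intro bexI[of _ "[:inverse c:]"]) (auto intro: E.polys_pCons E.polys_0 E_inverse)
      next
        case False
        then obtain q r where qr: "q \<in> E.polys" "r \<in> E.polys" "p = q * u + r" "degree r < degree u"
          using E_division[OF less.prems(1) _ \<open>p \<in> E.polys\<close>] by blast
        have "r \<noteq> 0"
        proof
          assume "r = 0"
          then have p: "p = q * u"
            using qr by simp
          have "q \<noteq> 0" "u \<noteq> 0"
            using p d by (auto simp: d_def)
          then have "degree q < d"
            using p False by (simp add: d_def degree_mult_eq)
          then show False
            using no_factor[OF p qr(1)] less.prems by blast
        qed
        then obtain v where v: "v \<in> E.polys" "poly r \<alpha> * poly v \<alpha> = 1"
          using less.hyps[OF qr(4) qr(2)] qr(4) less.prems(3) by auto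
        have "poly r \<alpha> = - (poly q \<alpha> * poly u \<alpha>)"
          using arg_cong[OF qr(3), of "\<lambda>p. poly p \<alpha>"] \<alpha> by (simp add: eq_neg_iff_add_eq_0 add.commute)
        then have "poly u \<alpha> * poly (- (q * v)) \<alpha> = 1"
          using v(2) by (simp add: algebra_simps)
        moreover have "- (q * v) \<in> E.polys"
          using E.polys_diff[OF E.polys_0 E.polys_mult[OF qr(1) v(1)]] by simp
        ultimately show ?thesis
          by blast
      qed
    qed
    \<comment> \<open>This is \<open>E[\<alpha>]\<close>, a field by \<open>F_inverse\<close>; every
      element has a representative of degree below \<open>d\<close> by
      \<open>reduce\<close>.\<close>
    define F where "F = {poly u \<alpha> | u. u \<in> E.polys}"
    have F: "poly u \<alpha> \<in> F" if "u \<in> E.polys" for u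
      using that by (auto simp: F_def)
    have F_add: "x + y \<in> F" and F_mult: "x * y \<in> F" and F_diff: "x - y \<in> F" if xy: "x \<in> F" "y \<in> F" for x y
    proof -
      obtain u v where uv: "u \<in> E.polys" "v \<in> E.polys" "x = poly u \<alpha>" "y = poly v \<alpha>"
        using xy by (auto simp: F_def)
      show "x + y \<in> F" "x * y \<in> F" "x - y \<in> F"
        using F[OF E.polys_add[OF uv(1,2)]] F[OF E.polys_mult[OF uv(1,2)]]
          F[OF E.polys_diff[OF uv(1,2)]] uv(3,4) by simp_all
    qed
    have F_const: "x \<in> F" if "x \<in> E" for x
      using F[of "[:x:]"] that by (auto intro: E.polys_pCons E.polys_0)
    have \<alpha>F: "\<alpha> \<in> F"
      using F[of "[:0, 1:]"] by (auto intro: E.polys_pCons E.polys_0 E.zero E.one)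
    have reduce: "\<exists>u\<in>E.polys. degree u < d \<and> x = poly u \<alpha>" if x: "x \<in> F" for x
    proof -
      obtain u where u: "u \<in> E.polys" "x = poly u \<alpha>"
        using x by (auto simp: F_def)
      obtain q r where qr: "q \<in> E.polys" "r \<in> E.polys" "u = q * p + r" "degree r < degree p"
        using E_division[OF \<open>p \<in> E.polys\<close> _ u(1)] d by (auto simp: d_def)
      then show ?thesis
        using u(2) \<alpha> by (intro bexI[of _ r]) (auto simp: d_def)
    qed
    have F_inverse: "\<exists>y\<in>F. x * y = 1" if x: "x \<in> F" "x \<noteq> 0" for x
    proof -
      obtain u where "u \<in> E.polys" "degree u < d" "x = poly u \<alpha>"
        using reduce[OF x(1)] by blast
      moreover from this x have "u \<noteq> 0"
        by auto
      ultimately show ?thesis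
        using inv F by blast
    qed
    define T where "T = weighted_squares C F"
    note C0 = zero
    have one_F: "1 \<in> F"
      using F_const E.one by blast
    have T_F: "t \<in> F" if "t \<in> T" for t
      using that unfolding T_def
    proof induction
      case zero
      then show ?case
        using F_const E.zero by blast
    next
      case (step t c w)
      then show ?case
        using F_add[OF _ F_mult[OF F_const F_mult]] C_subset_E by blast
    qed
    have T_step: "c * (w * w) \<in> T" if "c \<in> C" "w \<in> F" for c w
      using weighted_squares.step[OF weighted_squares.zero that] by (simp add: T_def)
    have rep: "\<exists>s. pos_poly d s \<and> t = poly s \<alpha>" if "t \<in> T" for t
      using that unfolding T_def
    proof induction
      case zero
      have "pos_poly d 0"
        by (simp add: pos_poly_def E.polys_0 C0)
      then show ?case
        by (intro exI[of _ 0]) simp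
    next
      case (step t c w)
      then obtain s where s: "pos_poly d s" "t = poly s \<alpha>"
        by blast
      obtain u where u: "u \<in> E.polys" "degree u < d" "w = poly u \<alpha>"
        using reduce[OF step(3)] by blast
      show ?case
        using pos_poly_add[OF s(1) pos_poly_square[OF step(2) u(1,2)]] s(2) u(3)
        by (intro exI[of _ "s + smult c (u * u)"]) simp
    qed
    have "- 1 \<notin> T"
    proof
      assume "- 1 \<in> T"
      then obtain s where s: "pos_poly d s" "- 1 = poly s \<alpha>"
        using rep by blast
      have "pos_poly d [:1:]"
        by (simp add: pos_poly_def E.polys_pCons E.polys_0 E.one one)
      then have s1: "pos_poly d (1 + s)"
        using pos_poly_add[OF _ s(1)] by (simp add: one_pCons)
      have val: "poly (1 + s) x \<noteq> 0" if "poly s x \<in> C" for x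
        using proper[OF one] that by (auto simp: add_eq_0_iff)
      have c0: "coeff (1 + s) 0 \<noteq> 0"
        using proper[OF one] s(1) by (auto simp: pos_poly_def add_eq_0_iff)
      then have "1 + s \<noteq> 0"
        by (metis coeff_0)
      obtain q r where qr: "q \<in> E.polys" "r \<in> E.polys" "1 + s = q * p + r" "degree r < degree p"
        using E_division[OF \<open>p \<in> E.polys\<close>, of "1 + s"] d s1 by (auto simp: d_def pos_poly_def)
      have "poly r \<alpha> = 0"
        using arg_cong[OF qr(3), of "\<lambda>p. poly p \<alpha>"] \<alpha> s(2)[symmetric] by simp
      then have "r = 0"
        using irred[OF qr(2)] qr(4) d_def by blast
      then have eq: "1 + s = q * p"
        using qr by simp
      have "q \<noteq> 0" "p \<noteq> 0"
        using eq \<open>1 + s \<noteq> 0\<close> by auto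
      \<comment> \<open>\<open>1 + s\<close> has degree at most \<open>2 * (d - 1)\<close>, since
        \<open>s\<close> comes from squares of representatives of degree below
        \<open>d\<close>.\<close>
      then have "degree q + d \<le> 2 * (d - 1)"
        using s1 degree_mult_eq[of q p] by (simp add: eq pos_poly_def d_def)
      then have dq: "degree q < d"
        using d by linarith
      have prod: "coeff (1 + s) 0 * lead_coeff (1 + s) = (coeff q 0 * lead_coeff q) * (coeff p 0 * lead_coeff p)"
        by (simp only: eq coeff_mult_at_0 lead_coeff_mult mult_ac)
      have pos: "coeff (1 + s) 0 * lead_coeff (1 + s) \<in> C"
        using s1 mult unfolding pos_poly_def by blast
      have nz: "coeff (1 + s) 0 * lead_coeff (1 + s) \<noteq> 0"
        using c0 \<open>1 + s \<noteq> 0\<close> by (metis leading_coeff_0_iff mult_eq_0_iff)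
      have qnz: "coeff q 0 * lead_coeff q \<noteq> 0"
        using nz prod by (metis mult_zero_left)
      have "- (coeff q 0 * lead_coeff q) \<in> C"
      proof (rule ccontr)
        assume "- (coeff q 0 * lead_coeff q) \<notin> C"
        then have "coeff q 0 * lead_coeff q \<in> C"
          using qr(1) E.mult[OF E.coeff_mem E.coeff_mem, of q q] by (auto simp: E_def)
        then have "(coeff q 0 * lead_coeff q) * (- (coeff p 0 * lead_coeff p)) \<in> C"
          using less.prems(2) by (rule mult)
        then have "- (coeff (1 + s) 0 * lead_coeff (1 + s)) \<in> C"
          unfolding prod by simp
        then show False
          using proper[OF pos] nz by blast
      qed
      then obtain x where x: "x \<in> E" "poly q x = 0"
        using less.hyps[of q] dq qr(1) qnz by (auto simp: d_def)
      then have "poly (1 + s) x = 0"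
        unfolding eq by simp
      moreover have "poly s x \<in> C"
        using s(1) x(1) by (simp add: pos_poly_def)
      ultimately show False
        using val by blast
    qed
    have T_mult: "x * y \<in> T" if "x \<in> T" "y \<in> T" for x y
      using weighted_squares_mult[of x C F y] that mult F_mult by (simp add: T_def)
    have T_square: "w * w \<in> T" if "w \<in> F" for w
      using T_step[OF one that] by simp
    have "real_cone T"
    proof (rule real_coneI)
      show "1 \<in> T"
        using T_square[OF one_F] by simp
      fix x y
      assume "x \<in> T" "y \<in> T"
      then show "x + y \<in> T" "x * y \<in> T"
        using weighted_squares_add T_mult by (auto simp: T_def)
      show "(x - y) * (x - y) \<in> T"
        using \<open>x \<in> T\<close> \<open>y \<in> T\<close> by (intro T_square F_diff T_F)
    next
      fix x
      assume x: "x \<in> T" "- x \<in> T"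
      show "x = 0"
      proof (rule ccontr)
        assume "x \<noteq> 0"
        then obtain y where y: "y \<in> F" "x * y = 1"
          using F_inverse T_F x by blast
        \<comment> \<open>With \<open>y\<close> the inverse of \<open>x\<close> in \<open>F\<close>,
          this product is - 1.\<close>
        have "(x * (- x)) * (y * y) \<in> T"
          using x y T_mult T_square by blast
        also have "(x * (- x)) * (y * y) = - ((x * y) * (x * y))"
          by (simp add: algebra_simps)
        finally show False
          using y(2) \<open>- 1 \<notin> T\<close> by simp
      qed
    qed
    moreover have "C \<subseteq> T"
      using T_step[OF _ one_F] by fastforce
    ultimately have "T = C"
      by (rule max)
    \<comment> \<open>The difference of these two squares is \<open>4 * \<alpha>\<close>, so
      \<alpha> lies in \<open>E\<close> and is a root of \<open>p\<close> there.\<close>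
    then have "(\<alpha> + 1) * (\<alpha> + 1) - (\<alpha> - 1) * (\<alpha> - 1) \<in> E"
      using T_square[OF F_add[OF \<alpha>F one_F]] T_square[OF F_diff[OF \<alpha>F one_F]] diff_mem_E by blast
    then have "of_nat 4 * \<alpha> \<in> E"
      by (simp add: algebra_simps)
    then have "inverse (of_nat 4) * (of_nat 4 * \<alpha>) \<in> E"
      by (rule E.mult[OF E_inverse[OF E.of_nat]])
    moreover have "of_nat 4 \<noteq> (0 :: 'a)"
      using of_nat_nz[of 3] by (simp del: of_nat_Suc)
    then have "inverse (of_nat 4) * (of_nat 4 * \<alpha>) = \<alpha>"
      by (metis left_inverse mult.assoc mult_1)
    ultimately have "\<alpha> \<in> E"
      by metis
    then show False
      using no_root \<alpha> by blast
  qed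
qed

end

section \<open>The Positivstellensatz\<close>

text \<open>The counterexample that \<open>not_pointless\<close> excludes. As a predicate on cones
  it can direct the choice of \<open>chosen_cone\<close>.\<close>

definition pointless :: "('v::finite) mpoly set \<Rightarrow> bool" where
  "pointless P \<longleftrightarrow> (\<exists>G\<subseteq>P. finite G \<and> (\<forall>x. \<exists>p\<in>G. peval p x < 0))"

text \<open>A type cannot depend on a maximal cone fixed in a proof. The following real closed field therefore
  extends the residue ring of one global choice of a cone, a counterexample if there is any.\<close>

definition chosen_cone :: "('v::finite) mpoly set" where
  "chosen_cone = (SOME P. max_cone P \<and>
    ((\<exists>P' :: 'v mpoly set. max_cone P' \<and> pointless P') \<longrightarrow> pointless P))"

lemma ex_max_cone_mpoly: "\<exists>P :: ('v::finite) mpoly set. max_cone P"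
proof -
  have "ring_preordering {p :: 'v mpoly. \<forall>x. peval p x \<ge> 0}"
    by (auto simp: ring_preordering_def)
  moreover have "- 1 \<notin> {p :: 'v mpoly. \<forall>x. peval p x \<ge> 0}"
    by simp
  ultimately show ?thesis
    using ex_max_cone by metis
qed

lemma chosen_cone: "max_cone (chosen_cone :: ('v::finite) mpoly set)"
  "(\<exists>P' :: 'v mpoly set. max_cone P' \<and> pointless P') \<Longrightarrow> pointless (chosen_cone :: 'v mpoly set)"
proof -
  have "\<exists>P :: 'v mpoly set. max_cone P \<and>
    ((\<exists>P' :: 'v mpoly set. max_cone P' \<and> pointless P') \<longrightarrow> pointless P)"
    using ex_max_cone_mpoly by blast
  from someI_ex[OF this] show "max_cone (chosen_cone :: 'v mpoly set)"
    "(\<exists>P' :: 'v mpoly set. max_cone P' \<and> pointless P') \<Longrightarrow> pointless (chosen_cone :: 'v mpoly set)"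
    unfolding chosen_cone_def by blast+
qed

section \<open>The residue domain of the chosen cone and its real closure\<close>

interpretation chosen: maximal_preordering chosen_cone
  by unfold_locales (rule chosen_cone)

lemma chosen_supp_0: "0 \<in> chosen.supp"
  by (simp add: chosen.supp_def chosen.zero)

lemma chosen_supp_uminus: "x \<in> chosen.supp \<Longrightarrow> - x \<in> chosen.supp"
  by (simp add: chosen.supp_def)

lemma chosen_supp_uminus_1: "- 1 \<notin> chosen.supp"
  by (simp add: chosen.supp_def chosen.proper)

quotient_type (overloaded) 'v residue_ring =
  "(('v::finite) \<Rightarrow>\<^sub>0 nat) \<Rightarrow>\<^sub>0 real" / "\<lambda>p q. p - q \<in> chosen.supp"
proof (rule equivpI)
  show "reflp (\<lambda>p q :: 'v mpoly. p - q \<in> chosen.supp)"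
    by (auto intro!: reflpI simp: chosen_supp_0)
  show "symp (\<lambda>p q :: 'v mpoly. p - q \<in> chosen.supp)"
    using chosen_supp_uminus by (fastforce intro!: sympI)
  show "transp (\<lambda>p q :: 'v mpoly. p - q \<in> chosen.supp)"
    using chosen.supp_add by (fastforce intro!: transpI)
qed

instantiation residue_ring :: (finite) comm_ring_1
begin

lift_definition zero_residue_ring :: "'a residue_ring" is 0 .

lift_definition one_residue_ring :: "'a residue_ring" is 1 .

lift_definition plus_residue_ring :: "'a residue_ring \<Rightarrow> 'a residue_ring \<Rightarrow> 'a residue_ring" is "(+)"
  using chosen.supp_add by (fastforce simp: algebra_simps)

lift_definition minus_residue_ring :: "'a residue_ring \<Rightarrow> 'a residue_ring \<Rightarrow> 'a residue_ring" is "(-)"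
proof -
  fix p q r s :: "'a mpoly"
  assume "p - q \<in> chosen.supp" "r - s \<in> chosen.supp"
  then have "(p - q) + - (r - s) \<in> chosen.supp"
    by (intro chosen.supp_add chosen_supp_uminus)
  then show "p - r - (q - s) \<in> chosen.supp"
    by (simp add: algebra_simps)
qed

lift_definition uminus_residue_ring :: "'a residue_ring \<Rightarrow> 'a residue_ring" is uminus
  using chosen_supp_uminus by fastforce

lift_definition times_residue_ring :: "'a residue_ring \<Rightarrow> 'a residue_ring \<Rightarrow> 'a residue_ring" is "(*)"
proof -
  fix p q r s :: "'a mpoly"
  assume "p - q \<in> chosen.supp" "r - s \<in> chosen.supp"
  then have "r * (p - q) + q * (r - s) \<in> chosen.supp"
    by (intro chosen.supp_add chosen.supp_mult)
  then show "p * r - q * s \<in> chosen.supp"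
    by (simp add: algebra_simps)
qed

instance
  by standard (transfer; simp add: chosen_supp_0 chosen_supp_uminus_1 algebra_simps)+

end

instance residue_ring :: (finite) idom
proof
  fix a b :: "'a residue_ring"
  have "a * b = 0 \<Longrightarrow> a = 0 \<or> b = 0"
    by transfer (auto dest: chosen.supp_prime)
  then show "a \<noteq> 0 \<Longrightarrow> b \<noteq> 0 \<Longrightarrow> a * b \<noteq> 0"
    by blast
qed

definition residue :: "('v::finite) mpoly \<Rightarrow> 'v residue_ring" where
  "residue = abs_residue_ring"

lemma rhom_residue: "rhom residue"
  by unfold_locales (simp_all add: residue_def one_residue_ring_def plus_residue_ring.abs_eq
      times_residue_ring.abs_eq)

lemma residue_eq_0_iff: "residue p = 0 \<longleftrightarrow> p \<in> chosen.supp"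
  by (simp add: residue_def zero_residue_ring_def residue_ring.abs_eq_iff)

definition residue_ac :: "('v::finite) mpoly \<Rightarrow> 'v residue_ring fract alg_closure" where
  "residue_ac p = to_ac (Fract (residue p) 1)"

interpretation residue: rhom residue
  by (rule rhom_residue)

interpretation residue_ac: rhom residue_ac
  by unfold_locales (simp_all add: residue_ac_def add.commute flip: One_fract_def to_ac_add to_ac_mult)

lemma residue_ac_eq_0_iff: "residue_ac p = 0 \<longleftrightarrow> p \<in> chosen.supp"
  by (simp add: residue_ac_def residue_eq_0_iff[symmetric] Zero_fract_def eq_fract)

text \<open>Differences of images are images, so the required squares come from squares in the
  polynomial ring. Properness holds because the kernel of \<open>residue_ac\<close> is exactly the
  support.\<close>

lemma real_cone_residue: "real_cone (residue_ac ` (chosen_cone :: ('v::finite) mpoly set))" (is "real_cone ?C")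
proof (rule real_coneI)
  show "1 \<in> ?C"
    using imageI[OF chosen.one, of residue_ac] by simp
next
  fix x y
  assume "x \<in> ?C" "y \<in> ?C"
  then obtain p q where *: "p \<in> chosen_cone" "q \<in> chosen_cone" "x = residue_ac p" "y = residue_ac q"
    by blast
  then show "x + y \<in> ?C" "x * y \<in> ?C"
    using imageI[OF chosen.add, of p q residue_ac] imageI[OF chosen.mult, of p q residue_ac] by simp_all
  have "(x - y) * (x - y) = residue_ac ((p - q) * (p - q))"
    by (simp only: * residue_ac.mult residue_ac.diff)
  then show "(x - y) * (x - y) \<in> ?C"
    using chosen.square by blast
next
  fix x
  assume "x \<in> ?C" "- x \<in> ?C"
  then obtain p q where *: "p \<in> chosen_cone" "q \<in> chosen_cone" "x = residue_ac p" "- x = residue_ac q"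
    by blast
  then have "residue_ac (p + q) = 0"
    by (simp add: *(3)[symmetric] *(4)[symmetric])
  then have "- (p + q) \<in> chosen_cone"
    unfolding residue_ac_eq_0_iff chosen.supp_def by blast
  then have "- (p + q) + q \<in> chosen_cone"
    using *(2) by (rule chosen.add)
  then have "p \<in> chosen.supp"
    using *(1) by (simp add: chosen.supp_def)
  then show "x = 0"
    using *(3) by (simp add: residue_ac_eq_0_iff)
qed

definition closure_cone :: "('v::finite) residue_ring fract alg_closure set" where
  "closure_cone = (SOME C. max_real_cone C \<and> residue_ac ` chosen_cone \<subseteq> C)"

lemma closure_cone: "max_real_cone (closure_cone :: ('v::finite) residue_ring fract alg_closure set)"
  "residue_ac ` chosen_cone \<subseteq> (closure_cone :: 'v residue_ring fract alg_closure set)"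
proof -
  have "\<exists>C :: 'v residue_ring fract alg_closure set. max_real_cone C \<and> residue_ac ` chosen_cone \<subseteq> C"
    using ex_max_real_cone[OF real_cone_residue] by metis
  from someI_ex[OF this] show "max_real_cone (closure_cone :: 'v residue_ring fract alg_closure set)"
    "residue_ac ` chosen_cone \<subseteq> (closure_cone :: 'v residue_ring fract alg_closure set)"
    unfolding closure_cone_def by blast+
qed

interpretation closure: maximal_real_cone_closed closure_cone
  by unfold_locales (rule closure_cone)

lemma closure_antisym: "y - x \<in> closure_cone \<Longrightarrow> x - y \<in> closure_cone \<Longrightarrow> x = y"
  using closure.proper[of "y - x"] by simp

lemma closure_trans: "y - x \<in> closure_cone \<Longrightarrow> z - y \<in> closure_cone \<Longrightarrow> z - x \<in> closure_cone"
  using closure.add[of "y - x" "z - y"] by simp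

lemma closure_mult_left: "y - x \<in> closure_cone \<Longrightarrow> z - 0 \<in> closure_cone \<Longrightarrow> z * y - z * x \<in> closure_cone"
  using closure.mult[of z "y - x"] by (simp add: algebra_simps)

lemma closure_linear: "x \<in> closure.E \<Longrightarrow> y \<in> closure.E \<Longrightarrow> y - x \<in> closure_cone \<or> x - y \<in> closure_cone"
  using closure.E.diff[of y x] by (simp add: closure.E_def)

typedef (overloaded) 'v real_closure = "closure.E :: ('v::finite) residue_ring fract alg_closure set"
  using closure.E.one by blast

setup_lifting type_definition_real_closure

instantiation real_closure :: (finite) linordered_field
begin

lift_definition zero_real_closure :: "'a real_closure" is 0
  by (rule closure.E.zero)

lift_definition one_real_closure :: "'a real_closure" is 1
  by (rule closure.E.one)

lift_definition plus_real_closure :: "'a real_closure \<Rightarrow> 'a real_closure \<Rightarrow> 'a real_closure" is "(+)"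
  by (rule closure.E.add)

lift_definition minus_real_closure :: "'a real_closure \<Rightarrow> 'a real_closure \<Rightarrow> 'a real_closure" is "(-)"
  by (rule closure.E.diff)

lift_definition uminus_real_closure :: "'a real_closure \<Rightarrow> 'a real_closure" is uminus
  by (rule closure.E.uminus)

lift_definition times_real_closure :: "'a real_closure \<Rightarrow> 'a real_closure \<Rightarrow> 'a real_closure" is "(*)"
  by (rule closure.E.mult)

lift_definition inverse_real_closure :: "'a real_closure \<Rightarrow> 'a real_closure" is inverse
  by (rule closure.E_inverse)

definition divide_real_closure :: "'a real_closure \<Rightarrow> 'a real_closure \<Rightarrow> 'a real_closure" where
  "divide_real_closure x y = x * inverse y"

lift_definition less_eq_real_closure :: "'a real_closure \<Rightarrow> 'a real_closure \<Rightarrow> bool" is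
  "\<lambda>x y. y - x \<in> closure_cone" .

definition less_real_closure :: "'a real_closure \<Rightarrow> 'a real_closure \<Rightarrow> bool" where
  "less_real_closure x y \<longleftrightarrow> x \<le> y \<and> x \<noteq> y"

definition abs_real_closure :: "'a real_closure \<Rightarrow> 'a real_closure" where
  "abs_real_closure x = (if x < 0 then - x else x)"

definition sgn_real_closure :: "'a real_closure \<Rightarrow> 'a real_closure" where
  "sgn_real_closure x = (if x = 0 then 0 else if 0 < x then 1 else - 1)"

instance
proof
  fix x y z :: "'a real_closure"
  show "x + y + z = x + (y + z)" "x + y = y + x" "0 + x = x" "- x + x = 0" "x - y = x + - y"
    "x * y * z = x * (y * z)" "x * y = y * x" "1 * x = x" "(x + y) * z = x * z + y * z" "(0 :: 'a real_closure) \<noteq> 1"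
    by (transfer; simp add: algebra_simps)+
  show "x + y - x = y" "x - y - z = x - (y + z)" "0 * x = 0" "x * 0 = 0"
    by (transfer; simp add: algebra_simps)+
  show "inverse x * x = 1" if "x \<noteq> 0"
    using that by transfer simp
  show "x div y = x * inverse y"
    by (simp add: divide_real_closure_def)
  show "inverse (0 :: 'a real_closure) = 0"
    by transfer simp
  show refl: "x \<le> x"
    by transfer (simp add: closure.zero)
  show antisym: "x = y" if "x \<le> y" "y \<le> x" for x y :: "'a real_closure"
    using that by transfer (rule closure_antisym)
  show "x \<le> z" if "x \<le> y" "y \<le> z"
    using that by transfer (rule closure_trans)
  show "x < y \<longleftrightarrow> x \<le> y \<and> \<not> y \<le> x"
    using antisym refl by (auto simp: less_real_closure_def)
  show "x \<le> y \<or> y \<le> x"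
    by transfer (rule closure_linear)
  show "z + x \<le> z + y" if "x \<le> y"
    using that by transfer simp
  show "z * x < z * y" if "x < y" "0 < z"
  proof -
    have "z * x \<le> z * y"
      using that unfolding less_real_closure_def
      by (transfer, intro closure_mult_left) auto
    moreover have "z * x \<noteq> z * y"
      using that unfolding less_real_closure_def by transfer simp
    ultimately show ?thesis
      by (simp add: less_real_closure_def)
  qed
  show "\<bar>x\<bar> = (if x < 0 then - x else x)"
    by (simp add: abs_real_closure_def)
  show "sgn x = (if x = 0 then 0 else if 0 < x then 1 else - 1)"
    by (simp add: sgn_real_closure_def)
qed

end

interpretation Rep_real_closure: rhom Rep_real_closure
  by unfold_locales
    (simp_all add: one_real_closure.rep_eq plus_real_closure.rep_eq times_real_closure.rep_eq)

lemma real_closure_sign_change_root: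
  fixes q :: "('v::finite) real_closure poly"
  assumes "coeff q 0 * lead_coeff q < 0"
  shows "\<exists>x. poly q x = 0"
proof -
  let ?q = "map_poly Rep_real_closure q"
  have inj: "Rep_real_closure x \<noteq> 0" if "x \<noteq> 0" for x :: "'v real_closure"
    using that by (metis Rep_real_closure_inject zero_real_closure.rep_eq)
  have deg: "degree ?q = degree q"
    by (rule degree_map_poly) (rule inj)
  have "?q \<in> closure.E.polys"
    by (simp add: closure.E.polys_def Rep_real_closure)
  moreover have eq: "coeff ?q 0 * lead_coeff ?q = Rep_real_closure (coeff q 0 * lead_coeff q)"
    by (simp add: deg times_real_closure.rep_eq)
  moreover have "- Rep_real_closure (coeff q 0 * lead_coeff q) \<in> closure_cone"
    using assms by (auto simp: less_real_closure_def less_eq_real_closure.rep_eq zero_real_closure.rep_eq)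
  moreover have "Rep_real_closure (coeff q 0 * lead_coeff q) \<noteq> 0"
    using assms by (intro inj) auto
  ultimately obtain x where "x \<in> closure.E" "poly ?q x = 0"
    using closure.sign_change_root[of ?q] by (metis eq)
  then obtain y where "poly ?q (Rep_real_closure y) = 0"
    by (metis Rep_real_closure_cases)
  then show ?thesis
    using inj by (metis Rep_real_closure.poly_map_poly)
qed

instance real_closure :: (finite) rcf
proof
  fix a b :: "'a real_closure" and f :: "nat \<Rightarrow> 'a real_closure" and n
  assume "a < b" "(\<Sum>k\<le>n. f k * a ^ k) < 0" "0 < (\<Sum>k\<le>n. f k * b ^ k)"
  then show "\<exists>x. a < x \<and> x < b \<and> (\<Sum>k\<le>n. f k * x ^ k) = 0"
    unfolding sum_eq_poly using ivt_of_sign_change_root[OF real_closure_sign_change_root] by blast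
qed

definition to_real_closure :: "('v::finite) mpoly \<Rightarrow> 'v real_closure" where
  "to_real_closure p = Abs_real_closure (residue_ac p)"

lemma residue_ac_mem: "residue_ac p \<in> closure.E"
  using chosen.total[of p] closure_cone(2) by (auto simp: closure.E_def simp flip: residue_ac.uminus)

lemma Rep_to_real_closure: "Rep_real_closure (to_real_closure p) = residue_ac p"
  by (simp add: to_real_closure_def Abs_real_closure_inverse residue_ac_mem)

lemma rhom_to_real_closure: "rhom to_real_closure"
  by unfold_locales (simp_all add: Rep_real_closure_inject[symmetric] Rep_to_real_closure)

lemma to_real_closure_nonneg: "p \<in> chosen_cone \<Longrightarrow> to_real_closure p \<ge> 0"
  using closure_cone(2)
  by (auto simp: less_eq_real_closure.rep_eq zero_real_closure.rep_eq Rep_to_real_closure)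

section \<open>Transfer of solutions to the reals\<close>

lemma subring_set_gen_ring: "subring_set (gen_ring U)"
proof
  show "1 \<in> gen_ring U"
    using gen_ring.Const[of 1] by simp
  show "- x \<in> gen_ring U" if "x \<in> gen_ring U" for x
    using gen_ring.mult[OF gen_ring.Const[of "- 1"] that] by simp
qed (auto intro: gen_ring.intros)

interpretation gen_subring: subring_set "gen_ring U" for U
  by (rule subring_set_gen_ring)

lemma gen_ring_insert:
  assumes "p \<in> gen_ring (insert v U)"
  shows "\<exists>P\<in>gen_subring.polys U. p = poly P (Var v)"
  using assms
proof induction
  case (Const c)
  then show ?case
    by (intro bexI[of _ "[:Const c:]"]) (auto intro!: gen_subring.polys_pCons gen_subring.polys_0 gen_ring.Const)
next
  case (Var w)
  then consider "w = v" | "w \<in> U"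
    by blast
  then show ?case
  proof cases
    case 1
    then show ?thesis
      by (intro bexI[of _ "[:0, 1:]"]) (auto intro!: gen_subring.polys_pCons gen_subring.polys_0 gen_subring.zero gen_subring.one)
  next
    case 2
    then show ?thesis
      by (intro bexI[of _ "[:Var w:]"]) (auto intro!: gen_subring.polys_pCons gen_subring.polys_0 gen_ring.Var)
  qed
next
  case (add p q)
  then obtain P Q where "P \<in> gen_subring.polys U" "Q \<in> gen_subring.polys U" "p = poly P (Var v)" "q = poly Q (Var v)"
    by blast
  then show ?case
    by (intro bexI[of _ "P + Q"]) (auto intro: gen_subring.polys_add)
next
  case (mult p q)
  then obtain P Q where "P \<in> gen_subring.polys U" "Q \<in> gen_subring.polys U" "p = poly P (Var v)" "q = poly Q (Var v)"
    by blast
  then show ?case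
    by (intro bexI[of _ "P * Q"]) (auto intro: gen_subring.polys_mult)
qed

lemma poly_subst_cong_gen_ring:
  assumes "rhom c" "p \<in> gen_ring U" "\<And>u. u \<in> U \<Longrightarrow> a u = b u"
  shows "poly_subst c a p = poly_subst c b p"
  using assms(2)
proof induction
  case (Var v)
  then show ?case
    using assms by simp
qed (simp_all add: assms(1) rhom.add[OF rhom_poly_subst[OF assms(1)]] rhom.mult[OF rhom_poly_subst[OF assms(1)]])

text \<open>Every positive real is an invertible square, so its image in an ordered field is a
  nonzero square. This starts the induction in \<open>artin_lang\<close>.\<close>

lemma same_sign_Const:
  fixes h :: "'v mpoly \<Rightarrow> 'a::rcf"
  assumes "rhom h"
  shows "same_sign (h (Const c)) c"
proof -
  interpret rhom h by fact
  have pos: "h (Const c) > 0" if "c > 0" for c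
  proof -
    have "h (Const (1 / sqrt c)) * h (Const (sqrt c)) = h (Const (1 / sqrt c) * Const (sqrt c))"
      by simp
    also have "\<dots> = h (Const 1)"
      by (rule arg_cong[OF Const_mult_eq]) (use that in simp)
    finally have "h (Const (sqrt c)) \<noteq> 0"
      by auto
    moreover have "h (Const (sqrt c)) * h (Const (sqrt c)) = h (Const (sqrt c) * Const (sqrt c))"
      by simp
    moreover have "\<dots> = h (Const c)"
      by (rule arg_cong[OF Const_mult_eq]) (use that in simp)
    ultimately show ?thesis
      by (metis not_square_less_zero not_less_iff_gr_or_eq mult_eq_0_iff)
  qed
  consider "c > 0" | "c = 0" | "- c > 0"
    by linarith
  then show ?thesis
  proof cases
    case 3
    then show ?thesis
      using pos[of "- c"] by (simp add: same_sign_neg)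
  qed (auto intro: same_sign_pos same_sign_zero pos)
qed

text \<open>\<open>h\<close> amounts to a point over \<open>'a\<close> with coordinates
  \<open>h (Var v)\<close>, which is replaced by a real point. For a new variable \<open>v\<close>,
  the induction first matches the signs of the coefficients in \<open>R\<close> by real values
  \<open>b\<close> of the other variables. Then \<open>sign_transfer\<close>, applied to
  \<open>h\<close> and to evaluation at \<open>b\<close>, turns the coordinate
  \<open>h (Var v)\<close> into a real \<open>y\<close>.\<close>

lemma artin_lang:
  fixes h :: "('v::finite) mpoly \<Rightarrow> 'a::rcf"
  assumes h: "rhom h" and "finite Q"
  obtains x where "\<And>q. q \<in> Q \<Longrightarrow> same_sign (h q) (peval q x)"
proof -
  have "\<exists>b. \<forall>q\<in>Q. same_sign (h q) (poly_subst (\<lambda>c. c) b q)"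
    if "finite U" "finite Q" "Q \<subseteq> gen_ring U" for U Q
    using that
  proof (induction U arbitrary: Q rule: finite_induct)
    case empty
    have const: "\<exists>c. p = Const c" if "p \<in> gen_ring {}" for p :: "'v mpoly"
      using that by induction (auto simp flip: Const.add Const.mult)
    have "same_sign (h q) (poly_subst (\<lambda>c. c) (\<lambda>_. 0) q)" if "q \<in> Q" for q
    proof -
      have "q \<in> gen_ring {}"
        using that empty by blast
      from const[OF this] show ?thesis
        using same_sign_Const[OF h] by (auto simp: rhom_id)
    qed
    then show ?case
      by blast
  next
    case (insert v U)
    have "\<forall>q\<in>Q. \<exists>P\<in>gen_subring.polys U. q = poly P (Var v)"
      by (intro ballI gen_ring_insert subsetD[OF insert.prems(2)])
    then obtain P where P: "\<And>q. q \<in> Q \<Longrightarrow> P q \<in> gen_subring.polys U" "\<And>q. q \<in> Q \<Longrightarrow> q = poly (P q) (Var v)"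
      by metis
    have "P ` Q \<subseteq> gen_subring.polys U" "finite (P ` Q)"
      using P(1) insert.prems(1) by (intro image_subsetI, auto)
    then obtain R where R: "finite R" "R \<subseteq> gen_ring U"
      "\<forall>(phi :: 'v mpoly \<Rightarrow> 'a) (psi :: 'v mpoly \<Rightarrow> real) x. rhom phi \<longrightarrow> rhom psi \<longrightarrow>
      (\<forall>c\<in>R. same_sign (phi c) (psi c)) \<longrightarrow>
      (\<exists>y. \<forall>p\<in>P ` Q. same_sign (poly (map_poly phi p) x) (poly (map_poly psi p) y))"
      using gen_subring.sign_transfer[of "P ` Q" U] by metis
    obtain b where b: "\<forall>q\<in>R. same_sign (h q) (poly_subst (\<lambda>c. c) b q)"
      using insert.IH[OF R(1,2)] by blast
    obtain y where y: "\<forall>p\<in>P ` Q. same_sign (poly (map_poly h p) (h (Var v)))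
        (poly (map_poly (poly_subst (\<lambda>c. c) b) p) y)"
      using R(3)[rule_format, OF h rhom_poly_subst[OF rhom_id], of b "h (Var v)"] b by blast
    define b' where "b' = b(v := y)"
    have "same_sign (h q) (poly_subst (\<lambda>c. c) b' q)" if "q \<in> Q" for q
    proof -
      have "poly (map_poly h (P q)) (h (Var v)) = h q"
        using rhom.poly_map_poly[OF h] P(2)[OF that] by metis
      moreover have "map_poly (poly_subst (\<lambda>c. c) b) (P q) = map_poly (poly_subst (\<lambda>c. c) b') (P q)"
      proof (rule poly_eqI)
        fix i
        have "coeff (P q) i \<in> gen_ring U"
          by (rule gen_subring.coeff_mem) (rule P(1)[OF that])
        then have "poly_subst (\<lambda>c. c) b (coeff (P q) i) = poly_subst (\<lambda>c. c) b' (coeff (P q) i)"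
          using insert.hyps(2) by (intro poly_subst_cong_gen_ring rhom_id) (auto simp: b'_def)
        then show "coeff (map_poly (poly_subst (\<lambda>c. c) b) (P q)) i =
            coeff (map_poly (poly_subst (\<lambda>c. c) b') (P q)) i"
          by (simp add: rhom.coeff_map[OF rhom_poly_subst[OF rhom_id]])
      qed
      moreover have "poly (map_poly (poly_subst (\<lambda>c. c) b') (P q)) (poly_subst (\<lambda>c. c) b' (Var v)) =
          poly_subst (\<lambda>c. c) b' q"
        using rhom.poly_map_poly[OF rhom_poly_subst[OF rhom_id]] P(2)[OF that] by metis
      moreover have "poly_subst (\<lambda>c. c) b' (Var v) = y"
        by (simp add: rhom_id b'_def)
      ultimately show ?thesis
        using y that by (metis imageI)
    qed
    then show ?case
      by blast
  qed
  from this[of UNIV Q] obtain b where "\<forall>q\<in>Q. same_sign (h q) (poly_subst (\<lambda>c. c) b q)"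
    using assms(2) gen_ring_UNIV by auto
  then show ?thesis
    using that[of "\<chi> v. b v"] by (simp add: peval_def)
qed

text \<open>A counterexample anywhere would make \<open>chosen_cone\<close> one. Its members are
  nonnegative at the generic point in the real closure, and \<open>artin_lang\<close> moves this
  point to the reals for finitely many of them.\<close>

lemma not_pointless:
  fixes P :: "('v::finite) mpoly set"
  assumes "max_cone P"
  shows "\<not> pointless P"
proof
  assume "pointless P"
  then have "pointless (chosen_cone :: 'v mpoly set)"
    using assms chosen_cone(2) by blast
  then obtain G where G: "G \<subseteq> chosen_cone" "finite G" "\<And>x :: real ^ 'v. \<exists>p\<in>G. peval p x < 0"
    by (auto simp: pointless_def)
  obtain x where x: "\<And>q. q \<in> G \<Longrightarrow> same_sign (to_real_closure q) (peval q x)"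
    using artin_lang[OF rhom_to_real_closure G(2)] by metis
  obtain p where p: "p \<in> G" "peval p x < 0"
    using G(3) by blast
  then have "to_real_closure p < 0"
    using x[OF p(1)] by (simp add: same_sign_def)
  then show False
    using to_real_closure_nonneg G(1) p(1) by (meson not_le subsetD)
qed

text \<open>Finiteness of \<open>G\<close> matters: a preordering may be centred at infinity, with
  no real point where all its members are nonnegative.\<close>

lemma positivstellensatz:
  fixes T :: "('v::finite) mpoly set"
  assumes "ring_preordering T" "- 1 \<notin> T" "finite G" "G \<subseteq> T"
  obtains x where "\<And>p. p \<in> G \<Longrightarrow> peval p x \<ge> 0"
proof -
  obtain P where P: "max_cone P" "T \<subseteq> P"
    using ex_max_cone[OF assms(1,2)] by blast
  have "\<not> (\<forall>x. \<exists>p\<in>G. peval p x < 0)"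
    using not_pointless[OF P(1)] assms(3,4) P(2) unfolding pointless_def by blast
  then show ?thesis
    using that by (meson not_le)
qed

section \<open>Derivations modulo a prime ideal\<close>

text \<open>Derivations of a residue ring will be computed on representatives, up to the congruence
  \<open>eqv\<close>.\<close>

locale ideal_set =
  fixes I :: "'a::comm_ring_1 set"
  assumes zero: "0 \<in> I" and add: "x \<in> I \<Longrightarrow> y \<in> I \<Longrightarrow> x + y \<in> I" and mult: "x \<in> I \<Longrightarrow> a * x \<in> I"
begin

lemma mult_right: "x \<in> I \<Longrightarrow> x * a \<in> I"
  using mult[of x a] by (simp add: mult.commute)

lemma uminus: "x \<in> I \<Longrightarrow> - x \<in> I"
  using mult[of x "- 1"] by simp

lemma diff: "x \<in> I \<Longrightarrow> y \<in> I \<Longrightarrow> x - y \<in> I"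
  using add[of x "- y"] uminus[of y] by simp

lemma sum: "(\<And>i. i \<in> A \<Longrightarrow> f i \<in> I) \<Longrightarrow> (\<Sum>i\<in>A. f i) \<in> I"
  by (induction A rule: infinite_finite_induct) (auto simp: zero add)

definition eqv :: "'a \<Rightarrow> 'a \<Rightarrow> bool" (infix "\<doteq>" 50) where
  "x \<doteq> y \<longleftrightarrow> x - y \<in> I"

lemma eqv_refl: "x \<doteq> x"
  by (simp add: eqv_def zero)

lemma eqv_sym: "x \<doteq> y \<Longrightarrow> y \<doteq> x"
  using uminus[of "x - y"] by (simp add: eqv_def)

lemma eqv_trans [trans]: "x \<doteq> y \<Longrightarrow> y \<doteq> z \<Longrightarrow> x \<doteq> z"
  using add[of "x - y" "y - z"] by (simp add: eqv_def)

lemma eqv_add: "x \<doteq> y \<Longrightarrow> u \<doteq> v \<Longrightarrow> x + u \<doteq> y + v"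
  using add[of "x - y" "u - v"] by (simp add: eqv_def algebra_simps)

lemma eqv_mult: "x \<doteq> y \<Longrightarrow> a * x \<doteq> a * y"
  using mult[of "x - y" a] by (simp add: eqv_def algebra_simps)

lemma eqv_mem: "x \<doteq> y \<Longrightarrow> x \<in> I \<longleftrightarrow> y \<in> I"
  using add[of "x - y" y] diff[of x "x - y"] by (auto simp: eqv_def)

lemma eqv_sum: "(\<And>i. i \<in> A \<Longrightarrow> f i \<doteq> g i) \<Longrightarrow> (\<Sum>i\<in>A. f i) \<doteq> (\<Sum>i\<in>A. g i)"
  by (induction A rule: infinite_finite_induct) (auto simp: eqv_refl eqv_add)

lemma poly_mem: "(\<And>i. coeff p i \<in> I) \<Longrightarrow> poly p z \<in> I"
  by (simp add: poly_altdef sum mult_right)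

lemma eqv_poly: "(\<And>i. coeff p i \<doteq> coeff q i) \<Longrightarrow> poly p z \<doteq> poly q z"
  using poly_mem[of "p - q" z] by (simp add: eqv_def)

end

locale prime_ideal_set = ideal_set +
  assumes one: "1 \<notin> I" and prime: "a * b \<in> I \<Longrightarrow> a \<in> I \<or> b \<in> I"
begin

lemma power: "a ^ n \<in> I \<Longrightarrow> a \<in> I"
  by (induction n) (auto simp: one dest: prime)

end

section \<open>Prime ideals disjoint from a multiplicative set\<close>

lemma ex_prime_ideal_disjoint:
  assumes "ideal_set J" "J \<inter> M = {}" "1 \<in> M" "\<And>x y. x \<in> M \<Longrightarrow> y \<in> M \<Longrightarrow> x * y \<in> M"
  obtains I where "prime_ideal_set I" "J \<subseteq> I" "I \<inter> M = {}"
proof -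
  obtain I where I: "ideal_set I \<and> I \<inter> M = {}" "J \<subseteq> I"
    "\<And>K. ideal_set K \<and> K \<inter> M = {} \<Longrightarrow> I \<subseteq> K \<Longrightarrow> K = I"
  proof (rule ex_maximal_superset[of "\<lambda>I. ideal_set I \<and> I \<inter> M = {}" J])
    show "ideal_set J \<and> J \<inter> M = {}"
      using assms by blast
  next
    fix C :: "'a set set"
    assume C: "C \<noteq> {}" and A: "\<And>K. K \<in> C \<Longrightarrow> ideal_set K \<and> K \<inter> M = {}"
      and directed: "\<And>x y. x \<in> \<Union>C \<Longrightarrow> y \<in> \<Union>C \<Longrightarrow> \<exists>K\<in>C. x \<in> K \<and> y \<in> K"
    have "ideal_set (\<Union>C)"
    proof
      show "0 \<in> \<Union>C"
        using C A ideal_set.zero by blast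
      show "a * x \<in> \<Union>C" if "x \<in> \<Union>C" for a x
        using that A ideal_set.mult by blast
    next
      fix x y
      assume "x \<in> \<Union>C" "y \<in> \<Union>C"
      from directed[OF this] obtain K where "K \<in> C" "x \<in> K" "y \<in> K"
        by blast
      then show "x + y \<in> \<Union>C"
        using ideal_set.add[of K x y] A by blast
    qed
    then show "ideal_set (\<Union>C) \<and> \<Union>C \<inter> M = {}"
      using A by blast
  next
    fix K
    assume "ideal_set K \<and> K \<inter> M = {}" "J \<subseteq> K"
      "\<And>Q. ideal_set Q \<and> Q \<inter> M = {} \<Longrightarrow> K \<subseteq> Q \<Longrightarrow> Q = K"
    then show thesis
      by (rule that)
  qed
  interpret ideal_set I
    using I(1) by blast
  have larger: "\<exists>i\<in>I. \<exists>b. i + b * a \<in> M" if "a \<notin> I" for a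
  proof (rule ccontr)
    assume no: "\<not> ?thesis"
    define K where "K = {i + b * a | i b. i \<in> I}"
    have K: "i + b * a \<in> K" if "i \<in> I" for i b
      using that by (auto simp: K_def)
    have "ideal_set K"
    proof
      show "0 \<in> K"
        using K[OF zero, of 0] by simp
    next
      fix x y
      assume "x \<in> K" "y \<in> K"
      then obtain i b j c where *: "i \<in> I" "j \<in> I" "x = i + b * a" "y = j + c * a"
        by (auto simp: K_def)
      then show "x + y \<in> K"
        using K[OF add[OF *(1,2)], of "b + c"] by (simp add: algebra_simps)
    next
      fix x d
      assume "x \<in> K"
      then obtain i b where *: "i \<in> I" "x = i + b * a"
        by (auto simp: K_def)
      then show "d * x \<in> K"
        using K[OF mult[OF *(1)], of d "d * b"] by (simp add: algebra_simps)
    qed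
    moreover have "I \<subseteq> K"
      using K[of _ 0] by auto
    moreover have "K \<inter> M = {}"
      using no by (auto simp: K_def)
    ultimately have "K = I"
      using I by blast
    then show False
      using K[OF zero, of 1] that by simp
  qed
  have "prime_ideal_set I"
  proof
    show "1 \<notin> I"
      using I(1) assms(3) by blast
  next
    fix a b
    assume ab: "a * b \<in> I"
    show "a \<in> I \<or> b \<in> I"
    proof (rule ccontr)
      assume "\<not> ?thesis"
      then obtain i c j d where *: "i \<in> I" "i + c * a \<in> M" "j \<in> I" "j + d * b \<in> M"
        using larger[of a] larger[of b] by blast
      have "(i + c * a) * (j + d * b) = (j + d * b) * i + ((c * a) * j + (c * d) * (a * b))"
        by (simp add: algebra_simps)
      also have "\<dots> \<in> I"
        by (rule add[OF mult[OF *(1)] add[OF mult[OF *(3)] mult[OF ab]]])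
      finally have "(i + c * a) * (j + d * b) \<in> I" .
      moreover have "(i + c * a) * (j + d * b) \<in> M"
        using * by (intro assms(4))
      ultimately show False
        using I(1) by blast
    qed
  qed
  then show ?thesis
    using that I(1,2) by blast
qed

section \<open>Extension of derivations\<close>

lemma fderiv_add: "fderiv (p + q) = fderiv p + fderiv q"
  by (rule poly_eqI) (simp add: coeff_fderiv algebra_simps)

lemma fderiv_smult: "fderiv (smult a p) = smult a (fderiv p)"
  by (rule poly_eqI) (simp add: coeff_fderiv algebra_simps)

lemma fderiv_pCons: "fderiv (pCons a p) = p + pCons 0 (fderiv p)"
  by (rule poly_eqI) (auto simp: coeff_fderiv coeff_pCons algebra_simps split: nat.split)

lemma fderiv_mult: "fderiv (p * q) = p * fderiv q + q * fderiv p"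
  by (induction p) (simp_all add: fderiv_add fderiv_smult fderiv_pCons algebra_simps, simp add: fderiv_def)

locale prime_ideal_char_0 = prime_ideal_set +
  assumes of_nat: "of_nat (Suc n) \<notin> I"
begin

text \<open>\<open>D\<close> represents a derivation from the image of \<open>S\<close> to the
  residue ring modulo \<open>I\<close>. The exact equation \<open>D 0 = 0\<close> makes
  \<open>map_poly D\<close> act coefficientwise.\<close>

definition derivation_on :: "'a set \<Rightarrow> ('a \<Rightarrow> 'a) \<Rightarrow> bool" where
  "derivation_on S D \<longleftrightarrow> D 0 = 0 \<and>
    (\<forall>x\<in>S. \<forall>y\<in>S. D (x + y) \<doteq> D x + D y \<and> D (x * y) \<doteq> x * D y + y * D x) \<and>
    (\<forall>x\<in>S. x \<in> I \<longrightarrow> D x \<in> I)"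

lemma derivation_onD:
  assumes "derivation_on S D"
  shows "D 0 = 0" "x \<in> S \<Longrightarrow> y \<in> S \<Longrightarrow> D (x + y) \<doteq> D x + D y"
    "x \<in> S \<Longrightarrow> y \<in> S \<Longrightarrow> D (x * y) \<doteq> x * D y + y * D x" "x \<in> S \<Longrightarrow> x \<in> I \<Longrightarrow> D x \<in> I"
  using assms by (auto simp: derivation_on_def)

text \<open>The extension of a derivation \<open>D\<close> of \<open>S\<close> to \<open>S[z]\<close>, up to the factor \<open>a\<close>, that sends \<open>z\<close> to \<open>c\<close>.\<close>

definition extend :: "('a \<Rightarrow> 'a) \<Rightarrow> 'a \<Rightarrow> 'a \<Rightarrow> 'a \<Rightarrow> 'a poly \<Rightarrow> 'a" where
  "extend D z a c p = a * poly (map_poly D p) z + c * poly (fderiv p) z"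

definition adjoin :: "'a set \<Rightarrow> 'a \<Rightarrow> 'a set" where
  "adjoin S z = {poly p z | p. p \<in> subring_set.polys S}"

context
  fixes S D
  assumes S: "subring_set S" and D: "derivation_on S D"
begin

interpretation S: subring_set S
  by (rule S)

lemma coeff_map_D: "coeff (map_poly D p) i = D (coeff p i)"
  by (simp add: coeff_map_poly derivation_onD(1)[OF D])

lemma D_sum: "(\<And>i. i \<in> A \<Longrightarrow> f i \<in> S) \<Longrightarrow> D (\<Sum>i\<in>A. f i) \<doteq> (\<Sum>i\<in>A. D (f i))"
proof (induction A rule: infinite_finite_induct)
  case (insert a A)
  have "D (f a + (\<Sum>i\<in>A. f i)) \<doteq> D (f a) + D (\<Sum>i\<in>A. f i)"
    using insert.prems by (intro derivation_onD(2)[OF D] S.sum) auto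
  also have "\<dots> \<doteq> D (f a) + (\<Sum>i\<in>A. D (f i))"
    using insert by (intro eqv_add eqv_refl) auto
  finally show ?case
    using insert.hyps by simp
qed (simp_all add: derivation_onD(1)[OF D] eqv_refl)

lemma extend_add:
  assumes "p \<in> S.polys" "q \<in> S.polys"
  shows "extend D z a c (p + q) \<doteq> extend D z a c p + extend D z a c q"
proof -
  have "poly (map_poly D (p + q)) z \<doteq> poly (map_poly D p + map_poly D q) z"
    by (rule eqv_poly) (use assms in \<open>simp add: coeff_map_D derivation_onD(2)[OF D] S.coeff_mem\<close>)
  from eqv_add[OF eqv_mult[OF this, of a] eqv_refl[of "c * poly (fderiv (p + q)) z"]]
  show ?thesis
    by (simp add: extend_def fderiv_add algebra_simps)
qed

lemma extend_mult:
  assumes "p \<in> S.polys" "q \<in> S.polys"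
  shows "extend D z a c (p * q) \<doteq> poly p z * extend D z a c q + poly q z * extend D z a c p"
proof -
  have "poly (map_poly D (p * q)) z \<doteq> poly (p * map_poly D q + map_poly D p * q) z"
  proof (rule eqv_poly)
    fix n
    have "D (\<Sum>i\<le>n. coeff p i * coeff q (n - i)) \<doteq> (\<Sum>i\<le>n. D (coeff p i * coeff q (n - i)))"
      using assms by (intro D_sum S.mult S.coeff_mem)
    also have "\<dots> \<doteq> (\<Sum>i\<le>n. coeff p i * D (coeff q (n - i)) + coeff q (n - i) * D (coeff p i))"
      using assms by (intro eqv_sum derivation_onD(3)[OF D] S.coeff_mem)
    finally show "coeff (map_poly D (p * q)) n \<doteq> coeff (p * map_poly D q + map_poly D p * q) n"
      by (simp add: coeff_map_D coeff_mult sum.distrib mult.commute[of "coeff q _"])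
  qed
  from eqv_add[OF eqv_mult[OF this, of a] eqv_refl[of "c * poly (fderiv (p * q)) z"]]
  show ?thesis
    by (simp add: extend_def fderiv_mult algebra_simps)
qed

lemma extend_const: "extend D z a c [:x:] = a * D x"
  by (simp add: extend_def map_poly_pCons derivation_onD(1)[OF D] fderiv_def)

lemma extend_coeffs_mem:
  assumes "p \<in> S.polys" "\<And>i. coeff p i \<in> I"
  shows "extend D z a c p \<in> I"
  unfolding extend_def using assms
  by (intro add mult poly_mem)
    (auto simp: coeff_map_D coeff_fderiv S.coeff_mem derivation_onD(4)[OF D] mult simp del: of_nat_Suc)

lemma subring_set_adjoin: "subring_set (adjoin S z)"
proof
  show "1 \<in> adjoin S z"
    unfolding adjoin_def by (intro CollectI exI[of _ "[:1:]"]) (simp add: S.polys_pCons S.polys_0 S.one)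
next
  fix x y
  assume "x \<in> adjoin S z" "y \<in> adjoin S z"
  then obtain p q where *: "p \<in> S.polys" "q \<in> S.polys" "x = poly p z" "y = poly q z"
    by (auto simp: adjoin_def)
  show "x + y \<in> adjoin S z" "x * y \<in> adjoin S z"
    unfolding adjoin_def using * S.polys_add S.polys_mult by (metis (mono_tags, lifting) CollectI poly_add, metis (mono_tags, lifting) CollectI poly_mult)
next
  fix x
  assume "x \<in> adjoin S z"
  then obtain p where *: "p \<in> S.polys" "x = poly p z"
    by (auto simp: adjoin_def)
  then show "- x \<in> adjoin S z"
    unfolding adjoin_def using S.polys_diff[OF S.polys_0 *(1)]
    by (intro CollectI exI[of _ "- p"]) simp
qed

lemma subset_adjoin: "S \<subseteq> adjoin S z"
proof
  fix x assume "x \<in> S"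
  then show "x \<in> adjoin S z"
    unfolding adjoin_def by (intro CollectI exI[of _ "[:x:]"]) (simp add: S.polys_pCons S.polys_0)
qed

lemma mem_adjoin: "z \<in> adjoin S z"
  unfolding adjoin_def
  by (intro CollectI exI[of _ "[:0, 1:]"]) (simp add: S.polys_pCons S.polys_0 S.zero S.one)

text \<open>Two polynomials in \<open>S[X]\<close> with the same value at \<open>z\<close> differ by
  one that vanishes at \<open>z\<close>. So \<open>kills\<close> makes the value modulo
  \<open>I\<close> independent of the representative.\<close>

lemma derivation_extend:
  assumes kills: "\<And>p. p \<in> S.polys \<Longrightarrow> poly p z \<in> I \<Longrightarrow> extend D z a c p \<in> I"
  obtains D' where "derivation_on (adjoin S z) D'" "\<And>p. p \<in> S.polys \<Longrightarrow> D' (poly p z) \<doteq> extend D z a c p"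
proof -
  define rep where "rep x = (SOME p. p \<in> S.polys \<and> poly p z = x)" for x
  \<comment> \<open>The value at 0 is set by hand, as \<open>derivation_on\<close> demands it
    exactly.\<close>
  define D' where "D' x = (if x = 0 then 0 else extend D z a c (rep x))" for x
  have D': "D' (poly p z) \<doteq> extend D z a c p" if p: "p \<in> S.polys" for p
  proof (cases "poly p z = 0")
    case True
    then show ?thesis
      using kills[OF p] zero uminus by (simp add: D'_def eqv_def)
  next
    case False
    define r where "r = rep (poly p z)"
    have r: "r \<in> S.polys" "poly r z = poly p z"
      unfolding r_def rep_def using someI[of "\<lambda>r. r \<in> S.polys \<and> poly r z = poly p z" p] p by auto
    have "extend D z a c r \<doteq> extend D z a c (r - p) + extend D z a c p"
      using extend_add[of "r - p" p] r(1) p S.polys_diff by simp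
    moreover have "extend D z a c (r - p) \<in> I"
      using r p by (intro kills) (auto simp: S.polys_diff zero)
    ultimately have "extend D z a c r \<doteq> extend D z a c p"
      using diff[of "extend D z a c r - (extend D z a c (r - p) + extend D z a c p)" "- extend D z a c (r - p)"] uminus
      by (simp add: eqv_def)
    then show ?thesis
      using False by (simp add: D'_def r_def)
  qed
  have "derivation_on (adjoin S z) D'"
    unfolding derivation_on_def
  proof (intro conjI ballI impI)
    show "D' 0 = 0"
      by (simp add: D'_def)
  next
    fix x y
    assume "x \<in> adjoin S z" "y \<in> adjoin S z"
    then obtain p q where *: "p \<in> S.polys" "q \<in> S.polys" "x = poly p z" "y = poly q z"
      by (auto simp: adjoin_def)
    have "D' (x + y) \<doteq> extend D z a c (p + q)"
      using D'[OF S.polys_add[OF *(1,2)]] * by simp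
    also have "\<dots> \<doteq> extend D z a c p + extend D z a c q"
      using * by (intro extend_add)
    also have "\<dots> \<doteq> D' x + D' y"
      using * by (intro eqv_add eqv_sym[OF D'[OF *(1), folded *(3)]] eqv_sym[OF D'[OF *(2), folded *(4)]])
    finally show "D' (x + y) \<doteq> D' x + D' y" .
    have "D' (x * y) \<doteq> extend D z a c (p * q)"
      using D'[OF S.polys_mult[OF *(1,2)]] * by simp
    also have "\<dots> \<doteq> x * extend D z a c q + y * extend D z a c p"
      using extend_mult[OF *(1,2)] *(3,4) by simp
    also have "\<dots> \<doteq> x * D' y + y * D' x"
      using * by (intro eqv_add eqv_mult eqv_sym[OF D'[OF *(1), folded *(3)]] eqv_sym[OF D'[OF *(2), folded *(4)]])
    finally show "D' (x * y) \<doteq> x * D' y + y * D' x" .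
  next
    fix x
    assume x: "x \<in> adjoin S z" "x \<in> I"
    then obtain p where *: "p \<in> S.polys" "x = poly p z"
      by (auto simp: adjoin_def)
    then show "D' x \<in> I"
      using eqv_mem[OF D'[OF *(1)]] kills[OF *(1)] x(2) by simp
  qed
  then show ?thesis
    using that D' by blast
qed

text \<open>If \<open>z\<close> is algebraic modulo \<open>I\<close> over \<open>S\<close>, with a relation \<open>P\<close> of minimal degree, the value at \<open>z\<close> is forced
  by \<open>P(z) = 0\<close>; multiplication by \<open>P'(z)\<close> avoids denominators.\<close>

lemma derivation_extend_step:
  obtains D' a where "derivation_on (adjoin S z) D'" "a \<notin> I" "\<And>x. x \<in> S \<Longrightarrow> D' x \<doteq> a * D x"
proof -
  have "\<exists>a c. a \<notin> I \<and> (\<forall>p\<in>S.polys. poly p z \<in> I \<longrightarrow> extend D z a c p \<in> I)"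
  proof (cases "\<forall>p\<in>S.polys. poly p z \<in> I \<longrightarrow> (\<forall>i. coeff p i \<in> I)")
    \<comment> \<open>Here \<open>z\<close> is transcendental over \<open>S\<close> modulo
      \<open>I\<close>, so its image may be prescribed; 0 is taken.\<close>
    case True
    then show ?thesis
      using one extend_coeffs_mem by (intro exI[of _ 1] exI[of _ 0]) blast
  next
    case False
    define R where "R p \<longleftrightarrow> p \<in> S.polys \<and> poly p z \<in> I \<and> (\<exists>i. coeff p i \<notin> I)" for p
    obtain p0 where "R p0"
      using False by (auto simp: R_def)
    then obtain P where P: "R P" "\<And>p. degree p < degree P \<Longrightarrow> \<not> R p"
      using ex_has_least_nat[of R p0 degree] by (metis not_le)
    have P_polys: "P \<in> S.polys" and Pz: "poly P z \<in> I"
      using P(1) by (auto simp: R_def)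
    have small: "coeff p i \<in> I" if "p \<in> S.polys" "poly p z \<in> I" "degree p < degree P" for p i
      using P(2)[OF that(3)] that by (auto simp: R_def)
    \<comment> \<open>Otherwise \<open>trunc_poly P\<close> would be a nontrivial relation of
      smaller degree.\<close>
    have lc: "lead_coeff P \<notin> I"
    proof
      assume lc: "lead_coeff P \<in> I"
      obtain i where i: "coeff P i \<notin> I"
        using P(1) by (auto simp: R_def)
      have "degree P > 0"
      proof (rule ccontr)
        assume "\<not> ?thesis"
        then have "degree P = 0"
          by simp
        then show False
          using i lc by (cases "i = 0") (auto simp: coeff_eq_0 zero)
      qed
      then have deg: "degree (trunc_poly P) < degree P"
        by (rule degree_trunc_poly)
      have "poly (trunc_poly P) z \<in> I"
        using Pz lc by (auto simp: trunc_poly_def poly_monom intro: diff mult_right)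
      then have "coeff (trunc_poly P) i \<in> I"
        by (intro small S.polys_trunc P_polys deg)
      moreover have "coeff P i = coeff (trunc_poly P) i + (if i = degree P then lead_coeff P else 0)"
        by (simp add: trunc_poly_def)
      ultimately show False
        using i lc add zero by (auto split: if_splits)
    qed
    have dP: "degree P > 0"
    proof (rule ccontr)
      assume "\<not> ?thesis"
      then obtain c where "P = [:c:]"
        using degree_eq_zeroE by blast
      then show False
        using lc Pz by simp
    qed
    \<comment> \<open>Chosen so that \<open>extend D z a c P = 0\<close>. Minimality of
      \<open>P\<close> and characteristic 0 keep the factor \<open>a\<close> outside
      \<open>I\<close>.\<close>
    define a c where "a = poly (fderiv P) z" and "c = - poly (map_poly D P) z"
    have "a \<notin> I"
    proof
      assume "a \<in> I"
      then have "coeff (fderiv P) (degree P - 1) \<in> I"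
        unfolding a_def by (intro small S.polys_fderiv P_polys degree_fderiv dP)
      then have "of_nat (Suc (degree P - 1)) * lead_coeff P \<in> I"
        using dP by (simp add: coeff_fderiv del: of_nat_Suc)
      then show False
        using prime lc of_nat by blast
    qed
    moreover have "extend D z a c p \<in> I" if p: "p \<in> S.polys" "poly p z \<in> I" for p
    proof -
      \<comment> \<open>The remainder of a relation is a relation of smaller degree, so all its
        coefficients are in \<open>I\<close>. Hence \<open>extend\<close> kills it as it kills the
        multiple of \<open>P\<close>, and the factor \<open>l\<close> is removed by
        primality.\<close>
      obtain k q r where qr: "q \<in> S.polys" "r \<in> S.polys" "smult (lead_coeff P ^ k) p = q * P + r" "degree r < degree P"
        using S.pseudo_division[OF dP P_polys p(1)] by blast
      define l where "l = lead_coeff P ^ k"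
      have l: "l \<in> S" "l \<notin> I"
        unfolding l_def using lc power P_polys by (auto intro: S.power S.coeff_mem)
      have "poly r z = l * poly p z - poly q z * poly P z"
        using arg_cong[OF qr(3), of "\<lambda>p. poly p z"] by (simp add: l_def)
      then have "poly r z \<in> I"
        using p(2) Pz by (simp add: diff mult)
      then have r: "extend D z a c r \<in> I"
        using qr(2,4) by (intro extend_coeffs_mem small)
      have "extend D z a c P = 0"
        by (simp add: extend_def a_def c_def)
      then have "extend D z a c (q * P) \<in> I"
        using eqv_mem[OF extend_mult[OF qr(1) P_polys]] Pz by (simp add: mult_right)
      then have "extend D z a c (smult l p) \<in> I"
        using eqv_mem[OF extend_add[OF S.polys_mult[OF qr(1) P_polys] qr(2)]] r qr(3) add by (simp add: l_def)
      moreover have "extend D z a c ([:l:] * p) \<doteq> l * extend D z a c p + poly p z * (a * D l)"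
        using extend_mult[of "[:l:]" p z a c] p(1) l(1)
        by (simp add: extend_const S.polys_pCons S.polys_0)
      ultimately have "l * extend D z a c p + poly p z * (a * D l) \<in> I"
        using eqv_mem by simp
      then have "l * extend D z a c p \<in> I"
        using diff[of "l * extend D z a c p + poly p z * (a * D l)" "poly p z * (a * D l)"] p(2)
        by (simp add: mult_right)
      then show ?thesis
        using prime l(2) by blast
    qed
    ultimately show ?thesis
      by blast
  qed
  then obtain a c where ac: "a \<notin> I" "\<And>p. p \<in> S.polys \<Longrightarrow> poly p z \<in> I \<Longrightarrow> extend D z a c p \<in> I"
    by blast
  from derivation_extend[OF ac(2)] obtain D' where D': "derivation_on (adjoin S z) D'"
      "\<And>p. p \<in> S.polys \<Longrightarrow> D' (poly p z) \<doteq> extend D z a c p"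
    by metis
  have "D' x \<doteq> a * D x" if "x \<in> S" for x
    using D'(2)[of "[:x:]"] that by (simp add: extend_const S.polys_pCons S.polys_0)
  then show ?thesis
    using that D'(1) ac(1) by blast
qed

end

end

text \<open>Start with differentiation by \<open>f\<close> on the polynomials in \<open>f\<close>
  and adjoin the variables one at a time. Each step multiplies the old derivation by a factor
  outside \<open>I\<close>, so primality keeps \<open>D f\<close> outside \<open>I\<close>.\<close>

lemma transcendental_derivation:
  fixes I :: "('v::finite) mpoly set"
  assumes "prime_ideal_set I"
    and transcendental: "\<And>q :: real poly. poly (map_poly Const q) f \<in> I \<Longrightarrow> q = 0"
  obtains D where "\<And>x y. D (x + y) - (D x + D y) \<in> I" "\<And>x y. D (x * y) - (x * D y + y * D x) \<in> I"
    "\<And>x. x \<in> I \<Longrightarrow> D x \<in> I" "\<And>c. D (Const c) \<in> I" "D f \<notin> I"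
proof -
  interpret prime_ideal_set I by fact
  have const: "Const c \<notin> I" if "c \<noteq> 0" for c
  proof
    assume "Const c \<in> I"
    then have "Const (1 / c) * Const c \<in> I"
      by (rule mult)
    also have "Const (1 / c) * Const c = (Const 1 :: 'v mpoly)"
      using that by (intro Const_mult_eq) simp
    finally show False
      using one by simp
  qed
  interpret prime_ideal_char_0 I
  proof
    show "of_nat (Suc n) \<notin> I" for n
    proof -
      have "of_nat k = (Const (of_nat k) :: 'v mpoly)" for k
        by (induction k) auto
      then show ?thesis
        using const[of "of_nat (Suc n)"] by (simp del: of_nat_Suc)
    qed
  qed
  define S0 :: "'v mpoly set" where "S0 = range Const"
  have S0: "subring_set S0"
    by unfold_locales (auto simp: S0_def simp flip: Const.one Const.add Const.mult Const.uminus)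
  have D0: "derivation_on S0 (\<lambda>_. 0)"
    by (simp add: derivation_on_def eqv_refl zero)
  have coeffs0: "coeff p i \<in> I" if "p \<in> subring_set.polys S0" "poly p f \<in> I" for p i
  proof -
    have "\<forall>i. \<exists>c. coeff p i = Const c"
      using subring_set.coeff_mem[OF S0 that(1)] by (auto simp: S0_def)
    then obtain c where c: "\<And>i. coeff p i = Const (c i)"
      by metis
    define q where "q = (\<Sum>i\<le>degree p. monom (c i) i)"
    have "coeff q i = (if i \<le> degree p then c i else 0)" for i
      by (simp add: q_def coeff_sum)
    moreover have "c i = 0" if "i > degree p" for i
      using c[of i] coeff_eq_0[OF that] const zero by metis
    ultimately have "map_poly Const q = p"
      by (intro poly_eqI) (auto simp: Const.coeff_map c)
    then have "p = 0"
      using transcendental[of q] that(2) by auto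
    then show ?thesis
      by (simp add: zero)
  qed
  \<comment> \<open>With these parameters \<open>extend\<close> is the formal derivative evaluated
    at \<open>f\<close>, well defined because \<open>f\<close> satisfies no nontrivial
    relation.\<close>
  have "extend (\<lambda>_. 0) f 0 1 p \<in> I" if "p \<in> subring_set.polys S0" "poly p f \<in> I" for p
    using extend_coeffs_mem[OF S0 D0 that(1)] coeffs0[OF that] by blast
  from derivation_extend[OF S0 D0 this] obtain D1 where D1: "derivation_on (adjoin S0 f) D1"
      "\<And>p. p \<in> subring_set.polys S0 \<Longrightarrow> D1 (poly p f) \<doteq> extend (\<lambda>_. 0) f 0 1 p"
    by metis
  have c0: "[:x:] \<in> subring_set.polys S0" if "x \<in> S0" for x
    using that S0 by (auto intro!: subring_set.polys_pCons[OF S0] subring_set.polys_0[OF S0])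
  have D1_const: "D1 x \<in> I" if "x \<in> S0" for x
    using D1(2)[OF c0[OF that]] by (simp add: extend_def fderiv_def eqv_def)
  have "[:0, 1:] \<in> subring_set.polys S0"
    by (intro subring_set.polys_pCons[OF S0] subring_set.polys_0[OF S0] subring_set.zero[OF S0] subring_set.one[OF S0])
  from D1(2)[OF this] have "D1 f \<doteq> 1"
    by (simp add: extend_def fderiv_pCons fderiv_def one_pCons)
  then have D1_f: "D1 f \<notin> I"
    using eqv_mem one by blast
  have "\<exists>S D. subring_set S \<and> S0 \<subseteq> S \<and> f \<in> S \<and> Var ` U \<subseteq> S \<and> derivation_on S D \<and>
      (\<forall>x\<in>S0. D x \<in> I) \<and> D f \<notin> I" if "finite U" for U :: "'v set"
    using that
  proof (induction U rule: finite_induct)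
    case empty
    show ?case
      using subring_set_adjoin[OF S0 D0] subset_adjoin[OF S0 D0] mem_adjoin[OF S0 D0] D1(1) D1_const D1_f
      by blast
  next
    case (insert v U)
    then obtain S D where SD: "subring_set S" "S0 \<subseteq> S" "f \<in> S" "Var ` U \<subseteq> S" "derivation_on S D"
        "\<forall>x\<in>S0. D x \<in> I" "D f \<notin> I"
      by blast
    from derivation_extend_step[OF SD(1,5)] obtain D' a where D': "derivation_on (adjoin S (Var v)) D'"
        "a \<notin> I" "\<And>x. x \<in> S \<Longrightarrow> D' x \<doteq> a * D x"
      by metis
    have "D' x \<in> I" if "x \<in> S0" for x
      using eqv_mem[OF D'(3)[of x]] SD(2,6) that mult by blast
    moreover have "D' f \<notin> I"
      using eqv_mem[OF D'(3)[OF SD(3)]] SD(7) D'(2) prime by blast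
    moreover have "Var ` insert v U \<subseteq> adjoin S (Var v)"
      using SD(4) subset_adjoin[OF SD(1,5), of "Var v"] mem_adjoin[OF SD(1,5), of "Var v"] by auto
    ultimately show ?case
      using subring_set_adjoin[OF SD(1,5), of "Var v"] subset_adjoin[OF SD(1,5), of "Var v"] SD(2,3) D'(1)
      by (intro exI[of _ "adjoin S (Var v)"] exI[of _ D']) blast
  qed
  from this[OF finite] obtain S D where SD: "subring_set S" "S0 \<subseteq> S" "Var ` UNIV \<subseteq> S" "derivation_on S D"
      "\<forall>x\<in>S0. D x \<in> I" "D f \<notin> I"
    by blast
  have all: "p \<in> S" for p
  proof (induction p rule: mpoly_induct)
    case (Const c)
    then show ?case
      using SD(2) by (auto simp: S0_def)
  next
    case (Var v)
    then show ?case
      using SD(3) by auto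
  qed (auto intro: subring_set.add[OF SD(1)] subring_set.mult[OF SD(1)])
  show ?thesis
    by (rule that[of D])
      (use all SD(5,6) derivation_onD[OF SD(4)] in \<open>auto simp: eqv_def S0_def\<close>)
qed

section \<open>Certificates and interpolation\<close>

text \<open>All exponents are allowed, so that products of such monomials keep the form.\<close>

definition cone_monomial :: "('m::finite \<Rightarrow> 'v mpoly) \<Rightarrow> ('m \<Rightarrow> nat) \<Rightarrow> 'v mpoly" where
  "cone_monomial g a = (\<Prod>j\<in>UNIV. g j ^ a j)"

lemma cone_monomial_add: "cone_monomial g (\<lambda>j. a j + b j) = cone_monomial g a * cone_monomial g b"
  by (simp add: cone_monomial_def power_add prod.distrib)

lemma preorder_cone_def': "preorder_cone g =
    {\<Sum>a\<in>UNIV \<rightarrow> {0, 1}. cone_monomial g a * s a | s. \<forall>a. s a \<in> sos}"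
  by (simp add: preorder_cone_def cone_monomial_def)

lemma preorder_coneI:
  "(\<And>a. s a \<in> sos) \<Longrightarrow> (\<Sum>a\<in>UNIV \<rightarrow> {0, 1}. cone_monomial g a * s a) \<in> preorder_cone g"
  unfolding preorder_cone_def' by blast

lemma quad_moduleI:
  "s0 \<in> sos \<Longrightarrow> (\<And>j. s j \<in> sos) \<Longrightarrow> s0 + (\<Sum>j\<in>UNIV. g j * s j) \<in> quad_module g"
  unfolding quad_module_def by blast

lemma finite_exponents: "finite (UNIV \<rightarrow> {0, 1 :: nat} :: ('m::finite \<Rightarrow> nat) set)"
  using finite_PiE[of "UNIV :: 'm set" "\<lambda>_. {0, 1 :: nat}"] by (simp add: PiE_UNIV_domain Pi_def)

lemma preorder_cone_add:
  assumes "p \<in> preorder_cone g" "q \<in> preorder_cone g"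
  shows "p + q \<in> preorder_cone g"
proof -
  obtain s t where s: "p = (\<Sum>a\<in>UNIV \<rightarrow> {0, 1}. cone_monomial g a * s a)" "\<forall>a. s a \<in> sos"
    and t: "q = (\<Sum>a\<in>UNIV \<rightarrow> {0, 1}. cone_monomial g a * t a)" "\<forall>a. t a \<in> sos"
    using assms unfolding preorder_cone_def' by blast
  have "p + q = (\<Sum>a\<in>UNIV \<rightarrow> {0, 1}. cone_monomial g a * (s a + t a))"
    unfolding s t by (simp add: sum.distrib algebra_simps)
  then show ?thesis
    using preorder_coneI[of "\<lambda>a. s a + t a" g] s(2) t(2) by (simp add: sos_add)
qed

text \<open>Exponents are reduced modulo 2; what is split off is a square and goes into the sum of
  squares.\<close>

lemma preorder_cone_term:
  assumes "s \<in> sos"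
  shows "cone_monomial g a * s \<in> preorder_cone g"
proof -
  define b c where "b = (\<lambda>j. a j mod 2)" and "c = (\<lambda>j. a j div 2)"
  have "a j = b j + (c j + c j)" for j
    unfolding b_def c_def by presburger
  then have "a = (\<lambda>j. b j + (c j + c j))"
    by (rule ext)
  then have "cone_monomial g a = cone_monomial g b * (cone_monomial g c * cone_monomial g c)"
    by (metis (no_types) cone_monomial_add)
  moreover have "b \<in> UNIV \<rightarrow> {0, 1}"
    by (auto simp: b_def)
  then have "(\<Sum>d\<in>UNIV \<rightarrow> {0, 1}. cone_monomial g d *
      (if d = b then cone_monomial g c * cone_monomial g c * s else 0)) =
      cone_monomial g b * (cone_monomial g c * cone_monomial g c * s)"
    by (simp add: finite_exponents[simplified] if_distrib[of "\<lambda>x. _ * x"] sum.delta cong: if_cong)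
  ultimately have "cone_monomial g a * s = (\<Sum>d\<in>UNIV \<rightarrow> {0, 1}. cone_monomial g d *
      (if d = b then cone_monomial g c * cone_monomial g c * s else 0))"
    by (simp add: mult.assoc)
  then show ?thesis
    using preorder_coneI[of "\<lambda>d. if d = b then cone_monomial g c * cone_monomial g c * s else 0" g] assms
    by (simp add: sos_zero sos_mult_square)
qed

lemma sos_subset_preorder_cone: "sos \<subseteq> preorder_cone g"
  using preorder_cone_term[of _ g "\<lambda>_. 0"] by (auto simp: cone_monomial_def)

lemma preorder_cone_sum: "(\<And>i. i \<in> A \<Longrightarrow> p i \<in> preorder_cone g) \<Longrightarrow> (\<Sum>i\<in>A. p i) \<in> preorder_cone g"
  using sos_subset_preorder_cone[of g] sos_zero
  by (induction A rule: infinite_finite_induct) (auto intro: preorder_cone_add)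

lemma preorder_cone_mult:
  assumes "p \<in> preorder_cone g" "q \<in> preorder_cone g"
  shows "p * q \<in> preorder_cone g"
proof -
  obtain s t where s: "p = (\<Sum>a\<in>UNIV \<rightarrow> {0, 1}. cone_monomial g a * s a)" "\<forall>a. s a \<in> sos"
    and t: "q = (\<Sum>a\<in>UNIV \<rightarrow> {0, 1}. cone_monomial g a * t a)" "\<forall>a. t a \<in> sos"
    using assms unfolding preorder_cone_def' by blast
  have "cone_monomial g a * s a * (cone_monomial g b * t b) \<in> preorder_cone g" for a b
    using preorder_cone_term[OF sos_mult, of "s a" "t b" g "\<lambda>j. a j + b j"] s t
    by (simp add: cone_monomial_add mult_ac)
  then show ?thesis
    unfolding s(1) t(1) sum_product by (intro preorder_cone_sum)
qed

lemma generator_mem_preorder_cone: "g j \<in> preorder_cone g"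
proof -
  have "cone_monomial g (\<lambda>i. if i = j then 1 else 0) = g j"
    by (simp add: cone_monomial_def if_distrib[of "\<lambda>x. _ ^ x"] prod.delta cong: if_cong)
  then show ?thesis
    using preorder_cone_term[OF sos_one, of g "\<lambda>i. if i = j then 1 else 0"] by simp
qed

lemma quad_module_add:
  assumes "p \<in> quad_module g" "q \<in> quad_module g"
  shows "p + q \<in> quad_module g"
proof -
  obtain s0 s t0 t where s: "p = s0 + (\<Sum>j\<in>UNIV. g j * s j)" "s0 \<in> sos" "\<forall>j. s j \<in> sos"
    and t: "q = t0 + (\<Sum>j\<in>UNIV. g j * t j)" "t0 \<in> sos" "\<forall>j. t j \<in> sos"
    using assms unfolding quad_module_def by blast
  have "p + q = (s0 + t0) + (\<Sum>j\<in>UNIV. g j * (s j + t j))"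
    unfolding s(1) t(1) by (simp add: sum.distrib algebra_simps)
  then show ?thesis
    using quad_moduleI[of "s0 + t0" "\<lambda>j. s j + t j" g] s(2,3) t(2,3) by (simp add: sos_add)
qed

lemma quad_module_scale:
  assumes "r \<in> sos" "p \<in> quad_module g"
  shows "r * p \<in> quad_module g"
proof -
  obtain s0 s where s: "p = s0 + (\<Sum>j\<in>UNIV. g j * s j)" "s0 \<in> sos" "\<forall>j. s j \<in> sos"
    using assms unfolding quad_module_def by blast
  have "r * p = r * s0 + (\<Sum>j\<in>UNIV. g j * (r * s j))"
    unfolding s(1) by (simp add: sum_distrib_left algebra_simps)
  then show ?thesis
    using quad_moduleI[of "r * s0" "\<lambda>j. r * s j" g] s(2,3) assms(1) by (simp add: sos_mult)
qed

lemma sos_subset_quad_module: "sos \<subseteq> quad_module g"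
proof
  fix s :: "'a mpoly" assume "s \<in> sos"
  then show "s \<in> quad_module g"
    using quad_moduleI[of s "\<lambda>_. 0" g] by (simp add: sos_zero)
qed

lemma generator_mem_quad_module: "g j \<in> quad_module g"
proof -
  have "g j = 0 + (\<Sum>i\<in>UNIV. g i * (if i = j then 1 else 0))"
    by (simp add: if_distrib[of "\<lambda>x. _ * x"] sum.delta cong: if_cong)
  then show ?thesis
    using quad_moduleI[of 0 "\<lambda>i. if i = j then 1 else 0" g] by (simp add: sos_zero sos_one)
qed

lemma lift_sos: "s \<in> sos \<Longrightarrow> lift_poly s \<in> sos"
  by (induction s rule: sos_induct) (simp_all add: sos_zero sos_add_square)

lemma lift_preorder_cone:
  fixes g :: "'m::finite \<Rightarrow> 'n mpoly"
  assumes "p \<in> preorder_cone g"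
  shows "lift_poly p \<in> preorder_cone (\<lambda>j. lift_poly (g j) :: ('n, 'k) var mpoly)"
proof -
  obtain s where s: "p = (\<Sum>a\<in>UNIV \<rightarrow> {0, 1}. cone_monomial g a * s a)" "\<forall>a. s a \<in> sos"
    using assms unfolding preorder_cone_def' by blast
  have "lift_poly (cone_monomial g a) = (cone_monomial (\<lambda>j. lift_poly (g j)) a :: ('n, 'k) var mpoly)" for a
    by (simp add: cone_monomial_def lift_poly.prod)
  then have "lift_poly p = (\<Sum>a\<in>UNIV \<rightarrow> {0, 1}.
      cone_monomial (\<lambda>j. lift_poly (g j)) a * lift_poly (s a) :: ('n, 'k) var mpoly)"
    unfolding s(1) by (simp add: lift_poly.sum)
  then show ?thesis
    using preorder_coneI[of "\<lambda>a. lift_poly (s a)" "\<lambda>j. lift_poly (g j)"] s(2) by (simp add: lift_sos)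
qed

lemma lift_quad_module:
  fixes g :: "'m::finite \<Rightarrow> 'n mpoly"
  assumes "p \<in> quad_module g"
  shows "lift_poly p \<in> quad_module (\<lambda>j. lift_poly (g j) :: ('n, 'k) var mpoly)"
proof -
  obtain s0 s where s: "p = s0 + (\<Sum>j\<in>UNIV. g j * s j)" "s0 \<in> sos" "\<forall>j. s j \<in> sos"
    using assms unfolding quad_module_def by blast
  have "lift_poly p = (lift_poly s0 + (\<Sum>j\<in>UNIV. lift_poly (g j) * lift_poly (s j)) :: ('n, 'k) var mpoly)"
    unfolding s(1) by (simp add: lift_poly.sum)
  then show ?thesis
    using quad_moduleI[of "lift_poly s0" "\<lambda>j. lift_poly (s j)" "\<lambda>j. lift_poly (g j)"] s(2,3)
    by (simp add: lift_sos)
qed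

text \<open>The common part of both cases. \<open>T\<close> is \<open>K\<close> enlarged by the
  ideal of \<open>h\<close>; a point where \<open>h\<close>, \<open>- h\<close> and all
  \<open>g j\<close> are nonnegative would be a zero of \<open>h\<close> in
  \<open>nonneg_set g\<close>. So - 1 is in \<open>T\<close>, and its component in \<open>K\<close>
  is the certificate.\<close>

lemma certificate_if_no_point:
  fixes g :: "'m::finite \<Rightarrow> 'v::finite mpoly"
  assumes no_point: "\<And>x. x \<in> nonneg_set g \<Longrightarrow> peval h x \<noteq> 0"
    and K: "sos \<subseteq> K" "range g \<subseteq> K"
  defines "T \<equiv> {p + h * r | p r. p \<in> K}"
  assumes point: "\<And>G. - 1 \<notin> T \<Longrightarrow> finite G \<Longrightarrow> G \<subseteq> T \<Longrightarrow> \<exists>x. \<forall>p\<in>G. peval p x \<ge> 0"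
  shows "\<exists>p\<in>K. \<forall>x. peval h x = 0 \<longrightarrow> peval p x = - 1"
proof -
  have T: "p + h * r \<in> T" if "p \<in> K" for p r
    using that by (auto simp: T_def)
  have "- 1 \<in> T"
  proof (rule ccontr)
    assume "- 1 \<notin> T"
    have "h \<in> T" "- h \<in> T"
      using T[of 0 1] T[of 0 "- 1"] K(1) sos_zero by auto
    moreover have "g j \<in> T" for j
      using T[of "g j" 0] K(2) by auto
    ultimately have sub: "insert h (insert (- h) (range g)) \<subseteq> T"
      by blast
    have "finite (insert h (insert (- h) (range g)))"
      by simp
    from point[OF \<open>- 1 \<notin> T\<close> this sub] obtain x where
      x: "\<forall>p\<in>insert h (insert (- h) (range g)). peval p x \<ge> 0" ..
    then have "x \<in> nonneg_set g"
      by (simp add: nonneg_set_def)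
    moreover have "peval h x = 0"
      using x by simp
    ultimately show False
      using no_point by blast
  qed
  then obtain p r where p: "p \<in> K" "- 1 = p + h * r"
    by (auto simp: T_def)
  have "peval p x = - 1" if "peval h x = 0" for x
    using arg_cong[OF p(2), of "\<lambda>p. peval p x"] that by simp
  then show ?thesis
    using p(1) by blast
qed

lemma preorder_cone_certificate:
  fixes g :: "'m::finite \<Rightarrow> 'v::finite mpoly"
  assumes "\<And>x. x \<in> nonneg_set g \<Longrightarrow> peval h x \<noteq> 0"
  shows "\<exists>p\<in>preorder_cone g. \<forall>x. peval h x = 0 \<longrightarrow> peval p x = - 1"
proof (rule certificate_if_no_point[OF assms sos_subset_preorder_cone])
  show "range g \<subseteq> preorder_cone g"
    using generator_mem_preorder_cone by blast
  let ?T = "{p + h * r | p r. p \<in> preorder_cone g}"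
  have T: "p + h * r \<in> ?T" if "p \<in> preorder_cone g" for p r
    using that by auto
  have "ring_preordering ?T"
    unfolding ring_preordering_def
  proof (intro conjI ballI allI)
    fix x y assume "x \<in> ?T" "y \<in> ?T"
    then obtain p r q s where *: "p \<in> preorder_cone g" "q \<in> preorder_cone g" "x = p + h * r" "y = q + h * s"
      by auto
    have xy: "x + y = (p + q) + h * (r + s)"
      using *(3,4) by (simp add: algebra_simps)
    show "x + y \<in> ?T"
      unfolding xy by (rule T[OF preorder_cone_add[OF *(1,2)]])
    have xy: "x * y = p * q + h * (p * s + q * r + h * r * s)"
      using *(3,4) by (simp add: algebra_simps)
    show "x * y \<in> ?T"
      unfolding xy by (rule T[OF preorder_cone_mult[OF *(1,2)]])
  next
    fix x
    have xx: "x * x = x\<^sup>2 + h * 0"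
      by (simp add: power2_eq_square)
    show "x * x \<in> ?T"
      unfolding xx by (rule T[OF subsetD[OF sos_subset_preorder_cone sos_square]])
  qed
  then show "\<exists>x. \<forall>p\<in>G. peval p x \<ge> 0" if "- 1 \<notin> ?T" "finite G" "G \<subseteq> ?T" for G
    by (rule positivstellensatz[OF _ that]) blast
qed

lemma quad_module_certificate:
  fixes g :: "'m::finite \<Rightarrow> 'v::finite mpoly"
  assumes "\<And>x. x \<in> nonneg_set g \<Longrightarrow> peval h x \<noteq> 0" "archimedean g"
  shows "\<exists>p\<in>quad_module g. \<forall>x. peval h x = 0 \<longrightarrow> peval p x = - 1"
proof (rule certificate_if_no_point[OF assms(1) sos_subset_quad_module])
  show "range g \<subseteq> quad_module g"
    using generator_mem_quad_module by blast
  let ?T = "{p + h * r | p r. p \<in> quad_module g}"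
  have T: "p + h * r \<in> ?T" if "p \<in> quad_module g" for p r
    using that by auto
  have sub: "p \<in> ?T" if "p \<in> quad_module g" for p
    using T[OF that, of 0] by (simp only: mult_zero_right add_0_right)
  have qm: "quadratic_module ?T"
    unfolding quadratic_module_def
  proof (intro conjI ballI allI)
    show "1 \<in> ?T"
      by (rule sub[OF subsetD[OF sos_subset_quad_module sos_one]])
  next
    fix x y assume "x \<in> ?T" "y \<in> ?T"
    then obtain p r q s where *: "p \<in> quad_module g" "q \<in> quad_module g" "x = p + h * r" "y = q + h * s"
      by auto
    have xy: "x + y = (p + q) + h * (r + s)"
      using *(3,4) by (simp add: algebra_simps)
    show "x + y \<in> ?T"
      unfolding xy by (rule T[OF quad_module_add[OF *(1,2)]])
  next
    fix x a assume "x \<in> ?T"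
    then obtain p r where *: "p \<in> quad_module g" "x = p + h * r"
      by auto
    have aax: "a * a * x = a\<^sup>2 * p + h * (a * a * r)"
      using *(2) by (simp add: power2_eq_square algebra_simps)
    show "a * a * x \<in> ?T"
      unfolding aax by (rule T[OF quad_module_scale[OF sos_square *(1)]])
  qed
  obtain R where R: "Const R - (\<Sum>i\<in>UNIV. (Var i)\<^sup>2) \<in> quad_module g"
    using assms(2) unfolding archimedean_def by blast
  show "\<exists>x. \<forall>p\<in>G. peval p x \<ge> 0" if "- 1 \<notin> ?T" "G \<subseteq> ?T" for G
  proof (rule archimedean_real_point[OF qm that(1) sub[OF R]])
    fix x
    assume "\<And>p. p \<in> ?T \<Longrightarrow> peval p x \<ge> 0"
    then show ?thesis
      using that(2) by blast
  qed
qed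

lemma peval_poly_Const: "peval (poly (map_poly Const q) f) x = poly q (peval f x)"
  by (induction q) (auto simp: map_poly_pCons)

text \<open>The Lagrange polynomials of the finite value set, composed with \<open>f\<close>, are 0
  or 1 on \<open>W\<close>. Hence they may be squared without changing their values there, and the
  squares keep the interpolating sum in the cone.\<close>

lemma interpolate_in_cone:
  fixes f :: "'v::finite mpoly"
  assumes fin: "finite ((\<lambda>z. peval f z) ` W)"
    and C: "sos \<subseteq> C" "\<And>p q. p \<in> C \<Longrightarrow> q \<in> C \<Longrightarrow> p + q \<in> C" "\<And>s p. s \<in> sos \<Longrightarrow> p \<in> C \<Longrightarrow> s * p \<in> C"
    and neg: "\<And>v. v < 0 \<Longrightarrow> \<exists>p\<in>C. \<forall>z. peval f z = v \<longrightarrow> peval p z = - 1"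
  shows "\<exists>q\<in>C. \<forall>z\<in>W. peval q z = peval f z"
proof -
  define V where "V = (\<lambda>z. peval f z) ` W"
  have "\<exists>p\<in>C. \<forall>z. peval f z = v \<longrightarrow> peval p z = v" for v
  proof (cases "v \<ge> 0")
    case True
    then show ?thesis
      using C(1) sos_Const[of v] by (intro bexI[of _ "Const v"]) auto
  next
    case False
    then obtain p where "p \<in> C" "\<forall>z. peval f z = v \<longrightarrow> peval p z = - 1"
      using neg[of v] by auto
    then show ?thesis
      using False by (intro bexI[of _ "Const (- v) * p"] C(3) sos_Const) auto
  qed
  then obtain c where c: "\<And>v. c v \<in> C" "\<And>v z. peval f z = v \<Longrightarrow> peval (c v) z = v"
    by metis
  define L where "L v = (\<Prod>w\<in>V - {v}. Const (1 / (v - w)) * (f - Const w))" for v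
  define q where "q = (\<Sum>v\<in>V. (L v)\<^sup>2 * c v)"
  have "finite V"
    using fin by (simp add: V_def)
  have "(\<Sum>v\<in>A. (L v)\<^sup>2 * c v) \<in> C" if "finite A" for A
    using that
  proof (induction A rule: finite_induct)
    case empty
    then show ?case
      using C(1) sos_zero by auto
  next
    case (insert v A)
    then show ?case
      using C(2)[OF C(3)[OF sos_square c(1)]] by simp
  qed
  then have "q \<in> C"
    using \<open>finite V\<close> by (simp add: q_def)
  moreover have "peval q z = peval f z" if z: "z \<in> W" for z
  proof -
    define u where "u = peval f z"
    have u: "u \<in> V"
      using z by (simp add: u_def V_def)
    have L: "peval (L v) z = (\<Prod>w\<in>V - {v}. 1 / (v - w) * (u - w))" for v
      by (simp add: L_def peval.prod u_def)
    have "peval (L v) z = (if v = u then 1 else 0)" if "v \<in> V" for v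
    proof (cases "v = u")
      case True
      then show ?thesis
        unfolding L by (auto intro: prod.neutral)
    next
      case False
      then have "u \<in> V - {v}"
        using u by simp
      then have "(\<Prod>w\<in>V - {v}. 1 / (v - w) * (u - w)) = 0"
        using \<open>finite V\<close> by (intro prod_zero) auto
      then show ?thesis
        using False by (simp add: L)
    qed
    then have "(\<Sum>v\<in>V. (peval (L v) z)\<^sup>2 * peval (c v) z) = (\<Sum>v\<in>V. if v = u then peval (c v) z else 0)"
      by (intro sum.cong) auto
    also have "\<dots> = peval (c u) z"
      using \<open>finite V\<close> u by simp
    finally show ?thesis
      using c(2)[of z u] by (simp add: q_def peval.sum u_def)
  qed
  ultimately show ?thesis
    by blast
qed

section \<open>Finitely many critical values\<close>

lemma derivation_lift_chain_rule:
  fixes I :: "('n::finite + 'm option) mpoly set" and p :: "'n mpoly"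
  assumes "ideal_set I"
    and D: "\<And>x y. D (x + y) - (D x + D y) \<in> I" "\<And>x y. D (x * y) - (x * D y + y * D x) \<in> I"
      "\<And>c. D (Const c) \<in> I"
  shows "D (lift_poly p) - (\<Sum>i\<in>UNIV. lift_poly (pdiff i p) * D (Var (Inl i))) \<in> I"
proof -
  interpret ideal_set I by fact
  let ?S = "\<lambda>p. \<Sum>i\<in>UNIV. lift_poly (pdiff i p) * D (Var (Inl i))"
  have "D (lift_poly p) \<doteq> ?S p"
  proof (induction p rule: mpoly_induct)
    case (Const c)
    then show ?case
      using D(3) by (simp add: eqv_def)
  next
    case (Var v)
    have "?S (Var v) = (\<Sum>i\<in>UNIV. if i = v then D (Var (Inl i)) else 0)"
      by (intro sum.cong) (auto simp: pdiff_Var)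
    then show ?case
      by (simp add: eqv_refl)
  next
    case (add p q)
    have "D (lift_poly p + lift_poly q) \<doteq> D (lift_poly p) + D (lift_poly q)"
      using D(1) by (simp add: eqv_def)
    also have "\<dots> \<doteq> ?S p + ?S q"
      by (intro eqv_add add)
    also have "?S p + ?S q = ?S (p + q)"
      by (simp add: pdiff_add sum.distrib algebra_simps)
    finally show ?case
      by simp
  next
    case (mult p q)
    have "D (lift_poly p * lift_poly q) \<doteq> lift_poly p * D (lift_poly q) + lift_poly q * D (lift_poly p)"
      using D(2) by (simp add: eqv_def)
    also have "\<dots> \<doteq> lift_poly p * ?S q + lift_poly q * ?S p"
      by (intro eqv_add eqv_mult mult)
    also have "lift_poly p * ?S q + lift_poly q * ?S p = ?S (p * q)"
      by (simp add: pdiff_mult sum.distrib sum_distrib_left algebra_simps)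
    finally show ?case
      by simp
  qed
  then show ?thesis
    by (simp add: eqv_def)
qed

lemma finite_critical_values:
  fixes f :: "'n::finite mpoly" and g :: "'m::finite \<Rightarrow> 'n mpoly"
  defines "W \<equiv> {z \<in> zero_set (h_FJ f g). peval (lam None) z \<noteq> 0}"
  shows "finite ((\<lambda>z. peval (lift_poly f) z) ` W)"
proof (rule ccontr)
  let ?F = "lift_poly f :: ('n, 'm) var mpoly" and ?l = "lam None :: ('n, 'm) var mpoly"
  assume inf: "infinite ((\<lambda>z. peval ?F z) ` W)"
  define J where "J = {p :: ('n, 'm) var mpoly. \<forall>z\<in>W. peval p z = 0}"
  \<comment> \<open>One multiplicative set for two purposes: an ideal prime and disjoint from it
    omits \<open>lam None\<close> and contains no nonzero polynomial in \<open>f\<close>.\<close>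
  define M where "M = {?l ^ k * poly (map_poly Const q) ?F | k q. q \<noteq> 0}"
  have M: "?l ^ k * poly (map_poly Const q) ?F \<in> M" if "q \<noteq> 0" for k q
    using that by (auto simp: M_def)
  have one: "poly (map_poly Const 1) ?F = 1"
    by (simp add: one_pCons map_poly_pCons)
  have "ideal_set J"
    by unfold_locales (auto simp: J_def)
  moreover have "J \<inter> M = {}"
  proof -
    \<comment> \<open>On \<open>W\<close> the factor \<open>lam None\<close> is nonzero, so a common
      member would confine the values of \<open>f\<close> to the roots of \<open>q\<close>.\<close>
    have False if "?l ^ k * poly (map_poly Const q) ?F \<in> J" "q \<noteq> 0" for k q
    proof -
      have "poly q (peval ?F z) = 0" if "z \<in> W" for z
        using \<open>?l ^ k * poly (map_poly Const q) ?F \<in> J\<close> that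
        by (auto simp: J_def W_def peval_poly_Const)
      then have "(\<lambda>z. peval ?F z) ` W \<subseteq> {x. poly q x = 0}"
        by blast
      then show False
        using inf poly_roots_finite[OF that(2)] finite_subset by blast
    qed
    then show ?thesis
      by (auto simp: M_def)
  qed
  moreover have "1 \<in> M"
    using M[of 1 0] one by simp
  moreover have "x * y \<in> M" if xy: "x \<in> M" "y \<in> M" for x y
  proof -
    obtain k q k' q' where *: "x = ?l ^ k * poly (map_poly Const q) ?F" "q \<noteq> 0"
        "y = ?l ^ k' * poly (map_poly Const q') ?F" "q' \<noteq> 0"
      using xy by (auto simp: M_def)
    then show ?thesis
      using M[of "q * q'" "k + k'"] by (simp add: Const.map_poly_mult power_add mult_ac)
  qed
  ultimately obtain I where I: "prime_ideal_set I" "J \<subseteq> I" "I \<inter> M = {}"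
    using ex_prime_ideal_disjoint[of J M] by metis
  interpret prime_ideal_set I
    by (rule I(1))
  have "q = 0" if "poly (map_poly Const q) ?F \<in> I" for q
    using I(3) that M[of q 0] by auto
  from transcendental_derivation[OF I(1) this] obtain D where D:
    "\<And>x y. D (x + y) - (D x + D y) \<in> I" "\<And>x y. D (x * y) - (x * D y + y * D x) \<in> I"
    "\<And>x. x \<in> I \<Longrightarrow> D x \<in> I" "\<And>c. D (Const c) \<in> I" "D ?F \<notin> I"
    by metis
  have l: "?l \<notin> I"
    using I(3) M[of 1 1] one by auto
  have h: "h_FJ f g k \<in> I" for k
    using I(2) by (auto simp: J_def W_def zero_set_def)
  let ?d = "\<lambda>i. D (Var (Inl i))"
  have chain: "eqv (D (lift_poly p)) (\<Sum>i\<in>UNIV. lift_poly (pdiff i p) * ?d i)" for p :: "'n mpoly"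
    using derivation_lift_chain_rule[OF ideal_set_axioms D(1,2,4)] by (simp add: eqv_def)
  have g: "lam (Some j) * D (lift_poly (g j)) \<in> I" for j
  proof -
    have "lam (Some j) * lift_poly (g j) \<in> I"
      using h[of "Inr (Inl j)"] by simp
    then show ?thesis
      using prime D(3) mult mult_right by blast
  qed
  \<comment> \<open>The gradient entries of \<open>h_FJ\<close>, taken modulo \<open>I\<close>,
    exchange the differential of \<open>f\<close> for those of the \<open>g j\<close>.\<close>
  have "eqv (?l * D ?F) (?l * (\<Sum>i\<in>UNIV. lift_poly (pdiff i f) * ?d i))"
    by (rule eqv_mult[OF chain])
  also have "\<dots> = (\<Sum>i\<in>UNIV. ?d i * (?l * lift_poly (pdiff i f)))"
    by (simp add: sum_distrib_left mult_ac)
  also have "eqv \<dots> (\<Sum>i\<in>UNIV. ?d i * (\<Sum>j\<in>UNIV. lam (Some j) * lift_poly (pdiff i (g j))))"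
    using h[of "Inl _"] by (intro eqv_sum eqv_mult) (simp add: eqv_def)
  also have "\<dots> = (\<Sum>j\<in>UNIV. lam (Some j) * (\<Sum>i\<in>UNIV. lift_poly (pdiff i (g j)) * ?d i))"
    unfolding sum_distrib_left by (subst sum.swap) (simp add: mult_ac)
  also have "eqv \<dots> (\<Sum>j\<in>UNIV. lam (Some j) * D (lift_poly (g j)))"
    by (intro eqv_sum eqv_mult eqv_sym[OF chain])
  finally have "?l * D ?F \<in> I"
    using eqv_mem sum[of UNIV "\<lambda>j. lam (Some j) * D (lift_poly (g j))"] g by blast
  then show False
    using prime l D(5) by blast
qed

text \<open>The factor \<open>lam None\<close> settles the points where it vanishes. On the others,
  certificates found in \<open>x\<close> alone are lifted and interpolated.\<close>

lemma representation_on_FJ_points: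
  fixes f :: "'n::finite mpoly" and g :: "'m::finite \<Rightarrow> 'n mpoly"
  assumes C: "sos \<subseteq> C" "\<And>p q. p \<in> C \<Longrightarrow> q \<in> C \<Longrightarrow> p + q \<in> C" "\<And>s p. s \<in> sos \<Longrightarrow> p \<in> C \<Longrightarrow> s * p \<in> C"
    and neg: "\<And>v. v < 0 \<Longrightarrow> \<exists>p. lift_poly p \<in> C \<and> (\<forall>x. peval (f - Const v) x = 0 \<longrightarrow> peval p x = - 1)"
  shows "\<exists>q\<in>C. \<forall>z\<in>zero_set (h_FJ f g). peval (lam None * (lift_poly f - q)) z = 0"
proof -
  have "\<exists>q\<in>C. \<forall>z\<in>{z \<in> zero_set (h_FJ f g). peval (lam None) z \<noteq> 0}. peval q z = peval (lift_poly f) z"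
  proof (rule interpolate_in_cone[OF finite_critical_values C])
    fix v :: real
    assume "v < 0"
    then obtain p where "lift_poly p \<in> C" "\<forall>x. peval (f - Const v) x = 0 \<longrightarrow> peval p x = - 1"
      using neg by blast
    then show "\<exists>p\<in>C. \<forall>z. peval (lift_poly f) z = v \<longrightarrow> peval p z = - 1"
      by (intro bexI[of _ "lift_poly p"]) (simp_all add: peval_lift_poly)
  qed
  then obtain q where "q \<in> C" "\<forall>z\<in>{z \<in> zero_set (h_FJ f g). peval (lam None) z \<noteq> 0}. peval q z = peval (lift_poly f) z"
    by blast
  then show ?thesis
    by (intro bexI[of _ q]) auto
qed

theorem theorem9:
  fixes f :: "'n::finite mpoly"
    and g :: "'m::finite \<Rightarrow> 'n mpoly"
  assumes "\<And>x. x \<in> nonneg_set g \<Longrightarrow> peval f x \<ge> 0"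
  shows "(\<exists>q \<in> preorder_cone (\<lambda>j. lift_poly (g j)).
            \<forall>z \<in> zero_set (h_FJ f g). peval (lam None * (lift_poly f - q)) z = 0)
       \<and> (archimedean g \<longrightarrow>
           (\<exists>q \<in> quad_module (\<lambda>j. lift_poly (g j)).
              \<forall>z \<in> zero_set (h_FJ f g). peval (lam None * (lift_poly f - q)) z = 0))"
proof (intro conjI impI)
  have nz: "peval (f - Const v) x \<noteq> 0" if "v < 0" "x \<in> nonneg_set g" for v x
    using assms[OF that(2)] that(1) by simp
  show "\<exists>q \<in> preorder_cone (\<lambda>j. lift_poly (g j)).
      \<forall>z \<in> zero_set (h_FJ f g). peval (lam None * (lift_poly f - q)) z = 0"
  proof (rule representation_on_FJ_points)
    show "\<exists>p. lift_poly p \<in> preorder_cone (\<lambda>j. lift_poly (g j)) \<and>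
        (\<forall>x. peval (f - Const v) x = 0 \<longrightarrow> peval p x = - 1)" if "v < 0" for v
      using preorder_cone_certificate[OF nz[OF that]] lift_preorder_cone by blast
  qed (use sos_subset_preorder_cone in \<open>auto intro: preorder_cone_add preorder_cone_mult\<close>)
  show "\<exists>q \<in> quad_module (\<lambda>j. lift_poly (g j)).
      \<forall>z \<in> zero_set (h_FJ f g). peval (lam None * (lift_poly f - q)) z = 0" if arch: "archimedean g"
  proof (rule representation_on_FJ_points)
    show "\<exists>p. lift_poly p \<in> quad_module (\<lambda>j. lift_poly (g j)) \<and>
        (\<forall>x. peval (f - Const v) x = 0 \<longrightarrow> peval p x = - 1)" if "v < 0" for v
      using quad_module_certificate[OF nz[OF that] arch] lift_quad_module by blast
  qed (use sos_subset_quad_module in \<open>auto intro: quad_module_add quad_module_scale\<close>)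
qed

end
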